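(* Let $\hat\xi_t\in\mathbb R^{(L+1)n}$, let $\tilde V_t$ be symmetric positive definite, and let $c_t>0$. Define $$\tilde G_t=\tilde A\tilde V_t\tilde C^\top(\tilde C\tilde V_t\tilde C^\top+\tilde D\tilde D^\top)^{-1},\qquad \tilde P_{t+1}=\tilde A\tilde V_t\tilde A^\top-\tilde G_t(\tilde C\tilde V_t\tilde C^\top+\tilde D\tilde D^\top)\tilde G_t^\top+\tilde B\tilde B^\top,$$ and $g_t^0(y)=\tilde A\hat\xi_t+\tilde G_t(y-\tilde C\hat\xi_t)$. Then: (i) the function $$\gamma(\lambda)=\frac12\Big[\mathrm{tr}\big((I-\lambda^{-1}\tilde H^\top\tilde H\tilde P_{t+1})^{-1}-I\big)+\ln\det(I-\lambda^{-1}\tilde H^\top\tilde H\tilde P_{t+1})\Big]$$ is strictly decreasing on $(r(\tilde H\tilde P_{t+1}\tilde H^\top),\infty)$, with $\gamma(\lambda)\to+\infty$ as $\lambda\downarrow r(\tilde H\tilde P_{t+1}\tilde H^\top)$ and $\gamma(\lambda)\to0$ as $\lambda\to\infty$; hence there is a unique $\lambda_t>r(\tilde H\tilde P_{t+1}\tilde H^\top)$ with $\gamma(\lambda_t)=c_t$; (ii) with $\tilde V_{t+1}=(\tilde P_{t+1}^{-1}-\lambda_t^{-1}\tilde H^\top\tilde H)^{-1}$ (positive definite), let $\tilde f_t^0=\mathcal N(m_{z_t\mid Y_{t-1}},\tilde K^0)$ with $$\tilde K^0=\begin{bmatrix}I&\tilde G_t\\0&I\end{bmatrix}\begin{bmatrix}\tilde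 V_{t+1}&0\\0&\tilde C\tilde V_t\tilde C^\top+\tilde D\tilde D^\top\end{bmatrix}\begin{bmatrix}I&0\\ \tilde G_t^\top&I\end{bmatrix};$$ then $\tilde f_t^0\in\bar{\mathcal B}_t$ with $D(\tilde f_t^0\|\bar f_t)=c_t$, $\tilde f^0_t$ is a non-degenerate Gaussian density, and $(g_t^0,\tilde f_t^0)$ is a saddle point of the minimax problem $\min_{g\in\bar{\mathcal G}_t}\max_{\tilde f\in\bar{\mathcal B}_t}J_t(\tilde f,g)$, i.e. $J_t(\tilde f,g_t^0)\le J_t(\tilde f_t^0,g_t^0)\le J_t(\tilde f_t^0,g)$ for all $\tilde f\in\bar{\mathcal B}_t$, $g\in\bar{\mathcal G}_t$; (iii) under $\tilde f_t^0$, the conditional distribution of $\xi_{t+1}$ given $y_t$ is Gaussian with mean $g_t^0(y_t)$ and covariance $\tilde V_{t+1}$, while $\tilde P_{t+1}$ is the corresponding conditional covariance under $\bar f_t$.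
   Context: $A\in\mathbb R^{n\times n}$, $B\in\mathbb R^{n\times(n+m)}$, $C\in\mathbb R^{m\times n}$, $D\in\mathbb R^{m\times(n+m)}$ with $BD^\top=0$, $\mathrm{rank}(B)=n$, $\mathrm{rank}(D)=m$. Fix $L\ge1$. $\tilde A\in\mathbb R^{(L+1)n\times(L+1)n}$ is the block matrix with $A$ in block $(1,1)$, $I_n$ in blocks $(i+1,i)$ for $i=1,\dots,L$, zero blocks elsewhere; $\tilde B=[B^\top\ 0\ \cdots\ 0]^\top$; $\tilde C=[C\ 0\ \cdots\ 0]$; $\tilde D=D$; $\tilde H=[0\ \cdots\ 0\ I_n]\in\mathbb R^{n\times(L+1)n}$. For a symmetric matrix $P$, $r(P)$ is its largest eigenvalue. Write $z_t=[\xi_{t+1}^\top\ y_t^\top]^\top\in\mathbb R^{(L+1)n+m}$. The nominal predictive density is $\bar f_t=\mathcal N(m_{z_t\mid Y_{t-1}},K_{z_t\mid Y_{t-1}})$ with $m_{z_t\mid Y_{t-1}}=[\tilde A^\top\ \tilde C^\top]^\top\hat\xi_t$ and $K_{z_t\mid Y_{t-1}}=[\tilde A^\top\ \tilde C^\top]^\top\tilde V_t[\tilde A^\top\ \tilde C^\top]+[\tilde B^\top\ \tilde D^\top]^\top[\tilde B^\top\ \tilde D^\top]$. The ambiguity set $\bar{\mathcal B}_t$ is the set of probability densities $\tilde f$ on $\mathbb R^{(L+1)n+m}$ with Kullback–Leibler divergence $D(\tilde f\|\bar f_t)=\int\tilde f\ln(\tilde f/\bar f_t)\le c_t$. $\bar{\mathcal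 G}_t$ is the set of measurable estimators $g:\mathbb R^m\to\mathbb R^{(L+1)n}$ with finite second-order moments under every $\tilde f\in\bar{\mathcal B}_t$. The cost is $J_t(\tilde f,g)=\frac12\int\|\tilde H(\xi_{t+1}-g(y_t))\|^2\tilde f(z_t)\,dz_t$. *)

theory Defs
  imports "HOL-Analysis.Analysis" "Jordan_Normal_Form.Gauss_Jordan_Elimination"
          "Jordan_Normal_Form.DL_Rank" "Jordan_Normal_Form.Char_Poly"
begin

definition minv :: "real mat \<Rightarrow> real mat" where
  "minv M = the (mat_inverse M)"

definition mtrace :: "real mat \<Rightarrow> real" where
  "mtrace M = (\<Sum>i<dim_row M. M $$ (i, i))"

definition sym_pd :: "nat \<Rightarrow> real mat \<Rightarrow> bool" where
  "sym_pd d M \<longleftrightarrow> M \<in> carrier_mat d d \<and> transpose_mat M = M \<and>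
     (\<forall>v \<in> carrier_vec d. v \<noteq> 0\<^sub>v d \<longrightarrow> 0 < scalar_prod v (M *\<^sub>v v))"

definition lmax :: "real mat \<Rightarrow> real" where
  "lmax M = Max {k. eigenvalue M k}"

definition dimxi :: "nat \<Rightarrow> nat \<Rightarrow> nat" where
  "dimxi n L = Suc L * n"

definition tA :: "nat \<Rightarrow> nat \<Rightarrow> real mat \<Rightarrow> real mat" where
  "tA n L A = mat (dimxi n L) (dimxi n L)
     (\<lambda>(i, j). if i < n \<and> j < n then A $$ (i, j)
               else if n \<le> i \<and> j + n = i then 1 else 0)"

definition tB :: "nat \<Rightarrow> nat \<Rightarrow> real mat \<Rightarrow> real mat" where
  "tB n L B = mat (dimxi n L) (dim_col B) (\<lambda>(i, j). if i < n then B $$ (i, j) else 0)"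

definition tC :: "nat \<Rightarrow> nat \<Rightarrow> real mat \<Rightarrow> real mat" where
  "tC n L C = mat (dim_row C) (dimxi n L) (\<lambda>(i, j). if j < n then C $$ (i, j) else 0)"

definition tH :: "nat \<Rightarrow> nat \<Rightarrow> real mat" where
  "tH n L = mat n (dimxi n L) (\<lambda>(i, j). if j = L * n + i then 1 else 0)"

definition stack :: "real mat \<Rightarrow> real mat \<Rightarrow> real mat" where
  "stack X Y = mat (dim_row X + dim_row Y) (dim_col X)
     (\<lambda>(i, j). if i < dim_row X then X $$ (i, j) else Y $$ (i - dim_row X, j))"

definition innov :: "real mat \<Rightarrow> real mat \<Rightarrow> real mat \<Rightarrow> real mat" where
  "innov Ct Dt V = Ct * V * transpose_mat Ct + Dt * transpose_mat Dt"

definition gainG :: "real mat \<Rightarrow> real mat \<Rightarrow> real mat \<Rightarrow> real mat \<Rightarrow> real mat" where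
  "gainG At Ct Dt V = At * V * transpose_mat Ct * minv (innov Ct Dt V)"

definition predP :: "real mat \<Rightarrow> real mat \<Rightarrow> real mat \<Rightarrow> real mat \<Rightarrow> real mat \<Rightarrow> real mat" where
  "predP At Bt Ct Dt V = At * V * transpose_mat At
      - gainG At Ct Dt V * innov Ct Dt V * transpose_mat (gainG At Ct Dt V)
      + Bt * transpose_mat Bt"

definition gammaf :: "nat \<Rightarrow> real mat \<Rightarrow> real mat \<Rightarrow> real \<Rightarrow> real" where
  "gammaf N H P lam =
     (let Q = 1\<^sub>m N - (1 / lam) \<cdot>\<^sub>m (transpose_mat H * H * P)
      in (1/2) * (mtrace (minv Q - 1\<^sub>m N) + ln (det Q)))"

text \<open>Lebesgue measure on R^d, points are (extensional) functions on {..<d}.\<close>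
definition Rsp :: "nat \<Rightarrow> (nat \<Rightarrow> real) measure" where
  "Rsp d = PiM {..<d} (\<lambda>_. lborel)"

definition gauss :: "nat \<Rightarrow> real vec \<Rightarrow> real mat \<Rightarrow> (nat \<Rightarrow> real) \<Rightarrow> real" where
  "gauss d mu K z =
     exp (- (1/2) * scalar_prod (vec d z - mu) (minv K *\<^sub>v (vec d z - mu)))
       / sqrt ((2 * pi) ^ d * det K)"

definition is_density :: "nat \<Rightarrow> ((nat \<Rightarrow> real) \<Rightarrow> real) \<Rightarrow> bool" where
  "is_density d f \<longleftrightarrow> f \<in> borel_measurable (Rsp d) \<and> (\<forall>z \<in> space (Rsp d). 0 \<le> f z)
      \<and> integrable (Rsp d) f \<and> integral\<^sup>L (Rsp d) f = 1"

definition KL :: "nat \<Rightarrow> ((nat \<Rightarrow> real) \<Rightarrow> real) \<Rightarrow> ((nat \<Rightarrow> real) \<Rightarrow> real) \<Rightarrow> real" where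
  "KL d f g = (\<integral>z. f z * ln (f z / g z) \<partial>Rsp d)"

definition amb :: "nat \<Rightarrow> ((nat \<Rightarrow> real) \<Rightarrow> real) \<Rightarrow> real \<Rightarrow> ((nat \<Rightarrow> real) \<Rightarrow> real) set" where
  "amb d fbar c = {f. is_density d f \<and> integrable (Rsp d) (\<lambda>z. f z * ln (f z / fbar z))
                      \<and> KL d f fbar \<le> c}"

definition xpart :: "nat \<Rightarrow> (nat \<Rightarrow> real) \<Rightarrow> (nat \<Rightarrow> real)" where
  "xpart N z = (\<lambda>i. if i < N then z i else undefined)"

definition ypart :: "nat \<Rightarrow> nat \<Rightarrow> (nat \<Rightarrow> real) \<Rightarrow> (nat \<Rightarrow> real)" where
  "ypart N m z = (\<lambda>i. if i < m then z (N + i) else undefined)"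

definition join :: "nat \<Rightarrow> nat \<Rightarrow> (nat \<Rightarrow> real) \<Rightarrow> (nat \<Rightarrow> real) \<Rightarrow> (nat \<Rightarrow> real)" where
  "join N m x y = (\<lambda>i. if i < N then x i else if i < N + m then y (i - N) else undefined)"

definition marg :: "nat \<Rightarrow> nat \<Rightarrow> ((nat \<Rightarrow> real) \<Rightarrow> real) \<Rightarrow> (nat \<Rightarrow> real) \<Rightarrow> real" where
  "marg N m f y = (\<integral>x. f (join N m x y) \<partial>Rsp N)"

definition sqnorm :: "real vec \<Rightarrow> real" where
  "sqnorm v = (\<Sum>i<dim_vec v. (v $ i)\<^sup>2)"

definition estims :: "nat \<Rightarrow> nat \<Rightarrow> ((nat \<Rightarrow> real) \<Rightarrow> real) set
     \<Rightarrow> ((nat \<Rightarrow> real) \<Rightarrow> (nat \<Rightarrow> real)) set" where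
  "estims N m Bs = {g. g \<in> Rsp m \<rightarrow>\<^sub>M Rsp N \<and>
     (\<forall>f \<in> Bs. (\<integral>\<^sup>+ z. ennreal (f z * sqnorm (vec N (g (ypart N m z)))) \<partial>Rsp (N + m)) < \<infinity>)}"

definition cost :: "nat \<Rightarrow> nat \<Rightarrow> real mat \<Rightarrow> ((nat \<Rightarrow> real) \<Rightarrow> real)
     \<Rightarrow> ((nat \<Rightarrow> real) \<Rightarrow> (nat \<Rightarrow> real)) \<Rightarrow> ennreal" where
  "cost N m H f g = ennreal (1/2) *
     (\<integral>\<^sup>+ z. ennreal (sqnorm (H *\<^sub>v vec N (\<lambda>i. z i - g (ypart N m z) i)) * f z) \<partial>Rsp (N + m))"

definition g0v :: "nat \<Rightarrow> real mat \<Rightarrow> real mat \<Rightarrow> real mat \<Rightarrow> real vec \<Rightarrow> (nat \<Rightarrow> real) \<Rightarrow> real vec" where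
  "g0v m At Ct G xi y = At *\<^sub>v xi + G *\<^sub>v (vec m y - Ct *\<^sub>v xi)"

definition g0f :: "nat \<Rightarrow> nat \<Rightarrow> real mat \<Rightarrow> real mat \<Rightarrow> real mat \<Rightarrow> real vec
     \<Rightarrow> (nat \<Rightarrow> real) \<Rightarrow> (nat \<Rightarrow> real)" where
  "g0f N m At Ct G xi y = (\<lambda>i. if i < N then g0v m At Ct G xi y $ i else undefined)"

end

theory Submission
  imports "HOL-Probability.Distributions" "HOL-Real_Asymp.Real_Asymp"
    "Jordan_Normal_Form.Schur_Decomposition" Defs
begin

text \<open>Both the nominal density and the candidate worst-case density have a covariance of the form
  \<open>U diag(W, S) U\<^sup>T\<close> with the same unit upper triangular \<open>U\<close> (with off-diagonal block \<open>G\<close>), so that they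
  factor as the common marginal of \<open>y\<close> times a conditional Gaussian for \<open>x\<close> with mean \<open>g0 y\<close> and
  covariance \<open>W = P\<close> or \<open>W = V1\<close>. Since \<open>V1\<^sup>-\<^sup>1 = P\<^sup>-\<^sup>1 - H\<^sup>T H / l\<close>, their log-ratio is the loss
  \<open>|H (x - g0 y)|\<^sup>2 / (2 l)\<close> plus a constant. The Gibbs variational inequality then bounds the expected
  loss under any density of the ambiguity set by that under the worst-case density, whose divergence
  is \<open>gamma l = c\<close>; optimality of \<open>g0\<close> is the minimum mean square error property of the conditional
  mean. The shape of \<open>gamma\<close> is read off from the eigenvalues of \<open>H\<^sup>T H P\<close>, which are real since this
  matrix is symmetrizable, by triangularising it.\<close>

text \<open>No orthogonal diagonalisation and no linear change of variables in an integral is used.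
  The measure is a product of coordinate Lebesgue measures, so Gaussian facts in dimension
  \<open>d\<close> come from the \<open>U diag(W, S) U^T\<close> factorisation with a
  one-dimensional \<open>S\<close>, by induction on \<open>d\<close>. Two definiteness claims need
  more than algebra. \<open>V1\<close> is the inverse of a difference of matrices, and its
  definiteness comes from \<open>l > r\<close> alone: \<open>det (P^-1 - s H^T H) * det P\<close>
  equals \<open>det (1 - s H^T H P)\<close>, which stays positive for \<open>s\<close> from 0 to
  \<open>1 / l\<close>. And the noise acts only on the first block of the lifted state, so
  \<open>tB tB^T\<close> is singular; definiteness of \<open>P\<close> rests on the shift structure
  of \<open>tA\<close> together with the full ranks of \<open>B\<close> and \<open>D\<close>. The
  members of the ambiguity set are arbitrary densities. The Gibbs inequality is therefore used
  twice: for the loss, and, against a Gaussian with inflated innovation covariance, for the finite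
  second moments that make \<open>g0\<close> admissible. Costs are integrals in
  \<open>ennreal\<close>, so an infinite cost needs no special case.\<close>

unbundle no inner_syntax
unbundle no vec_syntax

section \<open>Symmetric positive definite matrices\<close>

text \<open>\<open>minv\<close> is the outcome of an elimination algorithm. This lemma hides it:
  from here on an inverse is found by exhibiting a right inverse.\<close>

lemma minv_eqI:
  assumes A: "A \<in> carrier_mat d d" and B: "B \<in> carrier_mat d d" and AB: "A * B = 1\<^sub>m d"
  shows "minv A = B"
proof -
  have BA: "B * A = 1\<^sub>m d"
    using mat_mult_left_right_inverse[OF A B AB] .
  show ?thesis
  proof (cases "mat_inverse A")
    case None
    from mat_inverse(1)[OF A None, of undefined] show ?thesis
      using A B AB BA by (auto simp: Units_def ring_mat_def)
  next
    case (Some C)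
    from mat_inverse(2)[OF A Some] have C: "A * C = 1\<^sub>m d" "C \<in> carrier_mat d d" by auto
    have "B = B * (A * C)" using B C by simp
    also have "\<dots> = (B * A) * C" using A B C by simp
    also have "\<dots> = C" using BA C by simp
    finally show ?thesis by (simp add: minv_def Some)
  qed
qed

lemma minv_inverse:
  assumes A: "A \<in> carrier_mat d d" and det: "det A \<noteq> 0"
  shows "minv A \<in> carrier_mat d d" "A * minv A = 1\<^sub>m d" "minv A * A = 1\<^sub>m d"
proof -
  obtain B where B: "B \<in> carrier_mat d d" "A * B = 1\<^sub>m d" "B * A = 1\<^sub>m d"
    using det_non_zero_imp_unit[OF A det, of undefined]
    by (auto simp: Units_def ring_mat_def)
  with minv_eqI[OF A B(1,2)] show "minv A \<in> carrier_mat d d" "A * minv A = 1\<^sub>m d" "minv A * A = 1\<^sub>m d"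
    by auto
qed

lemma sym_pdD:
  assumes "sym_pd d K"
  shows "K \<in> carrier_mat d d" "transpose_mat K = K"
    "\<And>v. v \<in> carrier_vec d \<Longrightarrow> v \<noteq> 0\<^sub>v d \<Longrightarrow> 0 < v \<bullet> (K *\<^sub>v v)"
    "\<And>v. v \<in> carrier_vec d \<Longrightarrow> 0 \<le> v \<bullet> (K *\<^sub>v v)"
proof -
  show *: "K \<in> carrier_mat d d" "transpose_mat K = K"
    "\<And>v. v \<in> carrier_vec d \<Longrightarrow> v \<noteq> 0\<^sub>v d \<Longrightarrow> 0 < v \<bullet> (K *\<^sub>v v)"
    using assms by (auto simp: sym_pd_def)
  show "0 \<le> v \<bullet> (K *\<^sub>v v)" if "v \<in> carrier_vec d" for v
    using *(1) *(3)[OF that] that by (cases "v = 0\<^sub>v d") auto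
qed

lemma sym_pd_det_nz:
  assumes K: "sym_pd d K" shows "det K \<noteq> 0"
proof
  assume "det K = 0"
  then obtain v where v: "v \<in> carrier_vec d" "v \<noteq> 0\<^sub>v d" "K *\<^sub>v v = 0\<^sub>v d"
    using det_0_iff_vec_prod_zero[OF sym_pdD(1)[OF K]] by blast
  from sym_pdD(3)[OF K v(1,2)] v show False by simp
qed

lemma sym_pd_minv_inverse:
  assumes "sym_pd d K"
  shows "minv K \<in> carrier_mat d d" "K * minv K = 1\<^sub>m d" "minv K * K = 1\<^sub>m d"
  using minv_inverse[OF sym_pdD(1) sym_pd_det_nz] assms by auto

lemma sym_bilinear_commute:
  fixes K :: "real mat"
  assumes "K \<in> carrier_mat d d" "transpose_mat K = K" "u \<in> carrier_vec d" "v \<in> carrier_vec d"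
  shows "u \<bullet> (K *\<^sub>v v) = v \<bullet> (K *\<^sub>v u)"
  using transpose_vec_mult_scalar[of K d d v u] assms
  by (metis comm_scalar_prod mult_mat_vec_carrier)

lemma sym_pd_minv:
  assumes K: "sym_pd d K"
  shows "sym_pd d (minv K)"
proof -
  note K' = sym_pdD[OF K] and I = sym_pd_minv_inverse[OF K]
  have "K * transpose_mat (minv K) = transpose_mat (minv K * K)"
    using transpose_mult[OF I(1) K'(1)] K'(2) by simp
  also have "\<dots> = 1\<^sub>m d" using I(3) by simp
  finally have sym: "transpose_mat (minv K) = minv K"
    using minv_eqI[OF K'(1), of "transpose_mat (minv K)"] I by simp
  have "0 < v \<bullet> (minv K *\<^sub>v v)" if v: "v \<in> carrier_vec d" "v \<noteq> 0\<^sub>v d" for v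
  proof -
    define w where "w = minv K *\<^sub>v v"
    have w: "w \<in> carrier_vec d" using I v by (simp add: w_def)
    have vw: "v = K *\<^sub>v w"
      using I v K' by (simp add: w_def assoc_mult_mat_vec[symmetric, of K d d "minv K" d])
    have "w \<noteq> 0\<^sub>v d" using vw v K' by auto
    from K'(3)[OF w this] have "0 < (K *\<^sub>v w) \<bullet> w"
      using comm_scalar_prod[of w d "K *\<^sub>v w"] w K' by auto
    thus ?thesis unfolding vw[symmetric] by (simp add: w_def)
  qed
  thus ?thesis using I sym by (simp add: sym_pd_def)
qed

lemma minv_minv:
  assumes "sym_pd d K" shows "minv (minv K) = K"
  using minv_eqI[OF sym_pd_minv_inverse(1)[OF assms] sym_pdD(1)[OF assms]]
    sym_pd_minv_inverse[OF assms] by simp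

lemma sym_pd_cauchy_schwarz:
  assumes K: "sym_pd d K" and u: "u \<in> carrier_vec d" and w: "w \<in> carrier_vec d"
  shows "(u \<bullet> (K *\<^sub>v w))\<^sup>2 \<le> (u \<bullet> (K *\<^sub>v u)) * (w \<bullet> (K *\<^sub>v w))"
proof (cases "w = 0\<^sub>v d")
  case True
  moreover have "K *\<^sub>v 0\<^sub>v d = 0\<^sub>v d" using sym_pdD(1)[OF K] by auto
  ultimately show ?thesis using u by simp
next
  case False
  note K' = sym_pdD[OF K]
  define q b a where "q = w \<bullet> (K *\<^sub>v w)" and "b = u \<bullet> (K *\<^sub>v w)" and "a = u \<bullet> (K *\<^sub>v u)"
  have q: "q > 0" using K'(3)[OF w False] by (simp add: q_def)
  have b': "w \<bullet> (K *\<^sub>v u) = b" using sym_bilinear_commute[OF K'(1,2) w u] by (simp add: b_def)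
  \<comment> \<open>The vector is the residual of projecting \<open>u\<close> on \<open>w\<close> in
    the inner product of \<open>K\<close>, multiplied by \<open>q\<close> to avoid a
    division.\<close>
  have "0 \<le> (q \<cdot>\<^sub>v u - b \<cdot>\<^sub>v w) \<bullet> (K *\<^sub>v (q \<cdot>\<^sub>v u - b \<cdot>\<^sub>v w))"
    by (rule K'(4)) (use u w in auto)
  also have "K *\<^sub>v (q \<cdot>\<^sub>v u - b \<cdot>\<^sub>v w) = q \<cdot>\<^sub>v (K *\<^sub>v u) - b \<cdot>\<^sub>v (K *\<^sub>v w)"
    using K'(1) u w by (simp add: mult_minus_distrib_mat_vec[of _ d d] mult_mat_vec)
  also have "(q \<cdot>\<^sub>v u - b \<cdot>\<^sub>v w) \<bullet> \<dots> = q * q * a - 2 * q * b * b + b * b * q"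
    using K'(1) u w b'
    by (simp add: minus_scalar_prod_distrib[of _ d] scalar_prod_minus_distrib[of _ d] a_def b_def[symmetric] q_def[symmetric]
        algebra_simps)
  also have "\<dots> = q * (a * q - b\<^sup>2)" by (simp add: algebra_simps power2_eq_square)
  finally have "0 \<le> a * q - b\<^sup>2" using q by (simp add: zero_le_mult_iff)
  thus ?thesis by (simp add: a_def b_def q_def)
qed

text \<open>Cauchy-Schwarz with \<open>w = K^-1 v\<close>. It bounds a linear functional by a
  quadratic form with an explicit constant, which later replaces compactness of the unit
  sphere.\<close>

lemma sym_pd_dual_bound:
  assumes K: "sym_pd d K" and u: "u \<in> carrier_vec d" and v: "v \<in> carrier_vec d"
  shows "(u \<bullet> v)\<^sup>2 \<le> (u \<bullet> (K *\<^sub>v u)) * (v \<bullet> (minv K *\<^sub>v v))"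
proof -
  note K' = sym_pdD[OF K] and I = sym_pd_minv_inverse[OF K]
  define w where "w = minv K *\<^sub>v v"
  have w: "w \<in> carrier_vec d" using I v by (simp add: w_def)
  have vw: "K *\<^sub>v w = v"
    using I v K' by (simp add: w_def assoc_mult_mat_vec[symmetric, of K d d "minv K" d])
  have "w \<bullet> v = v \<bullet> w" using comm_scalar_prod[OF w v] .
  with sym_pd_cauchy_schwarz[OF K u w] show ?thesis by (simp add: vw) (simp add: w_def)
qed

section \<open>Congruences, Gram matrices and full row rank\<close>

lemma congruence_form:
  fixes K :: "real mat"
  assumes X: "X \<in> carrier_mat e d" and K: "K \<in> carrier_mat d d" and v: "v \<in> carrier_vec e"
  shows "v \<bullet> ((X * K * transpose_mat X) *\<^sub>v v) = (transpose_mat X *\<^sub>v v) \<bullet> (K *\<^sub>v (transpose_mat X *\<^sub>v v))"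
proof -
  have "(X * K * transpose_mat X) *\<^sub>v v = X *\<^sub>v (K *\<^sub>v (transpose_mat X *\<^sub>v v))"
    using X K v by (simp add: assoc_mult_mat_vec[of _ e d _ e] assoc_mult_mat_vec[of _ e d _ d])
  thus ?thesis using transpose_vec_mult_scalar[of X e d _ v] X K v by simp
qed

lemma congruence_sym:
  fixes K :: "real mat"
  assumes X: "X \<in> carrier_mat e d" and K: "K \<in> carrier_mat d d" and s: "transpose_mat K = K"
  shows "transpose_mat (X * K * transpose_mat X) = X * K * transpose_mat X"
proof -
  have "transpose_mat (X * K * transpose_mat X) = X * transpose_mat (X * K)"
    using transpose_mult[of "X * K" e d "transpose_mat X" e] X K by simp
  also have "transpose_mat (X * K) = K * transpose_mat X"
    using transpose_mult[OF X K] s by simp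
  finally show ?thesis using X K by simp
qed

lemma sym_pd_congruence:
  assumes X: "X \<in> carrier_mat e d" and K: "sym_pd d K"
    and inj: "\<And>v. v \<in> carrier_vec e \<Longrightarrow> transpose_mat X *\<^sub>v v = 0\<^sub>v d \<Longrightarrow> v = 0\<^sub>v e"
  shows "sym_pd e (X * K * transpose_mat X)"
  unfolding sym_pd_def
proof (intro conjI ballI impI)
  note K' = sym_pdD[OF K]
  show "X * K * transpose_mat X \<in> carrier_mat e e" using X K' by simp
  show "transpose_mat (X * K * transpose_mat X) = X * K * transpose_mat X"
    by (rule congruence_sym[OF X K'(1,2)])
  fix v :: "real vec" assume v: "v \<in> carrier_vec e" "v \<noteq> 0\<^sub>v e"
  show "0 < v \<bullet> (X * K * transpose_mat X *\<^sub>v v)"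
    unfolding congruence_form[OF X K'(1) v(1)]
    by (rule K'(3)) (use X v inj in auto)
qed

lemma sym_pd_add_psd:
  assumes K: "sym_pd d K" and M: "M \<in> carrier_mat d d" "transpose_mat M = M"
    and psd: "\<And>v. v \<in> carrier_vec d \<Longrightarrow> 0 \<le> v \<bullet> (M *\<^sub>v v)"
  shows "sym_pd d (M + K)"
  unfolding sym_pd_def
proof (intro conjI ballI impI)
  note K' = sym_pdD[OF K]
  show "M + K \<in> carrier_mat d d" "transpose_mat (M + K) = M + K"
    using K' M by (auto simp: transpose_add)
  fix v :: "real vec" assume v: "v \<in> carrier_vec d" "v \<noteq> 0\<^sub>v d"
  have "v \<bullet> ((M + K) *\<^sub>v v) = v \<bullet> (M *\<^sub>v v) + v \<bullet> (K *\<^sub>v v)"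
    using v K' M by (simp add: add_mult_distrib_mat_vec[of _ d d] scalar_prod_add_distrib[of _ d])
  thus "0 < v \<bullet> ((M + K) *\<^sub>v v)" using K'(3)[OF v] psd[OF v(1)] by simp
qed

lemma gram_form:
  fixes X :: "real mat"
  assumes X: "X \<in> carrier_mat e d" and v: "v \<in> carrier_vec e"
  shows "v \<bullet> ((X * transpose_mat X) *\<^sub>v v) = (transpose_mat X *\<^sub>v v) \<bullet> (transpose_mat X *\<^sub>v v)"
  using transpose_vec_mult_scalar[of X e d "transpose_mat X *\<^sub>v v" v] X v
  by (simp add: assoc_mult_mat_vec[of _ e d _ e])

lemma scalar_prod_self_zero:
  fixes v :: "real vec"
  assumes "v \<in> carrier_vec d" "v \<bullet> v = 0" shows "v = 0\<^sub>v d"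
proof -
  have "(\<Sum>i\<in>{0..<d}. v $ i * v $ i) = 0" using assms by (simp add: scalar_prod_def)
  hence "\<forall>i\<in>{0..<d}. v $ i * v $ i = 0" by (subst (asm) sum_nonneg_eq_0_iff) auto
  thus ?thesis using assms(1) by (intro eq_vecI) auto
qed

lemma scalar_prod_self_nonneg: "0 \<le> v \<bullet> (v :: real vec)"
  by (auto simp: scalar_prod_def intro: sum_nonneg)

lemma sym_pd_gram:
  fixes X :: "real mat"
  assumes X: "X \<in> carrier_mat e d"
    and inj: "\<And>v. v \<in> carrier_vec e \<Longrightarrow> transpose_mat X *\<^sub>v v = 0\<^sub>v d \<Longrightarrow> v = 0\<^sub>v e"
  shows "sym_pd e (X * transpose_mat X)"
  unfolding sym_pd_def
proof (intro conjI ballI impI)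
  show "X * transpose_mat X \<in> carrier_mat e e" using X by simp
  show "transpose_mat (X * transpose_mat X) = X * transpose_mat X"
    using X by (simp add: transpose_mult[of _ e d _ e])
  fix v :: "real vec" assume v: "v \<in> carrier_vec e" "v \<noteq> 0\<^sub>v e"
  have "transpose_mat X *\<^sub>v v \<in> carrier_vec d" using X v by simp
  from scalar_prod_self_zero[OF this] scalar_prod_self_nonneg[of "transpose_mat X *\<^sub>v v"]
  show "0 < v \<bullet> (X * transpose_mat X *\<^sub>v v)"
    unfolding gram_form[OF X v(1)] using inj[OF v(1)] v(2) by force
qed

text \<open>A maximal independent set of columns has \<open>e\<close> elements and is thus a basis.
  The vector \<open>v\<close> is orthogonal to each of them and is also a combination of them, hence
  orthogonal to itself.\<close>

lemma full_row_rank_transpose_inj: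
  fixes X :: "real mat"
  assumes X: "X \<in> carrier_mat e d" and r: "vec_space.rank e X = e"
    and v: "v \<in> carrier_vec e" and z: "transpose_mat X *\<^sub>v v = 0\<^sub>v d"
  shows "v = 0\<^sub>v e"
proof -
  interpret vec_space "TYPE(real)" e .
  have cX: "set (cols X) \<subseteq> carrier_vec e" using X cols_dim by blast
  obtain T where T: "maximal T (\<lambda>T. T \<subseteq> set (cols X) \<and> lin_indpt T)" "finite T"
    using maximal_exists_superset[of "set (cols X)" "\<lambda>T. T \<subseteq> set (cols X) \<and> lin_indpt T" "{}"]
    by (auto simp: lin_dep_def)
  have TX: "T \<subseteq> set (cols X)" "lin_indpt T" using T by (auto simp: maximal_def)
  have "card T = e" using rank_card_indpt[OF X T(1)] r by simp
  hence "basis T" using TX cX T(2) by (intro dim_li_is_basis) (auto simp: dim_is_n)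
  hence sp: "span T = carrier_vec e" by (simp add: basis_def)
  have orth: "v \<bullet> t = 0" if "t \<in> T" for t
  proof -
    from that TX obtain j where j: "j < d" "t = col X j" using X by (auto simp: cols_def)
    have "(transpose_mat X *\<^sub>v v) $ j = t \<bullet> v" using j X by simp
    thus ?thesis using z j comm_scalar_prod[of v e t] v cX that TX by auto
  qed
  have "v \<in> span T" using sp v by simp
  then obtain a where "v = lincomb a T" using TX cX T(2) by (auto simp: finite_span)
  hence "v \<bullet> v = v \<bullet> lincomb a T" by simp
  also have "\<dots> = (\<Sum>t\<in>T. a t * (v \<bullet> t))"
  proof -
    have TC: "T \<subseteq> carrier_vec e" using TX cX by auto
    have "v \<bullet> lincomb a T = (\<Sum>i\<in>{0..<e}. v $ i * (\<Sum>t\<in>T. a t * t $ i))"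
      using lincomb_index[OF _ TC] lincomb_dim[OF T(2) TC] by (auto simp: scalar_prod_def intro!: sum.cong)
    also have "\<dots> = (\<Sum>t\<in>T. \<Sum>i\<in>{0..<e}. a t * (v $ i * t $ i))"
      by (subst sum.swap) (simp add: sum_distrib_left mult_ac)
    also have "\<dots> = (\<Sum>t\<in>T. a t * (v \<bullet> t))"
      using TC by (intro sum.cong) (auto simp: scalar_prod_def sum_distrib_left)
    finally show ?thesis .
  qed
  also have "\<dots> = 0" using orth by simp
  finally show ?thesis using scalar_prod_self_zero[OF v] by simp
qed

section \<open>Block triangular factorisation\<close>

text \<open>For a joint covariance of \<open>(x, y)\<close>, \<open>S\<close> is the covariance of
  \<open>y\<close>, \<open>G\<close> the regression matrix of \<open>x\<close> on \<open>y\<close>,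
  and \<open>W\<close> the Schur complement, which is the conditional covariance of \<open>x\<close>
  given \<open>y\<close>. The factors are written as in \<open>K0\<close>, so that the theorem can
  be refolded literally.\<close>

definition udu :: "nat \<Rightarrow> nat \<Rightarrow> real mat \<Rightarrow> real mat \<Rightarrow> real mat \<Rightarrow> real mat" where
  "udu N m G W S = four_block_mat (1\<^sub>m N) G (0\<^sub>m m N) (1\<^sub>m m)
     * four_block_mat W (0\<^sub>m N m) (0\<^sub>m m N) S
     * four_block_mat (1\<^sub>m N) (0\<^sub>m N m) (transpose_mat G) (1\<^sub>m m)"

lemma transpose_unit_upper:
  fixes G :: "real mat"
  assumes "G \<in> carrier_mat N m"
  shows "transpose_mat (four_block_mat (1\<^sub>m N) G (0\<^sub>m m N) (1\<^sub>m m))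
    = four_block_mat (1\<^sub>m N) (0\<^sub>m N m) (transpose_mat G) (1\<^sub>m m)"
  using assms by (subst transpose_four_block_mat[of _ N N _ m _ m]) auto

lemma udu_congruence:
  assumes "G \<in> carrier_mat N m"
  shows "udu N m G W S = four_block_mat (1\<^sub>m N) G (0\<^sub>m m N) (1\<^sub>m m)
     * four_block_mat W (0\<^sub>m N m) (0\<^sub>m m N) S
     * transpose_mat (four_block_mat (1\<^sub>m N) G (0\<^sub>m m N) (1\<^sub>m m))"
  by (simp add: udu_def transpose_unit_upper[OF assms])

context
  fixes N m :: nat and G W S :: "real mat"
  assumes G: "G \<in> carrier_mat N m" and W: "W \<in> carrier_mat N N" and S: "S \<in> carrier_mat m m"
begin

lemma udu_carrier: "udu N m G W S \<in> carrier_mat (N + m) (N + m)"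
  unfolding udu_def using G W S by (intro mult_carrier_mat[of _ "N + m" "N + m"]) auto

lemma udu_four_block:
  "udu N m G W S = four_block_mat (W + G * S * transpose_mat G) (G * S) (S * transpose_mat G) S"
  using G W S unfolding udu_def
  by (subst mult_four_block_mat[of _ N N _ m _ m _ _ N _ m], simp_all,
      subst mult_four_block_mat[of _ N N _ m _ m _ _ N _ m], simp_all)

lemma udu_det: "det (udu N m G W S) = det W * det S"
proof -
  have U: "four_block_mat (1\<^sub>m N) G (0\<^sub>m m N) (1\<^sub>m m) \<in> carrier_mat (N + m) (N + m)" using G by simp
  have D: "four_block_mat W (0\<^sub>m N m) (0\<^sub>m m N) S \<in> carrier_mat (N + m) (N + m)" using W S by simp
  have UT: "four_block_mat (1\<^sub>m N) (0\<^sub>m N m) (transpose_mat G) (1\<^sub>m m) \<in> carrier_mat (N + m) (N + m)"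
    using G by simp
  show ?thesis
    unfolding udu_def det_mult[OF mult_carrier_mat[OF U D] UT] det_mult[OF U D]
    using G W S by (simp add: det_four_block_mat_lower_left_zero[of _ N _ m]
        det_four_block_mat_upper_right_zero[of _ N _ m])
qed

text \<open>The transposed triangular factor maps \<open>(u, w)\<close> to
  \<open>(u, G^T u + w)\<close>, after which the middle factor is block diagonal.\<close>

lemma udu_form:
  assumes u: "u \<in> carrier_vec N" and w: "w \<in> carrier_vec m"
  shows "(u @\<^sub>v w) \<bullet> (udu N m G W S *\<^sub>v (u @\<^sub>v w))
    = u \<bullet> (W *\<^sub>v u) + (transpose_mat G *\<^sub>v u + w) \<bullet> (S *\<^sub>v (transpose_mat G *\<^sub>v u + w))"
proof -
  let ?U = "four_block_mat (1\<^sub>m N) G (0\<^sub>m m N) (1\<^sub>m m)"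
  have Ut: "transpose_mat ?U *\<^sub>v (u @\<^sub>v w) = u @\<^sub>v (transpose_mat G *\<^sub>v u + w)"
    unfolding transpose_unit_upper[OF G]
    using G u w by (subst four_block_mat_mult_vec[of _ N N _ m _ m]) auto
  have U: "?U \<in> carrier_mat (N + m) (N + m)" using G by simp
  have D: "four_block_mat W (0\<^sub>m N m) (0\<^sub>m m N) S \<in> carrier_mat (N + m) (N + m)" using W S by simp
  show ?thesis
    unfolding udu_congruence[OF G]
    using G W S u w
    by (subst congruence_form[OF U D]) (auto simp: Ut mult_mat_vec_split scalar_prod_append[of _ N _ m])
qed

lemma udu_sym:
  assumes "transpose_mat W = W" "transpose_mat S = S"
  shows "transpose_mat (udu N m G W S) = udu N m G W S"
proof -
  have U: "four_block_mat (1\<^sub>m N) G (0\<^sub>m m N) (1\<^sub>m m) \<in> carrier_mat (N + m) (N + m)" using G by simp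
  have D: "four_block_mat W (0\<^sub>m N m) (0\<^sub>m m N) S \<in> carrier_mat (N + m) (N + m)" using W S by simp
  have "transpose_mat (four_block_mat W (0\<^sub>m N m) (0\<^sub>m m N) S) = four_block_mat W (0\<^sub>m N m) (0\<^sub>m m N) S"
    using W S assms by (subst transpose_four_block_mat[of _ N N _ m _ m]) auto
  from congruence_sym[OF U D this] show ?thesis unfolding udu_congruence[OF G] .
qed

end

lemma vec_append_zero_iff:
  assumes "u \<in> carrier_vec N" "w \<in> carrier_vec m"
  shows "u @\<^sub>v w = 0\<^sub>v (N + m) \<longleftrightarrow> u = 0\<^sub>v N \<and> w = 0\<^sub>v (m)"
proof -
  have "0\<^sub>v (N + m) = 0\<^sub>v N @\<^sub>v 0\<^sub>v m" by (intro eq_vecI) auto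
  thus ?thesis using append_vec_eq[of u N "0\<^sub>v N" w "0\<^sub>v m"] assms(1) zero_carrier_vec[of N] by metis
qed

lemma sym_pd_udu:
  assumes G: "G \<in> carrier_mat N m" and W: "sym_pd N W" and S: "sym_pd m S"
  shows "sym_pd (N + m) (udu N m G W S)"
  unfolding sym_pd_def
proof (intro conjI ballI impI)
  note W' = sym_pdD[OF W] and S' = sym_pdD[OF S]
  show "udu N m G W S \<in> carrier_mat (N + m) (N + m)" by (rule udu_carrier[OF G W'(1) S'(1)])
  show "transpose_mat (udu N m G W S) = udu N m G W S"
    by (rule udu_sym[OF G W'(1) S'(1) W'(2) S'(2)])
  fix v :: "real vec" assume v: "v \<in> carrier_vec (N + m)" "v \<noteq> 0\<^sub>v (N + m)"
  define u w where "u = vec_first v N" and "w = vec_last v m"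
  have vuw: "v = u @\<^sub>v w" "u \<in> carrier_vec N" "w \<in> carrier_vec m"
    using v by (auto simp: u_def w_def)
  let ?r = "transpose_mat G *\<^sub>v u + w"
  have r: "?r \<in> carrier_vec m" using vuw G by auto
  have "0 < u \<bullet> (W *\<^sub>v u) + ?r \<bullet> (S *\<^sub>v ?r)"
  proof (cases "u = 0\<^sub>v N")
    case True
    have "transpose_mat G *\<^sub>v 0\<^sub>v N = 0\<^sub>v m" using G by auto
    hence "?r = w" using True vuw by simp
    moreover have "w \<noteq> 0\<^sub>v m" using True vuw v vec_append_zero_iff[of u N w m] by auto
    ultimately show ?thesis using S'(3)[of w] W'(4)[of u] vuw by auto
  next
    case False
    thus ?thesis using W'(3)[of u] S'(4)[OF r] vuw by auto
  qed
  thus "0 < v \<bullet> (udu N m G W S *\<^sub>v v)"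
    using udu_form[OF G W'(1) S'(1) vuw(2,3)] vuw(1) by simp
qed

lemma congruence_inverse:
  fixes U :: "real mat"
  assumes U: "U \<in> carrier_mat d d" and V: "V \<in> carrier_mat d d"
    and D: "D \<in> carrier_mat d d" and E: "E \<in> carrier_mat d d"
    and UV: "U * V = 1\<^sub>m d" and DE: "D * E = 1\<^sub>m d"
  shows "U * D * transpose_mat U * (transpose_mat V * E * V) = 1\<^sub>m d"
proof -
  have tt: "transpose_mat U * transpose_mat V = 1\<^sub>m d"
    using transpose_mult[OF V U] mat_mult_left_right_inverse[OF U V UV] by simp
  have tU: "transpose_mat U \<in> carrier_mat d d" and tV: "transpose_mat V \<in> carrier_mat d d"
    using U V by auto
  have "U * D * transpose_mat U * (transpose_mat V * E * V)
      = U * (D * ((transpose_mat U * transpose_mat V) * (E * V)))"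
    using U V D E tU tV by (simp add: assoc_mult_mat[of _ d d _ d _ d])
  also have "\<dots> = U * ((D * E) * V)"
    unfolding tt using U V D E by (simp add: assoc_mult_mat[of _ d d _ d _ d])
  also have "\<dots> = 1\<^sub>m d" unfolding DE using V UV by simp
  finally show ?thesis .
qed

text \<open>A unit block triangular matrix is inverted by changing the sign of \<open>G\<close>, so
  the inverse is again a congruence of a block diagonal matrix.\<close>

lemma minv_udu:
  assumes G: "G \<in> carrier_mat N m" and W: "sym_pd N W" and S: "sym_pd m S"
  shows "minv (udu N m G W S) = transpose_mat (four_block_mat (1\<^sub>m N) (- G) (0\<^sub>m m N) (1\<^sub>m m))
     * four_block_mat (minv W) (0\<^sub>m N m) (0\<^sub>m m N) (minv S)
     * four_block_mat (1\<^sub>m N) (- G) (0\<^sub>m m N) (1\<^sub>m m)"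
proof (rule minv_eqI[of _ "N + m"])
  note W' = sym_pdD(1)[OF W] sym_pd_minv_inverse[OF W] and S' = sym_pdD(1)[OF S] sym_pd_minv_inverse[OF S]
  let ?d = "N + m"
  let ?U = "four_block_mat (1\<^sub>m N) G (0\<^sub>m m N) (1\<^sub>m m)" and ?V = "four_block_mat (1\<^sub>m N) (- G) (0\<^sub>m m N) (1\<^sub>m m)"
  let ?D = "four_block_mat W (0\<^sub>m N m) (0\<^sub>m m N) S" and ?E = "four_block_mat (minv W) (0\<^sub>m N m) (0\<^sub>m m N) (minv S)"
  show "udu N m G W S \<in> carrier_mat ?d ?d" by (rule udu_carrier[OF G W'(1) S'(1)])
  have U: "?U \<in> carrier_mat ?d ?d" and V: "?V \<in> carrier_mat ?d ?d"
    and D: "?D \<in> carrier_mat ?d ?d" and E: "?E \<in> carrier_mat ?d ?d"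
    using G W' S' by auto
  show "transpose_mat ?V * ?E * ?V \<in> carrier_mat ?d ?d"
    using V E by (intro mult_carrier_mat[of _ ?d ?d]) (simp_all only: transpose_carrier_mat)
  have GG: "G + - G = 0\<^sub>m N m" "- G + G = 0\<^sub>m N m" using G by (auto intro!: eq_matI)
  have z: "- 0\<^sub>m m m + 1\<^sub>m m = (1\<^sub>m m :: real mat)" by (intro eq_matI) auto
  have UV: "?U * ?V = 1\<^sub>m ?d" using G GG z
    by (subst mult_four_block_mat[of _ N N _ m _ m _ _ N _ m]) auto
  have DE: "?D * ?E = 1\<^sub>m ?d" using W' S'
    by (subst mult_four_block_mat[of _ N N _ m _ m _ _ N _ m]) auto
  show "udu N m G W S * (transpose_mat ?V * ?E * ?V) = 1\<^sub>m ?d"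
    unfolding udu_congruence[OF G] by (rule congruence_inverse[OF U V D E UV DE])
qed

text \<open>This completes the square in the Gaussian exponent: the residual \<open>a - G b\<close>
  of the regression on \<open>b\<close> is weighted by \<open>W^-1\<close>, and \<open>b\<close> by
  \<open>S^-1\<close>.\<close>

lemma minv_udu_form:
  assumes G: "G \<in> carrier_mat N m" and W: "sym_pd N W" and S: "sym_pd m S"
    and a: "a \<in> carrier_vec N" and b: "b \<in> carrier_vec m"
  shows "(a @\<^sub>v b) \<bullet> (minv (udu N m G W S) *\<^sub>v (a @\<^sub>v b))
    = (a - G *\<^sub>v b) \<bullet> (minv W *\<^sub>v (a - G *\<^sub>v b)) + b \<bullet> (minv S *\<^sub>v b)"
proof -
  let ?d = "N + m"
  let ?V = "four_block_mat (1\<^sub>m N) (- G) (0\<^sub>m m N) (1\<^sub>m m)"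
  let ?E = "four_block_mat (minv W) (0\<^sub>m N m) (0\<^sub>m m N) (minv S)"
  note W' = sym_pd_minv_inverse[OF W] and S' = sym_pd_minv_inverse[OF S]
  have V: "transpose_mat ?V \<in> carrier_mat ?d ?d" and E: "?E \<in> carrier_mat ?d ?d"
    using G W' S' by auto
  have Vm: "?V *\<^sub>v (a @\<^sub>v b) = (a - G *\<^sub>v b) @\<^sub>v b"
  proof -
    have "a + - G *\<^sub>v b = a - G *\<^sub>v b" using G a b by (intro eq_vecI) auto
    thus ?thesis using G a b by (subst four_block_mat_mult_vec[of _ N N _ m _ m]) auto
  qed
  have "(a @\<^sub>v b) \<bullet> (minv (udu N m G W S) *\<^sub>v (a @\<^sub>v b))
      = (?V *\<^sub>v (a @\<^sub>v b)) \<bullet> (?E *\<^sub>v (?V *\<^sub>v (a @\<^sub>v b)))"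
    unfolding minv_udu[OF G W S]
    using congruence_form[OF V E, of "a @\<^sub>v b"] a b by simp
  thus ?thesis unfolding Vm using W' S' G a b
    by (simp add: mult_mat_vec_split scalar_prod_append[of _ N _ m])
qed

text \<open>Block elimination: \<open>S\<close> is the lower right block of \<open>K\<close>, and
  \<open>G\<close> must be \<open>K2 S^-1\<close> to reproduce the upper right block
  \<open>K2\<close>. With \<open>m = 1\<close> this is the induction step for determinants and for
  Gaussian moments.\<close>

lemma sym_pd_udu_exists:
  assumes K: "sym_pd (N + m) K"
  obtains G W S where "G \<in> carrier_mat N m" "sym_pd N W" "sym_pd m S" "K = udu N m G W S"
proof -
  note K' = sym_pdD[OF K]
  obtain K1 K2 K3 S where sp: "split_block K N N = (K1, K2, K3, S)" by (metis prod_cases4)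
  from split_block[OF sp, of m m] K'(1)
  have c: "K1 \<in> carrier_mat N N" "K2 \<in> carrier_mat N m" "K3 \<in> carrier_mat m N" "S \<in> carrier_mat m m"
    and Keq: "K = four_block_mat K1 K2 K3 S" by auto
  have KT: "transpose_mat K = four_block_mat (transpose_mat K1) (transpose_mat K3) (transpose_mat K2) (transpose_mat S)"
    unfolding Keq using c by (subst transpose_four_block_mat) auto
  have id: "transpose_mat K1 = K1" "transpose_mat K3 = K2" "transpose_mat K2 = K3" "transpose_mat S = S"
  proof -
    have eq: "four_block_mat (transpose_mat K1) (transpose_mat K3) (transpose_mat K2) (transpose_mat S) = four_block_mat K1 K2 K3 S"
      using KT K'(2) Keq by simp
    have ij: "four_block_mat (transpose_mat K1) (transpose_mat K3) (transpose_mat K2) (transpose_mat S) $$ (i,j) = four_block_mat K1 K2 K3 S $$ (i,j)" for i j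
      using eq by simp
    show "transpose_mat K1 = K1"
    proof (rule eq_matI)
      fix i j assume "i < dim_row K1" "j < dim_col K1"
      thus "transpose_mat K1 $$ (i, j) = K1 $$ (i, j)" using c ij[of i j] by auto
    qed (use c in auto)
    show "transpose_mat K3 = K2"
    proof (rule eq_matI)
      fix i j assume "i < dim_row K2" "j < dim_col K2"
      thus "transpose_mat K3 $$ (i, j) = K2 $$ (i, j)" using c ij[of i "N + j"] by auto
    qed (use c in auto)
    thus "transpose_mat K2 = K3" by auto
    show "transpose_mat S = S"
    proof (rule eq_matI)
      fix i j assume "i < dim_row S" "j < dim_col S"
      thus "transpose_mat S $$ (i, j) = S $$ (i, j)" using c ij[of "N + i" "N + j"] by auto
    qed (use c in auto)
  qed
  have S: "sym_pd m S"
    unfolding sym_pd_def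
  proof (intro conjI ballI impI)
    fix w :: "real vec" assume w: "w \<in> carrier_vec m" "w \<noteq> 0\<^sub>v m"
    have z: "K1 *\<^sub>v 0\<^sub>v N = 0\<^sub>v N" "K3 *\<^sub>v 0\<^sub>v N = 0\<^sub>v m" using c by auto
    have e: "K *\<^sub>v (0\<^sub>v N @\<^sub>v w) = (K2 *\<^sub>v w) @\<^sub>v (S *\<^sub>v w)"
      unfolding Keq using c w z by (subst four_block_mat_mult_vec) auto
    have "0 < (0\<^sub>v N @\<^sub>v w) \<bullet> (K *\<^sub>v (0\<^sub>v N @\<^sub>v w))"
      by (rule K'(3)) (use w vec_append_zero_iff[of "0\<^sub>v N" N w m] in auto)
    thus "0 < w \<bullet> (S *\<^sub>v w)" unfolding e using c w by (subst (asm) scalar_prod_append[of _ N _ m]) auto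
  qed (use c id in auto)
  note S' = sym_pdD[OF S] sym_pd_minv_inverse[OF S] sym_pdD(2)[OF sym_pd_minv[OF S]]
  define G where "G = K2 * minv S"
  define W where "W = K1 - G * S * transpose_mat G"
  have G: "G \<in> carrier_mat N m" using c S' by (simp add: G_def)
  have Wc: "W \<in> carrier_mat N N" unfolding W_def using c G by (intro minus_carrier_mat mult_carrier_mat[of _ N m]) auto
  have GS: "G * S = K2" using c S' by (simp add: G_def assoc_mult_mat[of _ N m _ m _ m])
  have SG: "S * transpose_mat G = K3"
    using transpose_mult[OF G c(4)] GS id by simp
  have "W + G * S * transpose_mat G = K1" using c G by (auto intro!: eq_matI simp: W_def)
  hence Ku: "K = udu N m G W S" using udu_four_block[OF G Wc c(4)] GS SG Keq by simp
  have "transpose_mat W = W"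
  proof -
    have "transpose_mat W = transpose_mat K1 - transpose_mat (G * S * transpose_mat G)"
      unfolding W_def using c G by (intro transpose_minus) auto
    thus ?thesis using congruence_sym[OF G c(4) id(4)] id by (simp add: W_def)
  qed
  have W: "sym_pd N W"
    unfolding sym_pd_def
  proof (intro conjI ballI impI)
    fix u :: "real vec" assume u: "u \<in> carrier_vec N" "u \<noteq> 0\<^sub>v N"
    \<comment> \<open>This choice cancels the \<open>S\<close> term of \<open>udu_form\<close> and
      leaves the form of the Schur complement alone.\<close>
    let ?w = "- (transpose_mat G *\<^sub>v u)"
    have w: "?w \<in> carrier_vec m" using G u by auto
    have z: "transpose_mat G *\<^sub>v u + ?w = 0\<^sub>v m" using G u by auto
    have S0: "S *\<^sub>v 0\<^sub>v m = 0\<^sub>v m" using c by auto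
    have "0 < (u @\<^sub>v ?w) \<bullet> (K *\<^sub>v (u @\<^sub>v ?w))"
      by (rule K'(3)) (use u w vec_append_zero_iff[of u N ?w m] in auto)
    thus "0 < u \<bullet> (W *\<^sub>v u)" unfolding Ku udu_form[OF G Wc c(4) u(1) w] z S0 by simp
  qed fact+
  show thesis by (rule that[OF G W S Ku])
qed

lemma sym_pd_det_pos: "sym_pd d K \<Longrightarrow> 0 < det K"
proof (induction d arbitrary: K)
  case 0
  thus ?case using sym_pdD(1)[OF 0] by simp
next
  case (Suc d)
  hence "sym_pd (d + 1) K" by simp
  then obtain G W S where *: "G \<in> carrier_mat d 1" "sym_pd d W" "sym_pd 1 S" "K = udu d 1 G W S"
    by (rule sym_pd_udu_exists)
  have S: "S \<in> carrier_mat 1 1" using *(3) by (rule sym_pdD)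
  have "unit_vec 1 0 \<bullet> (S *\<^sub>v unit_vec 1 0) = S $$ (0, 0)" using S by (simp add: scalar_prod_def)
  moreover have "0 < unit_vec 1 0 \<bullet> (S *\<^sub>v unit_vec 1 0)" by (rule sym_pdD(3)[OF *(3)]) auto
  ultimately have "0 < det S" using det_single[OF S] by simp
  moreover have "0 < det W" by (rule Suc.IH[OF *(2)])
  ultimately show ?case using udu_det[OF *(1) sym_pdD(1)[OF *(2)] S] *(4) by simp
qed

section \<open>Gaussian integrals on product spaces\<close>

interpretation lborel_prod: product_sigma_finite "\<lambda>_::nat. lborel :: real measure"
  by standard

lemma space_Rsp: "space (Rsp d) = {..<d} \<rightarrow>\<^sub>E UNIV"
  by (simp add: Rsp_def space_PiM)

lemma sigma_finite_Rsp: "sigma_finite_measure (Rsp d)"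
  unfolding Rsp_def by (rule lborel_prod.sigma_finite) simp

lemma measurable_Rsp_component[measurable]: "i < d \<Longrightarrow> (\<lambda>z. z i) \<in> borel_measurable (Rsp d)"
  unfolding Rsp_def using measurable_component_singleton[of i "{..<d}" "\<lambda>_. lborel :: real measure"] by simp

lemma measurable_join: "(\<lambda>p. join N m (fst p) (snd p)) \<in> Rsp N \<Otimes>\<^sub>M Rsp m \<rightarrow>\<^sub>M Rsp (N + m)"
  unfolding Rsp_def[of "N + m"]
proof (rule measurable_PiM_single')
  fix i assume i: "i \<in> {..<N + m}"
  show "(\<lambda>p. join N m (fst p) (snd p) i) \<in> Rsp N \<Otimes>\<^sub>M Rsp m \<rightarrow>\<^sub>M lborel"
    using i by (cases "i < N") (auto simp: join_def intro!: measurable_compose[OF measurable_fst] measurable_compose[OF measurable_snd])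
qed (simp add: PiE_iff extensional_def join_def)

lemma ypart_join: "y \<in> space (Rsp m) \<Longrightarrow> ypart N m (join N m x y) = y"
  by (auto simp: fun_eq_iff ypart_def join_def space_Rsp PiE_def extensional_def)

lemma join_parts: "z \<in> space (Rsp (N + m)) \<Longrightarrow> join N m (xpart N z) (ypart N m z) = z"
  by (auto simp: fun_eq_iff xpart_def ypart_def join_def space_Rsp PiE_def extensional_def)

lemma vec_join: "vec (N + m) (join N m x y) = vec N x @\<^sub>v vec m y"
  by (intro eq_vecI) (auto simp: join_def)

text \<open>Points are functions on an index range, so splitting off coordinates is a relabelling
  and not a literal pairing. By uniqueness of product measures it suffices to compare boxes, whose
  preimages are products of two boxes, the second with its indices shifted by
  \<open>N\<close>.\<close>

lemma distr_join: "distr (Rsp N \<Otimes>\<^sub>M Rsp m) (Rsp (N + m)) (\<lambda>p. join N m (fst p) (snd p)) = Rsp (N + m)"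
  unfolding Rsp_def[of "N + m"]
proof (rule lborel_prod.PiM_eqI)
  interpret m: sigma_finite_measure "Rsp m" by (rule sigma_finite_Rsp)
  show "sets (distr (Rsp N \<Otimes>\<^sub>M Rsp m) (Pi\<^sub>M {..<N + m} (\<lambda>_. lborel)) (\<lambda>p. join N m (fst p) (snd p))) =
    sets (Pi\<^sub>M {..<N + m} (\<lambda>_. lborel))" by simp
  fix A :: "nat \<Rightarrow> real set" assume A: "\<And>i. i \<in> {..<N + m} \<Longrightarrow> A i \<in> sets lborel"
  have pre: "(\<lambda>p. join N m (fst p) (snd p)) -` (Pi\<^sub>E {..<N + m} A) \<inter> space (Rsp N \<Otimes>\<^sub>M Rsp m)
      = (Pi\<^sub>E {..<N} A) \<times> (Pi\<^sub>E {..<m} (\<lambda>i. A (N + i)))"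
  proof (intro equalityI subsetI)
    fix p assume p: "p \<in> (\<lambda>p. join N m (fst p) (snd p)) -` (Pi\<^sub>E {..<N + m} A) \<inter> space (Rsp N \<Otimes>\<^sub>M Rsp m)"
    obtain x y where pxy: "p = (x, y)" by fastforce
    have h: "(x, y) \<in> space (Rsp N \<Otimes>\<^sub>M Rsp m)" "join N m x y \<in> Pi\<^sub>E {..<N + m} A" using p pxy by auto
    have j: "join N m x y i \<in> A i" if "i < N + m" for i using h(2) that by (auto simp: PiE_iff)
    have sp: "x \<in> {..<N} \<rightarrow>\<^sub>E UNIV" "y \<in> {..<m} \<rightarrow>\<^sub>E UNIV" using h(1) by (auto simp: space_pair_measure space_Rsp)
    show "p \<in> Pi\<^sub>E {..<N} A \<times> Pi\<^sub>E {..<m} (\<lambda>i. A (N + i))"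
      unfolding pxy
    proof (intro SigmaI PiE_I)
      fix i assume "i \<in> {..<N}" thus "x i \<in> A i" using j[of i] by (simp add: join_def)
    next
      fix i assume "i \<notin> {..<N}" thus "x i = undefined" using sp(1) by (auto simp: PiE_iff extensional_def)
    next
      fix i assume "i \<in> {..<m}" thus "y i \<in> A (N + i)" using j[of "N + i"] by (simp add: join_def)
    next
      fix i assume "i \<notin> {..<m}" thus "y i = undefined" using sp(2) by (auto simp: PiE_iff extensional_def)
    qed
  next
    fix p assume "p \<in> Pi\<^sub>E {..<N} A \<times> Pi\<^sub>E {..<m} (\<lambda>i. A (N + i))"
    then obtain x y where pxy: "p = (x, y)"
      and h: "x \<in> Pi\<^sub>E {..<N} A" "y \<in> Pi\<^sub>E {..<m} (\<lambda>i. A (N + i))" by auto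
    have "join N m x y \<in> Pi\<^sub>E {..<N + m} A"
    proof (rule PiE_I)
      fix i assume i: "i \<in> {..<N + m}"
      show "join N m x y i \<in> A i"
      proof (cases "i < N")
        case True thus ?thesis using h by (auto simp: join_def PiE_iff)
      next
        case False
        hence "y (i - N) \<in> A (N + (i - N))" using h i by (intro PiE_mem[OF h(2)]) auto
        thus ?thesis using False i by (simp add: join_def)
      qed
    qed (auto simp: join_def)
    thus "p \<in> (\<lambda>p. join N m (fst p) (snd p)) -` Pi\<^sub>E {..<N + m} A \<inter> space (Rsp N \<Otimes>\<^sub>M Rsp m)"
      using h by (auto simp: pxy space_pair_measure space_Rsp PiE_iff)
  qed
  have mj: "(\<lambda>p. join N m (fst p) (snd p)) \<in> Rsp N \<Otimes>\<^sub>M Rsp m \<rightarrow>\<^sub>M Pi\<^sub>M {..<N + m} (\<lambda>_. lborel)"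
    using measurable_join[of N m] by (simp add: Rsp_def[of "N + m"])
  have AN: "Pi\<^sub>E {..<N} A \<in> sets (Rsp N)" "Pi\<^sub>E {..<m} (\<lambda>i. A (N + i)) \<in> sets (Rsp m)"
    unfolding Rsp_def by (rule sets_PiM_I_finite; use A in auto)+
  have "emeasure (distr (Rsp N \<Otimes>\<^sub>M Rsp m) (Pi\<^sub>M {..<N + m} (\<lambda>_. lborel)) (\<lambda>p. join N m (fst p) (snd p))) (Pi\<^sub>E {..<N + m} A)
     = emeasure (Rsp N \<Otimes>\<^sub>M Rsp m) ((Pi\<^sub>E {..<N} A) \<times> (Pi\<^sub>E {..<m} (\<lambda>i. A (N + i))))"
    unfolding pre[symmetric] by (rule emeasure_distr[OF mj]) (use A in \<open>auto intro!: sets_PiM_I_finite\<close>)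
  also have "\<dots> = emeasure (Rsp N) (Pi\<^sub>E {..<N} A) * emeasure (Rsp m) (Pi\<^sub>E {..<m} (\<lambda>i. A (N + i)))"
    by (rule m.emeasure_pair_measure_Times[OF AN])
  also have "\<dots> = (\<Prod>i<N. emeasure lborel (A i)) * (\<Prod>i<m. emeasure lborel (A (N + i)))"
    unfolding Rsp_def using A by (subst (1 2) lborel_prod.emeasure_PiM) auto
  also have "\<dots> = (\<Prod>i<N + m. emeasure lborel (A i))"
    by (induction m) (simp_all add: mult.assoc[symmetric])
  finally show "emeasure (distr (Rsp N \<Otimes>\<^sub>M Rsp m) (Pi\<^sub>M {..<N + m} (\<lambda>_. lborel)) (\<lambda>p. join N m (fst p) (snd p))) (Pi\<^sub>E {..<N + m} A)
     = (\<Prod>i<N + m. emeasure lborel (A i))" .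
qed auto

text \<open>The inner integral is over \<open>x\<close> with \<open>y\<close> fixed: the order in
  which a Gaussian with \<open>udu\<close> covariance splits into conditional and marginal.\<close>

lemma nn_integral_Rsp_join:
  assumes f: "f \<in> borel_measurable (Rsp (N + m))"
  shows "(\<integral>\<^sup>+ z. f z \<partial>Rsp (N + m)) = (\<integral>\<^sup>+ y. \<integral>\<^sup>+ x. f (join N m x y) \<partial>Rsp N \<partial>Rsp m)"
proof -
  interpret pair_sigma_finite "Rsp N" "Rsp m"
    by (intro pair_sigma_finite.intro sigma_finite_Rsp)
  have fj: "(\<lambda>p. f (join N m (fst p) (snd p))) \<in> borel_measurable (Rsp N \<Otimes>\<^sub>M Rsp m)"
    using measurable_compose[OF measurable_join f] .
  have "(\<integral>\<^sup>+ z. f z \<partial>Rsp (N + m)) = (\<integral>\<^sup>+ p. f (join N m (fst p) (snd p)) \<partial>(Rsp N \<Otimes>\<^sub>M Rsp m))"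
    using nn_integral_distr[OF measurable_join[of N m], of f] f by (simp add: distr_join)
  also have "\<dots> = (\<integral>\<^sup>+ y. \<integral>\<^sup>+ x. f (join N m x y) \<partial>Rsp N \<partial>Rsp m)"
    using nn_integral_snd[of "\<lambda>p. f (join N m (fst p) (snd p))"] fj by (simp add: split_beta)
  finally show ?thesis .
qed

section \<open>Gaussian densities: measurability, factorisation, moments\<close>

lemma quadratic_form_sum:
  fixes M :: "real mat"
  assumes "M \<in> carrier_mat d d" "mu \<in> carrier_vec d"
  shows "(vec d z - mu) \<bullet> (M *\<^sub>v (vec d z - mu))
     = (\<Sum>i<d. (z i - mu $ i) * (\<Sum>j<d. M $$ (i, j) * (z j - mu $ j)))"
  using assms by (auto simp: scalar_prod_def atLeast0LessThan intro!: sum.cong)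

lemma linear_form_sum:
  fixes mu :: "real vec"
  assumes "mu \<in> carrier_vec d"
  shows "v \<bullet> (vec d z - mu) = (\<Sum>i<d. v $ i * (z i - mu $ i))"
  using assms by (auto simp: scalar_prod_def atLeast0LessThan intro!: sum.cong)

lemma gauss_measurable:
  assumes "sym_pd d K" "mu \<in> carrier_vec d"
  shows "gauss d mu K \<in> borel_measurable (Rsp d)"
  unfolding gauss_def[abs_def] quadratic_form_sum[OF sym_pd_minv_inverse(1)[OF assms(1)] assms(2)]
  by measurable

lemma linear_form_measurable:
  assumes "mu \<in> carrier_vec d"
  shows "(\<lambda>z. v \<bullet> (vec d z - mu)) \<in> borel_measurable (Rsp d)"
  unfolding linear_form_sum[OF assms] by measurable

lemma gauss_pos:
  assumes "sym_pd d K" shows "0 < gauss d mu K z"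
  using sym_pd_det_pos[OF assms] by (simp add: gauss_def)

lemma gauss_nonneg:
  assumes "sym_pd d K" shows "0 \<le> gauss d mu K z"
  using gauss_pos[OF assms] by (rule less_imp_le)

text \<open>The exponent splits by \<open>minv_udu_form\<close> and the normalising constant by
  \<open>udu_det\<close>. The first factor is the conditional density of \<open>x\<close> given
  \<open>y\<close>, the second the marginal of \<open>y\<close>, which does not involve
  \<open>W\<close>.\<close>

lemma gauss_udu:
  assumes G: "G \<in> carrier_mat N m" and W: "sym_pd N W" and S: "sym_pd m S"
    and mx: "mx \<in> carrier_vec N" and my: "my \<in> carrier_vec m"
  shows "gauss (N + m) (mx @\<^sub>v my) (udu N m G W S) (join N m x y)
     = gauss N (mx + G *\<^sub>v (vec m y - my)) W x * gauss m my S y"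
proof -
  let ?b = "vec m y - my" and ?a = "vec N x - mx"
  have d: "vec (N + m) (join N m x y) - (mx @\<^sub>v my) = ?a @\<^sub>v ?b"
    unfolding vec_join using mx my by (intro eq_vecI) auto
  have e: "?a - G *\<^sub>v ?b = vec N x - (mx + G *\<^sub>v ?b)"
    using mx my G by (intro eq_vecI) auto
  have a: "?a \<in> carrier_vec N" and b: "?b \<in> carrier_vec m" using mx my by auto
  have "sqrt ((2 * pi) ^ (N + m) * det (udu N m G W S))
    = sqrt ((2 * pi) ^ N * det W) * sqrt ((2 * pi) ^ m * det S)"
    unfolding udu_det[OF G sym_pdD(1)[OF W] sym_pdD(1)[OF S]]
    by (simp add: power_add real_sqrt_mult[symmetric] algebra_simps)
  thus ?thesis
    unfolding gauss_def d minv_udu_form[OF G W S a b] e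
    by (simp add: exp_add[symmetric] algebra_simps add_divide_distrib)
qed

lemma gauss_moment_one:
  assumes K: "sym_pd 1 K" and mu: "mu \<in> carrier_vec 1" and v: "v \<in> carrier_vec 1"
  shows "(\<integral>\<^sup>+ x. ennreal (gauss 1 mu K x * (a + v \<bullet> (vec 1 x - mu))\<^sup>2) \<partial>Rsp 1)
     = ennreal (a\<^sup>2 + v \<bullet> (K *\<^sub>v v))"
proof -
  note K' = sym_pdD[OF K] sym_pd_minv_inverse[OF K]
  define s m c where "s = K $$ (0, 0)" and "m = mu $ 0" and "c = v $ 0"
  have dK: "det K = s" using det_single[OF K'(1)] by (simp add: s_def)
  have s: "s > 0" using sym_pd_det_pos[OF K] dK by simp
  have "(minv K * K) $$ (0, 0) = minv K $$ (0, 0) * s"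
    using K'(1,5) by (simp add: scalar_prod_def s_def)
  hence "minv K $$ (0, 0) * s = 1" using K'(7) by simp
  hence i: "minv K $$ (0, 0) = 1 / s" using s by (simp add: field_simps)
  have q: "(vec 1 x - mu) \<bullet> (minv K *\<^sub>v (vec 1 x - mu)) = (x 0 - m)\<^sup>2 / s" for x
    unfolding quadratic_form_sum[OF K'(5) mu] by (simp add: i m_def power2_eq_square)
  have l: "v \<bullet> (vec 1 x - mu) = c * (x 0 - m)" for x
    unfolding linear_form_sum[OF mu] by (simp add: c_def m_def)
  have vKv: "v \<bullet> (K *\<^sub>v v) = c\<^sup>2 * s"
    using K'(1) v by (simp add: scalar_prod_def c_def s_def power2_eq_square)
  have g: "gauss 1 mu K x = normal_density m (sqrt s) (x 0)" for x
    unfolding gauss_def q dK normal_density_def using s by simp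
  have "(\<integral>\<^sup>+ x. ennreal (gauss 1 mu K x * (a + v \<bullet> (vec 1 x - mu))\<^sup>2) \<partial>Rsp 1)
     = (\<integral>\<^sup>+ x. (\<lambda>t. ennreal (normal_density m (sqrt s) t * (a + c * (t - m))\<^sup>2)) (x 0) \<partial>Pi\<^sub>M {0} (\<lambda>_::nat. lborel))"
    unfolding Rsp_def g l by (simp add: lessThan_Suc)
  also have "\<dots> = (\<integral>\<^sup>+ t. ennreal (normal_density m (sqrt s) t * (a + c * (t - m))\<^sup>2) \<partial>lborel)"
    by (rule lborel_prod.product_nn_integral_singleton) auto
  also have "\<dots> = ennreal (a\<^sup>2 + c\<^sup>2 * s)"
  proof -
    have ss: "0 < sqrt s" using s by simp
    \<comment> \<open>Expanding the square leaves moments of order 0, 1 and 2 of the normal law. The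
      one of order 1 vanishes, which removes the cross term.\<close>
    have 0: "has_bochner_integral lborel (\<lambda>t. a\<^sup>2 * normal_density m (sqrt s) t) (a\<^sup>2 * 1)"
      using normal_moment_even[OF ss, of m 0] by (intro has_bochner_integral_mult_right) simp
    have 1: "has_bochner_integral lborel (\<lambda>t. (2 * a * c) * (normal_density m (sqrt s) t * (t - m))) ((2 * a * c) * 0)"
      using normal_moment_odd[OF ss, of m 0] by (intro has_bochner_integral_mult_right) simp
    have 2: "has_bochner_integral lborel (\<lambda>t. c\<^sup>2 * (normal_density m (sqrt s) t * (t - m)\<^sup>2)) (c\<^sup>2 * s)"
      using normal_moment_even[OF ss, of m 1] s by (intro has_bochner_integral_mult_right) (simp add: fact_numeral)
    have "has_bochner_integral lborel (\<lambda>t. normal_density m (sqrt s) t * (a + c * (t - m))\<^sup>2) (a\<^sup>2 + c\<^sup>2 * s)"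
      using has_bochner_integral_add[OF has_bochner_integral_add[OF 0 1] 2]
      by (simp add: power2_eq_square algebra_simps)
    thus ?thesis
      by (subst nn_integral_eq_integral) (auto simp: has_bochner_integral_iff)
  qed
  finally show ?thesis by (simp add: vKv)
qed

text \<open>Quantifying over \<open>a\<close> packs normalisation, mean and covariance into one identity between
  integrals of nonnegative functions, so that Tonelli applies without integrability conditions.\<close>

definition gauss_moments :: "nat \<Rightarrow> real mat \<Rightarrow> bool" where
  "gauss_moments d K \<longleftrightarrow> (\<forall>mu\<in>carrier_vec d. \<forall>v\<in>carrier_vec d. \<forall>a.
     (\<integral>\<^sup>+ x. ennreal (gauss d mu K x * (a + v \<bullet> (vec d x - mu))\<^sup>2) \<partial>Rsp d)
     = ennreal (a\<^sup>2 + v \<bullet> (K *\<^sub>v v)))"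

lemma gauss_moments_const:
  assumes "gauss_moments d K" "K \<in> carrier_mat d d" "mu \<in> carrier_vec d" "0 \<le> c"
  shows "(\<integral>\<^sup>+ x. ennreal (gauss d mu K x * c) \<partial>Rsp d) = ennreal c"
proof -
  have z: "K *\<^sub>v 0\<^sub>v d = 0\<^sub>v d" using assms by auto
  \<comment> \<open>The moment identity at \<open>v = 0\<close> and \<open>a = sqrt c\<close>; the
    case \<open>c = 1\<close> is normalisation.\<close>
  have "(\<integral>\<^sup>+ x. ennreal (gauss d mu K x * (sqrt c + 0\<^sub>v d \<bullet> (vec d x - mu))\<^sup>2) \<partial>Rsp d)
     = ennreal ((sqrt c)\<^sup>2 + 0\<^sub>v d \<bullet> (K *\<^sub>v 0\<^sub>v d))"
    by (rule assms(1)[unfolded gauss_moments_def, rule_format, OF assms(3) zero_carrier_vec])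
  thus ?thesis using assms z by simp
qed

lemma gauss_moments_udu:
  assumes G: "G \<in> carrier_mat N m" and W: "sym_pd N W" and S: "sym_pd m S"
    and MW: "gauss_moments N W" and MS: "gauss_moments m S"
  shows "gauss_moments (N + m) (udu N m G W S)"
  unfolding gauss_moments_def
proof (intro ballI allI)
  fix mu v :: "real vec" and a :: real
  assume "mu \<in> carrier_vec (N + m)" and "v \<in> carrier_vec (N + m)"
  then obtain mx my u w where
    mu: "mu = mx @\<^sub>v my" "mx \<in> carrier_vec N" "my \<in> carrier_vec m" and
    v: "v = u @\<^sub>v w" "u \<in> carrier_vec N" "w \<in> carrier_vec m"
    by (metis vec_first_last_append vec_first_carrier vec_last_carrier)
  let ?K = "udu N m G W S"
  note K = sym_pd_udu[OF G W S] and W' = sym_pdD[OF W] and S' = sym_pdD[OF S]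
  have muc: "mu \<in> carrier_vec (N + m)" using mu by simp
  let ?r = "transpose_mat G *\<^sub>v u + w"
  have r: "?r \<in> carrier_vec m" using G v by auto
  have [measurable]: "gauss (N + m) mu ?K \<in> borel_measurable (Rsp (N + m))"
    "(\<lambda>z. v \<bullet> (vec (N + m) z - mu)) \<in> borel_measurable (Rsp (N + m))"
    "gauss m my S \<in> borel_measurable (Rsp m)" "(\<lambda>z. ?r \<bullet> (vec m z - my)) \<in> borel_measurable (Rsp m)"
    using gauss_measurable[OF K muc] linear_form_measurable[OF muc] gauss_measurable[OF S mu(3)]
      linear_form_measurable[OF mu(3)] by auto
  \<comment> \<open>The linear form splits like the covariance: a part in the conditional residual
    of \<open>x\<close>, and a part in \<open>y\<close> with the coefficient
    \<open>G^T u + w\<close> known from \<open>udu_form\<close>.\<close>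
  have lin: "v \<bullet> (vec (N + m) (join N m x y) - mu)
      = ?r \<bullet> (vec m y - my) + u \<bullet> (vec N x - (mx + G *\<^sub>v (vec m y - my)))" for x y
  proof -
    let ?b = "vec m y - my"
    have b: "?b \<in> carrier_vec m" using mu by auto
    have "vec (N + m) (join N m x y) - mu = (vec N x - mx) @\<^sub>v ?b"
      unfolding vec_join mu(1) using mu by (intro eq_vecI) auto
    moreover have "vec N x - mx = (vec N x - (mx + G *\<^sub>v ?b)) + G *\<^sub>v ?b"
      using mu G by (intro eq_vecI) auto
    ultimately have "v \<bullet> (vec (N + m) (join N m x y) - mu)
       = u \<bullet> ((vec N x - (mx + G *\<^sub>v ?b)) + G *\<^sub>v ?b) + w \<bullet> ?b"
      using v mu G b by (simp add: scalar_prod_append[of _ N _ m])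
    also have "\<dots> = u \<bullet> (vec N x - (mx + G *\<^sub>v ?b)) + u \<bullet> (G *\<^sub>v ?b) + w \<bullet> ?b"
      using v mu G b by (subst scalar_prod_add_distrib[of _ N]) auto
    also have "u \<bullet> (G *\<^sub>v ?b) = (transpose_mat G *\<^sub>v u) \<bullet> ?b"
      using transpose_vec_mult_scalar[OF G b v(2)] by simp
    finally show ?thesis
      using G v b by (simp add: add_scalar_prod_distrib[of _ m])
  qed
  have "(\<integral>\<^sup>+ x. ennreal (gauss (N + m) mu ?K x * (a + v \<bullet> (vec (N + m) x - mu))\<^sup>2) \<partial>Rsp (N + m))
    = (\<integral>\<^sup>+ y. \<integral>\<^sup>+ x. ennreal (gauss (N + m) mu ?K (join N m x y) * (a + v \<bullet> (vec (N + m) (join N m x y) - mu))\<^sup>2) \<partial>Rsp N \<partial>Rsp m)"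
    by (rule nn_integral_Rsp_join) measurable
  also have "\<dots> = (\<integral>\<^sup>+ y. ennreal (gauss m my S y * (a + ?r \<bullet> (vec m y - my))\<^sup>2) + ennreal (gauss m my S y * (u \<bullet> (W *\<^sub>v u))) \<partial>Rsp m)"
  proof (rule nn_integral_cong)
    fix y
    let ?mu = "mx + G *\<^sub>v (vec m y - my)" and ?g = "gauss m my S y"
    have muy: "?mu \<in> carrier_vec N" using mu G by auto
    have [measurable]: "gauss N ?mu W \<in> borel_measurable (Rsp N)"
      "(\<lambda>x. u \<bullet> (vec N x - ?mu)) \<in> borel_measurable (Rsp N)"
      using gauss_measurable[OF W muy] linear_form_measurable[OF muy] by auto
    \<comment> \<open>The inner integral is the moment identity for \<open>W\<close> with an offset
      that depends on \<open>y\<close>; the induction therefore needs it for every \<open>a\<close>.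
      The square of that offset is then the integrand of the identity for \<open>S\<close>.\<close>
    have "(\<integral>\<^sup>+ x. ennreal (gauss (N + m) mu ?K (join N m x y) * (a + v \<bullet> (vec (N + m) (join N m x y) - mu))\<^sup>2) \<partial>Rsp N)
      = (\<integral>\<^sup>+ x. ennreal ?g * ennreal (gauss N ?mu W x * ((a + ?r \<bullet> (vec m y - my)) + u \<bullet> (vec N x - ?mu))\<^sup>2) \<partial>Rsp N)"
      unfolding mu(1) gauss_udu[OF G W S mu(2,3)] lin[unfolded mu(1)]
      using gauss_nonneg[OF W] gauss_nonneg[OF S]
      by (intro nn_integral_cong) (simp add: ennreal_mult'[symmetric] mult_ac add_ac)
    also have "\<dots> = ennreal ?g * ennreal ((a + ?r \<bullet> (vec m y - my))\<^sup>2 + u \<bullet> (W *\<^sub>v u))"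
      using MW muy v(2) unfolding gauss_moments_def by (subst nn_integral_cmult) auto
    also have "\<dots> = ennreal (?g * (a + ?r \<bullet> (vec m y - my))\<^sup>2) + ennreal (?g * (u \<bullet> (W *\<^sub>v u)))"
      using gauss_nonneg[OF S, of my y] W'(4)[OF v(2)]
      by (simp add: ennreal_mult'[symmetric] ennreal_plus[symmetric] distrib_left del: ennreal_plus)
    finally show "(\<integral>\<^sup>+ x. ennreal (gauss (N + m) mu ?K (join N m x y) * (a + v \<bullet> (vec (N + m) (join N m x y) - mu))\<^sup>2) \<partial>Rsp N)
       = ennreal (?g * (a + ?r \<bullet> (vec m y - my))\<^sup>2) + ennreal (?g * (u \<bullet> (W *\<^sub>v u)))" .
  qed
  also have "\<dots> = ennreal (a\<^sup>2 + ?r \<bullet> (S *\<^sub>v ?r)) + ennreal (u \<bullet> (W *\<^sub>v u))"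
    using MS mu(3) r gauss_moments_const[OF MS S'(1) mu(3) W'(4)[OF v(2)]]
    by (subst nn_integral_add) (auto simp: gauss_moments_def)
  also have "\<dots> = ennreal (a\<^sup>2 + v \<bullet> (?K *\<^sub>v v))"
    using S'(4)[OF r] W'(4)[OF v(2)] udu_form[OF G W'(1) S'(1) v(2,3)] v(1)
    by (simp add: ennreal_plus[symmetric] add_ac del: ennreal_plus)
  finally show "(\<integral>\<^sup>+ x. ennreal (gauss (N + m) mu ?K x * (a + v \<bullet> (vec (N + m) x - mu))\<^sup>2) \<partial>Rsp (N + m))
    = ennreal (a\<^sup>2 + v \<bullet> (?K *\<^sub>v v))" .
qed

text \<open>The last coordinate is split off as a one-dimensional \<open>y\<close>. In dimension 0
  the measure sits on a single point and the density is 1.\<close>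

lemma gauss_moments: "sym_pd d K \<Longrightarrow> gauss_moments d K"
proof (induction d arbitrary: K)
  case 0
  have K: "K \<in> carrier_mat 0 0" using sym_pdD(1)[OF 0] .
  show ?case unfolding gauss_moments_def
  proof (intro ballI allI)
    fix mu v :: "real vec" and a :: real assume c: "mu \<in> carrier_vec 0" "v \<in> carrier_vec 0"
    have "gauss 0 mu K x = 1" for x
      using c K by (simp add: gauss_def scalar_prod_def minv_eqI[OF K K])
    moreover have "v \<bullet> (vec 0 x - mu) = 0" for x using c by (simp add: scalar_prod_def)
    moreover have "v \<bullet> (K *\<^sub>v v) = 0" using c K by (simp add: scalar_prod_def)
    ultimately show "(\<integral>\<^sup>+ x. ennreal (gauss 0 mu K x * (a + v \<bullet> (vec 0 x - mu))\<^sup>2) \<partial>Rsp 0)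
       = ennreal (a\<^sup>2 + v \<bullet> (K *\<^sub>v v))"
      by (simp add: Rsp_def PiM_empty)
  qed
next
  case (Suc d)
  hence "sym_pd (d + 1) K" by simp
  then obtain G W S where *: "G \<in> carrier_mat d 1" "sym_pd d W" "sym_pd 1 S" "K = udu d 1 G W S"
    by (rule sym_pd_udu_exists)
  have "gauss_moments 1 S" using gauss_moment_one[OF *(3)] by (auto simp: gauss_moments_def)
  from gauss_moments_udu[OF *(1,2,3) Suc.IH[OF *(2)] this] show ?case by (simp add: *(4))
qed

section \<open>Spectra of symmetrizable matrices\<close>

lemma mtrace_mult_commute:
  assumes "X \<in> carrier_mat k l" "Y \<in> carrier_mat l k"
  shows "mtrace (X * Y) = mtrace (Y * X)"
proof -
  have "mtrace (X * Y) = (\<Sum>i<k. \<Sum>j<l. X $$ (i, j) * Y $$ (j, i))"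
    using assms by (auto simp: mtrace_def scalar_prod_def atLeast0LessThan intro!: sum.cong)
  also have "\<dots> = (\<Sum>j<l. \<Sum>i<k. Y $$ (j, i) * X $$ (i, j))"
    by (subst sum.swap) (simp add: mult.commute)
  also have "\<dots> = mtrace (Y * X)"
    using assms by (auto simp: mtrace_def scalar_prod_def atLeast0LessThan intro!: sum.cong)
  finally show ?thesis .
qed

lemma mtrace_similar:
  assumes "similar_mat_wit A B X Y" and A: "A \<in> carrier_mat k k"
  shows "mtrace A = mtrace B"
proof -
  have *: "B \<in> carrier_mat k k" "X \<in> carrier_mat k k" "Y \<in> carrier_mat k k" "Y * X = 1\<^sub>m k" "A = X * B * Y"
    using assms by (auto simp: similar_mat_wit_def Let_def)
  have "mtrace A = mtrace (Y * (X * B))"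
    unfolding *(5) using * by (intro mtrace_mult_commute) auto
  also have "Y * (X * B) = (Y * X) * B" using *(1-3) by simp
  also have "\<dots> = B" using *(1,4) by simp
  finally show ?thesis .
qed

text \<open>Column \<open>j\<close> of \<open>X * T\<close> involves only columns up to
  \<open>j\<close> of \<open>X\<close>. Going through the columns from the left kills the entries of
  \<open>X\<close> below the diagonal, and on the diagonal a single product remains.\<close>

lemma upper_triangular_inverse_diag:
  fixes T :: "real mat"
  assumes T: "T \<in> carrier_mat k k" and X: "X \<in> carrier_mat k k"
    and ut: "upper_triangular T" and XT: "X * T = 1\<^sub>m k" and nz: "\<And>i. i < k \<Longrightarrow> T $$ (i, i) \<noteq> 0"
    and i: "i < k"
  shows "X $$ (i, i) = 1 / T $$ (i, i)"
proof -
  have entry: "(\<Sum>l\<le>j. X $$ (i, l) * T $$ (l, j)) = (if i = j then 1 else 0)" if "i < k" "j < k" for i j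
  proof -
    have "(\<Sum>l\<le>j. X $$ (i, l) * T $$ (l, j)) = (\<Sum>l<k. X $$ (i, l) * T $$ (l, j))"
      using that upper_triangularD[OF ut] T by (intro sum.mono_neutral_left) auto
    also have "\<dots> = (X * T) $$ (i, j)"
      using that X T by (simp add: scalar_prod_def atLeast0LessThan)
    finally show ?thesis using that by (simp add: XT)
  qed
  have low: "X $$ (i, j) = 0" if "i < k" "j < i" for i j
    using that
  proof (induction j rule: less_induct)
    case (less j)
    have "(\<Sum>l\<le>j. X $$ (i, l) * T $$ (l, j)) = (\<Sum>l<j. X $$ (i, l) * T $$ (l, j)) + X $$ (i, j) * T $$ (j, j)"
      by (simp add: lessThan_Suc_atMost[symmetric])
    also have "(\<Sum>l<j. X $$ (i, l) * T $$ (l, j)) = 0" using less by (intro sum.neutral) auto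
    finally show ?case using entry[of i j] nz[of j] less.prems by simp
  qed
  have "(\<Sum>l\<le>i. X $$ (i, l) * T $$ (l, i)) = (\<Sum>l<i. X $$ (i, l) * T $$ (l, i)) + X $$ (i, i) * T $$ (i, i)"
    by (simp add: lessThan_Suc_atMost[symmetric])
  also have "(\<Sum>l<i. X $$ (i, l) * T $$ (l, i)) = 0" using low i by (intro sum.neutral) auto
  finally show ?thesis using entry[of i i] nz[OF i] i by (simp add: field_simps)
qed

text \<open>Over the complex numbers the characteristic polynomial splits. If all roots are real,
  the splitting descends along the injective embedding, and Schur decomposition applies over the
  reals.\<close>

lemma real_splitting_triangular:
  fixes M :: "real mat"
  assumes M: "M \<in> carrier_mat N N"
    and re: "\<And>e :: complex. eigenvalue (map_mat of_real M) e \<Longrightarrow> e \<in> \<real>"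
  obtains B X Y where "similar_mat_wit M B X Y" "upper_triangular B"
    "\<And>k. eigenvalue M k \<longleftrightarrow> (\<exists>i<N. k = B $$ (i, i))"
proof -
  interpret map_poly_inj_idom_hom "of_real :: real \<Rightarrow> complex" ..
  have MC: "map_mat complex_of_real M \<in> carrier_mat N N" using M by simp
  obtain as where as: "char_poly (map_mat complex_of_real M) = (\<Prod>a\<leftarrow>as. [:- a, 1:])" "length as = N"
    using char_poly_factorized[OF MC] by blast
  have "a \<in> \<real>" if "a \<in> set as" for a
    using that re eigenvalue_root_char_poly[OF MC] linear_poly_root[OF that] as(1) by metis
  hence "map complex_of_real (map Re as) = as" by (induction as) (auto simp: complex_is_Real_iff complex_eq_iff)
  then obtain es where es: "as = map complex_of_real es" by metis
  have "map_poly complex_of_real (char_poly M) = map_poly complex_of_real (\<Prod>e\<leftarrow>es. [:- e, 1:])"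
    using as(1) unfolding es of_real_hom.char_poly_hom[OF M]
    by (simp add: hom_prod_list o_def)
  hence cp: "char_poly M = (\<Prod>e\<leftarrow>es. [:- e, 1:])" by simp
  obtain B X Y where dec: "schur_decomposition M es = (B, X, Y)" by (metis prod_cases3)
  from schur_decomposition[OF M cp dec]
  have *: "similar_mat_wit M B X Y" "upper_triangular B" "diag_mat B = es" by auto
  have B: "B \<in> carrier_mat N N" using *(1) M by (auto simp: similar_mat_wit_def Let_def)
  have "eigenvalue M k \<longleftrightarrow> k \<in> set es" for k
    unfolding eigenvalue_root_char_poly[OF M] cp poly_prod_list_zero_iff by auto
  moreover have "set es = (\<lambda>i. B $$ (i, i)) ` {..<N}"
    unfolding *(3)[symmetric] diag_mat_def using carrier_matD(1)[OF B] by (simp add: atLeast0LessThan)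
  ultimately have "eigenvalue M k \<longleftrightarrow> (\<exists>i<N. k = B $$ (i, i))" for k by auto
  thus thesis using that *(1,2) by blast
qed

text \<open>The change of basis that triangularises \<open>M\<close> also triangularises
  \<open>1 - s M\<close>, and conjugates its inverse to the inverse of a triangular matrix, so both
  quantities can be read off the diagonal.\<close>

lemma det_trace_resolvent:
  fixes M :: "real mat"
  assumes M: "M \<in> carrier_mat N N" and sim: "similar_mat_wit M B X Y" and ut: "upper_triangular B"
    and nz: "\<And>i. i < N \<Longrightarrow> 1 - s * B $$ (i, i) \<noteq> 0"
  shows "det (1\<^sub>m N - s \<cdot>\<^sub>m M) = (\<Prod>i<N. 1 - s * B $$ (i, i))"
    and "mtrace (minv (1\<^sub>m N - s \<cdot>\<^sub>m M) - 1\<^sub>m N) = (\<Sum>i<N. 1 / (1 - s * B $$ (i, i)) - 1)"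
proof -
  have *: "B \<in> carrier_mat N N" "X \<in> carrier_mat N N" "Y \<in> carrier_mat N N" "X * Y = 1\<^sub>m N" "Y * X = 1\<^sub>m N" "M = X * B * Y"
    using sim M by (auto simp: similar_mat_wit_def Let_def)
  define T where "T = 1\<^sub>m N - s \<cdot>\<^sub>m B"
  define Q where "Q = 1\<^sub>m N - s \<cdot>\<^sub>m M"
  have T: "T \<in> carrier_mat N N" and Q: "Q \<in> carrier_mat N N" using * M by (auto simp: T_def Q_def)
  have Td: "T $$ (i, i) = 1 - s * B $$ (i, i)" if "i < N" for i using that * by (simp add: T_def)
  have utT: "upper_triangular T" using ut *(1) by (auto simp: T_def upper_triangular_def)
  have QT: "Q = X * T * Y"
  proof -
    have "X * T * Y = X * 1\<^sub>m N * Y - X * (s \<cdot>\<^sub>m B) * Y"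
    proof -
      have "X * T = X * 1\<^sub>m N - X * (s \<cdot>\<^sub>m B)"
        unfolding T_def using *(1,2) by (intro mult_minus_distrib_mat) auto
      thus ?thesis using minus_mult_distrib_mat[of "X * 1\<^sub>m N" N N "X * (s \<cdot>\<^sub>m B)" Y N] *(1-3) by simp
    qed
    also have "X * (s \<cdot>\<^sub>m B) * Y = s \<cdot>\<^sub>m M"
    proof -
      have "X * (s \<cdot>\<^sub>m B) = s \<cdot>\<^sub>m (X * B)" by (rule mult_smult_distrib[OF *(2,1)])
      thus ?thesis using mult_smult_assoc_mat[of "X * B" N N Y N s] *(1-3,6) by simp
    qed
    finally show ?thesis using *(2-4) by (simp add: Q_def)
  qed
  have sQ: "similar_mat_wit Q T X Y"
    using QT Q T * by (auto simp: similar_mat_wit_def Let_def)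
  have "det Q = det T" by (rule det_similar) (use sQ in \<open>auto simp: similar_mat_def\<close>)
  also have "\<dots> = prod_list (diag_mat T)" by (rule det_upper_triangular[OF utT T])
  also have "\<dots> = (\<Prod>i<N. T $$ (i, i))"
    using T by (simp add: diag_mat_def prod.list_conv_set_nth atLeast0LessThan)
  finally have dQ: "det Q = (\<Prod>i<N. T $$ (i, i))" .
  thus "det (1\<^sub>m N - s \<cdot>\<^sub>m M) = (\<Prod>i<N. 1 - s * B $$ (i, i))" using Td by (simp add: Q_def)
  have nzT: "T $$ (i, i) \<noteq> 0" if "i < N" for i using nz[OF that] Td[OF that] by simp
  have dT: "det T \<noteq> 0" using \<open>det Q = det T\<close> dQ nzT by auto
  note I = minv_inverse[OF T dT]
  have "Q * (X * minv T * Y) = X * (T * ((Y * X) * (minv T * Y)))"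
    unfolding QT using *(1-3) T I(1) by (simp add: assoc_mult_mat[of _ N N _ N _ N])
  also have "\<dots> = X * ((T * minv T) * Y)"
    unfolding *(5) using *(1-3) T I(1) by (simp add: assoc_mult_mat[of _ N N _ N _ N])
  also have "\<dots> = 1\<^sub>m N" using * I by simp
  finally have "minv Q = X * minv T * Y" using minv_eqI[OF Q] * I(1) by simp
  hence sI: "similar_mat_wit (minv Q) (minv T) X Y" and Ic: "minv Q \<in> carrier_mat N N"
    using * I(1) by (auto simp: similar_mat_wit_def Let_def)
  have "mtrace (minv Q - 1\<^sub>m N) = mtrace (minv Q) - real N"
    using Ic by (simp add: mtrace_def sum_subtractf)
  also have "mtrace (minv Q) = mtrace (minv T)" by (rule mtrace_similar[OF sI Ic])
  also have "\<dots> = (\<Sum>i<N. 1 / T $$ (i, i))"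
    using I(1) upper_triangular_inverse_diag[OF T I(1) utT I(3) nzT] by (simp add: mtrace_def)
  finally show "mtrace (minv (1\<^sub>m N - s \<cdot>\<^sub>m M) - 1\<^sub>m N) = (\<Sum>i<N. 1 / (1 - s * B $$ (i, i)) - 1)"
    using Td by (simp add: Q_def sum_subtractf)
qed

lemma map_vec_Re_mult:
  fixes M :: "real mat"
  assumes "M \<in> carrier_mat N N" "v \<in> carrier_vec N"
  shows "map_vec Re (map_mat complex_of_real M *\<^sub>v v) = M *\<^sub>v map_vec Re v"
    "map_vec Im (map_mat complex_of_real M *\<^sub>v v) = M *\<^sub>v map_vec Im v"
  using assms by (auto intro!: eq_vecI sum.cong simp: scalar_prod_def)

text \<open>\<open>M\<close> is self-adjoint for the inner product given by \<open>P\<close>. To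
  stay with real forms, an eigenvector is split as \<open>a + i b\<close>; symmetry of
  \<open>P * M\<close> between \<open>a\<close> and \<open>b\<close> says that \<open>Im e\<close>
  times the sum of their squared \<open>P\<close>-norms is zero.\<close>

lemma symmetrizable_complex_eigenvalue_real:
  fixes P M :: "real mat" and e :: complex
  assumes P: "sym_pd N P" and M: "M \<in> carrier_mat N N"
    and PM: "transpose_mat (P * M) = P * M"
    and e: "eigenvalue (map_mat of_real M) e"
  shows "e \<in> \<real>"
proof -
  note P' = sym_pdD[OF P]
  obtain v where v: "v \<in> carrier_vec N" "v \<noteq> 0\<^sub>v N" "map_mat of_real M *\<^sub>v v = e \<cdot>\<^sub>v v"
    using e M by (auto simp: eigenvalue_def eigenvector_def)
  define a b where "a = map_vec Re v" and "b = map_vec Im v"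
  have ab: "a \<in> carrier_vec N" "b \<in> carrier_vec N" using v by (auto simp: a_def b_def)
  have Ma: "M *\<^sub>v a = Re e \<cdot>\<^sub>v a - Im e \<cdot>\<^sub>v b"
  proof (rule eq_vecI)
    fix i assume "i < dim_vec (Re e \<cdot>\<^sub>v a - Im e \<cdot>\<^sub>v b)"
    hence i: "i < N" using ab by simp
    have "(M *\<^sub>v a) $ i = map_vec Re (e \<cdot>\<^sub>v v) $ i"
      using map_vec_Re_mult(1)[OF M v(1)] v(3) by (simp add: a_def)
    thus "(M *\<^sub>v a) $ i = (Re e \<cdot>\<^sub>v a - Im e \<cdot>\<^sub>v b) $ i"
      using i v(1) ab by (simp add: a_def b_def)
  qed (use M ab in auto)
  have Mb: "M *\<^sub>v b = Im e \<cdot>\<^sub>v a + Re e \<cdot>\<^sub>v b"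
  proof (rule eq_vecI)
    fix i assume "i < dim_vec (Im e \<cdot>\<^sub>v a + Re e \<cdot>\<^sub>v b)"
    hence i: "i < N" using ab by simp
    have "(M *\<^sub>v b) $ i = map_vec Im (e \<cdot>\<^sub>v v) $ i"
      using map_vec_Re_mult(2)[OF M v(1)] v(3) by (simp add: b_def)
    thus "(M *\<^sub>v b) $ i = (Im e \<cdot>\<^sub>v a + Re e \<cdot>\<^sub>v b) $ i"
      using i v(1) ab by (simp add: a_def b_def)
  qed (use M ab in auto)
  have PMc: "P * M \<in> carrier_mat N N" using P' M by simp
  have "b \<bullet> (P *\<^sub>v (M *\<^sub>v a)) = a \<bullet> (P *\<^sub>v (M *\<^sub>v b))"
    using sym_bilinear_commute[OF PMc PM ab(2,1)] P' M ab by simp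
  moreover have "b \<bullet> (P *\<^sub>v (M *\<^sub>v a)) = Re e * (b \<bullet> (P *\<^sub>v a)) - Im e * (b \<bullet> (P *\<^sub>v b))"
    unfolding Ma using P' ab
    by (simp add: mult_minus_distrib_mat_vec[of _ N N] mult_mat_vec[of _ N N] scalar_prod_minus_distrib[of _ N])
  moreover have "a \<bullet> (P *\<^sub>v (M *\<^sub>v b)) = Im e * (a \<bullet> (P *\<^sub>v a)) + Re e * (a \<bullet> (P *\<^sub>v b))"
    unfolding Mb using P' ab
    by (simp add: mult_add_distrib_mat_vec[of _ N N] mult_mat_vec[of _ N N] scalar_prod_add_distrib[of _ N])
  moreover have "b \<bullet> (P *\<^sub>v a) = a \<bullet> (P *\<^sub>v b)" by (rule sym_bilinear_commute[OF P'(1,2) ab(2,1)])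
  ultimately have z: "Im e * (a \<bullet> (P *\<^sub>v a) + b \<bullet> (P *\<^sub>v b)) = 0" by (simp add: algebra_simps)
  have "a \<noteq> 0\<^sub>v N \<or> b \<noteq> 0\<^sub>v N"
  proof (rule ccontr)
    assume "\<not> ?thesis"
    hence "a = 0\<^sub>v N" "b = 0\<^sub>v N" by auto
    hence "Re (v $ i) = 0" "Im (v $ i) = 0" if "i < N" for i
      using that v(1) unfolding a_def b_def by (metis carrier_vecD index_map_vec(1) index_zero_vec(1))+
    hence "v = 0\<^sub>v N" using v(1) by (intro eq_vecI) (auto simp: complex_eq_iff)
    thus False using v by simp
  qed
  hence "a \<bullet> (P *\<^sub>v a) + b \<bullet> (P *\<^sub>v b) > 0"
    using P'(3)[OF ab(1)] P'(3)[OF ab(2)] P'(4)[OF ab(1)] P'(4)[OF ab(2)]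
    by (auto intro: add_pos_nonneg add_nonneg_pos)
  thus ?thesis using z by (simp add: complex_is_Real_iff)
qed

section \<open>Definiteness along a one-parameter family\<close>

lemma psd_form_zero:
  fixes X :: "real mat"
  assumes X: "X \<in> carrier_mat d d" "transpose_mat X = X"
    and psd: "\<And>v. v \<in> carrier_vec d \<Longrightarrow> 0 \<le> v \<bullet> (X *\<^sub>v v)"
    and v: "v \<in> carrier_vec d" and z: "v \<bullet> (X *\<^sub>v v) = 0"
  shows "X *\<^sub>v v = 0\<^sub>v d"
proof (rule ccontr)
  define w where "w = X *\<^sub>v v"
  assume "X *\<^sub>v v \<noteq> 0\<^sub>v d"
  hence w: "w \<in> carrier_vec d" "w \<noteq> 0\<^sub>v d" using X v by (auto simp: w_def)
  define q p where "q = w \<bullet> (X *\<^sub>v w)" and "p = w \<bullet> w"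
  have p: "p > 0" using scalar_prod_self_zero[OF w(1)] w scalar_prod_self_nonneg[of w] by (force simp: p_def)
  have q: "q \<ge> 0" using psd[OF w(1)] by (simp add: q_def)
  \<comment> \<open>Moving from \<open>v\<close> by \<open>t\<close> against \<open>w = X v\<close>
    changes the form by \<open>t * (t * q - 2 * p)\<close>. This \<open>t\<close> gives
    \<open>t * q <= p\<close>, so the change is negative; the 1 in the denominator covers
    \<open>q = 0\<close>.\<close>
  define t where "t = p / (1 + q)"
  have t: "t > 0" using p q by (simp add: t_def)
  have vw: "v \<bullet> (X *\<^sub>v w) = p" "w \<bullet> (X *\<^sub>v v) = p"
    using sym_bilinear_commute[OF X v w(1)] by (simp_all add: w_def p_def)
  have "0 \<le> (v - t \<cdot>\<^sub>v w) \<bullet> (X *\<^sub>v (v - t \<cdot>\<^sub>v w))" by (rule psd) (use v w in auto)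
  also have "X *\<^sub>v (v - t \<cdot>\<^sub>v w) = X *\<^sub>v v - t \<cdot>\<^sub>v (X *\<^sub>v w)"
    using X v w by (simp add: mult_minus_distrib_mat_vec[of _ d d] mult_mat_vec[of _ d d])
  also have "(v - t \<cdot>\<^sub>v w) \<bullet> \<dots> = v \<bullet> (X *\<^sub>v v) - t * p - t * p + t * t * q"
    using X(1) v w(1) vw
    by (simp add: minus_scalar_prod_distrib[of _ d] scalar_prod_minus_distrib[of _ d] q_def algebra_simps)
  also have "\<dots> = t * (t * q - 2 * p)" using z by (simp add: algebra_simps)
  finally have "0 \<le> t * q - 2 * p" using t by (simp add: zero_le_mult_iff)
  moreover have "t * q \<le> p" using p q by (simp add: t_def field_simps)
  ultimately show False using p by simp
qed

lemma gram_form_sum: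
  fixes H :: "real mat"
  assumes "H \<in> carrier_mat n N" "v \<in> carrier_vec N"
  shows "v \<bullet> ((transpose_mat H * H) *\<^sub>v v) = (\<Sum>k<n. (row H k \<bullet> v)\<^sup>2)"
proof -
  have "v \<bullet> ((transpose_mat H * H) *\<^sub>v v) = (H *\<^sub>v v) \<bullet> (H *\<^sub>v v)"
    using gram_form[of "transpose_mat H" N n v] assms by simp
  thus ?thesis using assms by (auto simp: scalar_prod_def[of "H *\<^sub>v v"] atLeast0LessThan power2_eq_square intro!: sum.cong)
qed

text \<open>Positive definiteness is an open condition, and a positive semidefinite nonsingular matrix is
  definite; hence it can only be lost at a parameter where the determinant vanishes.\<close>

lemma sym_pd_minus_gram:
  fixes X H :: "real mat"
  assumes X: "sym_pd N X" and H: "H \<in> carrier_mat n N"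
    and nz: "\<And>s. 0 \<le> s \<Longrightarrow> s \<le> t \<Longrightarrow> det (X - s \<cdot>\<^sub>m (transpose_mat H * H)) \<noteq> 0"
    and t: "0 \<le> t"
  shows "sym_pd N (X - t \<cdot>\<^sub>m (transpose_mat H * H))"
proof -
  let ?R = "transpose_mat H * H"
  define Z where "Z s = X - s \<cdot>\<^sub>m ?R" for s
  note X' = sym_pdD[OF X]
  have R: "?R \<in> carrier_mat N N" using H by simp
  have Rs: "transpose_mat ?R = ?R" using H by (simp add: transpose_mult[of _ N n _ N])
  have Zc: "Z s \<in> carrier_mat N N" for s unfolding Z_def using R by (intro minus_carrier_mat) auto
  have Zs: "transpose_mat (Z s) = Z s" for s
  proof -
    have "transpose_mat (Z s) = transpose_mat X - transpose_mat (s \<cdot>\<^sub>m ?R)"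
      unfolding Z_def using X'(1) R by (intro transpose_minus) auto
    also have "transpose_mat (s \<cdot>\<^sub>m ?R) = s \<cdot>\<^sub>m transpose_mat ?R" by (intro eq_matI) auto
    finally show ?thesis using X' Rs by (simp add: Z_def)
  qed
  define R2 where "R2 v = (\<Sum>k<n. (row H k \<bullet> v)\<^sup>2)" for v
  have R2: "R2 v \<ge> 0" for v by (auto simp: R2_def intro: sum_nonneg)
  have Zf: "v \<bullet> (Z s *\<^sub>v v) = v \<bullet> (X *\<^sub>v v) - s * R2 v" if v: "v \<in> carrier_vec N" for s v
  proof -
    have "Z s *\<^sub>v v = X *\<^sub>v v - s \<cdot>\<^sub>v (?R *\<^sub>v v)"
    proof -
      have "Z s *\<^sub>v v = X *\<^sub>v v - (s \<cdot>\<^sub>m ?R) *\<^sub>v v"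
        unfolding Z_def using X'(1) R v by (intro minus_mult_distrib_mat_vec) auto
      moreover have "(s \<cdot>\<^sub>m ?R) *\<^sub>v v = s \<cdot>\<^sub>v (?R *\<^sub>v v)"
        using R v by (intro eq_vecI) auto
      ultimately show ?thesis by simp
    qed
    thus ?thesis using X'(1) R v gram_form_sum[OF H v]
      by (simp add: scalar_prod_minus_distrib[of _ N] R2_def del: assoc_mult_mat_vec)
  qed
  \<comment> \<open>The proof shows that the supremum \<open>s\<close> of \<open>T\<close> lies in
    \<open>T\<close> and equals \<open>t\<close>. Closedness gives only a semidefinite form at
    \<open>s\<close>; the determinant hypothesis makes it definite.\<close>
  define T where "T = {s. 0 \<le> s \<and> s \<le> t \<and> sym_pd N (Z s)}"
  have Z0: "Z 0 = X" using X' H by (auto intro!: eq_matI simp: Z_def)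
  have T0: "0 \<in> T" using X t by (simp add: T_def Z0)
  have Tb: "bdd_above T" by (auto simp: T_def intro!: bdd_aboveI[of _ t])
  define s where "s = Sup T"
  have s0: "0 \<le> s" unfolding s_def by (rule cSup_upper[OF T0 Tb])
  have st: "s \<le> t" unfolding s_def by (rule cSup_least) (use T0 in \<open>auto simp: T_def\<close>)
  have psd: "0 \<le> v \<bullet> (Z s *\<^sub>v v)" if v: "v \<in> carrier_vec N" for v
  proof (rule field_le_epsilon)
    fix e :: real assume e: "0 < e"
    \<comment> \<open>Chosen so that a shift of the parameter by at most this much changes the form
      at the fixed \<open>v\<close> by at most \<open>e\<close>.\<close>
    define \<delta> where "\<delta> = e / (R2 v + 1)"
    have d: "\<delta> > 0" using e R2[of v] by (simp add: \<delta>_def)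
    then obtain u where u: "u \<in> T" "s - \<delta> < u"
      using less_cSup_iff[of T "s - \<delta>"] T0 Tb unfolding s_def by auto
    have "0 \<le> v \<bullet> (Z u *\<^sub>v v)" using u v sym_pdD(4) by (auto simp: T_def)
    also have "\<dots> = v \<bullet> (Z s *\<^sub>v v) + (s - u) * R2 v" using v by (simp add: Zf algebra_simps)
    also have "(s - u) * R2 v \<le> \<delta> * R2 v" using u R2 by (intro mult_right_mono) auto
    also have "\<delta> * R2 v \<le> e" using e R2[of v] by (simp add: \<delta>_def field_simps)
    finally show "0 \<le> v \<bullet> (Z s *\<^sub>v v) + e" by simp
  qed
  have pd: "sym_pd N (Z s)"
    unfolding sym_pd_def
  proof (intro conjI ballI impI)
    fix v :: "real vec" assume v: "v \<in> carrier_vec N" "v \<noteq> 0\<^sub>v N"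
    have "v \<bullet> (Z s *\<^sub>v v) \<noteq> 0"
    proof
      assume "v \<bullet> (Z s *\<^sub>v v) = 0"
      from psd_form_zero[OF Zc Zs psd v(1) this] have "det (Z s) = 0"
        using v det_0_iff_vec_prod_zero[OF Zc] by blast
      thus False using nz[OF s0 st] by (simp add: Z_def)
    qed
    thus "0 < v \<bullet> (Z s *\<^sub>v v)" using psd[OF v(1)] by simp
  qed (use Zc Zs in auto)
  have "s = t"
  proof (rule ccontr)
    assume "s \<noteq> t"
    hence lt: "s < t" using st by simp
    \<comment> \<open>By \<open>sym_pd_dual_bound\<close> on each row of \<open>H\<close>, the Gram
      form is at most \<open>C\<close> times the form of \<open>Z s\<close>, uniformly in the
      vector. Any further shift below \<open>1 / C\<close> thus keeps the form positive.\<close>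
    define C where "C = (\<Sum>k<n. row H k \<bullet> (minv (Z s) *\<^sub>v row H k))"
    have C0: "C \<ge> 0" unfolding C_def
      by (intro sum_nonneg sym_pdD(4)[OF sym_pd_minv[OF pd]]) (use H in auto)
    have bound: "R2 v \<le> C * (v \<bullet> (Z s *\<^sub>v v))" if v: "v \<in> carrier_vec N" for v
      unfolding R2_def C_def sum_distrib_right
      using sym_pd_dual_bound[OF sym_pd_minv[OF pd] _ v] H v by (intro sum_mono) (auto simp: minv_minv[OF pd])
    define \<delta> where "\<delta> = min (t - s) (1 / (2 * (C + 1)))"
    have d: "\<delta> > 0" "s + \<delta> \<le> t" using lt C0 by (auto simp: \<delta>_def)
    have dC: "\<delta> * C < 1"
    proof -
      have "\<delta> * C \<le> (1 / (2 * (C + 1))) * C" using C0 by (intro mult_right_mono) (auto simp: \<delta>_def)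
      also have "\<dots> < 1" using C0 by (simp add: field_simps)
      finally show ?thesis .
    qed
    have "sym_pd N (Z (s + \<delta>))"
      unfolding sym_pd_def
    proof (intro conjI ballI impI)
      fix v :: "real vec" assume v: "v \<in> carrier_vec N" "v \<noteq> 0\<^sub>v N"
      let ?q = "v \<bullet> (Z s *\<^sub>v v)"
      have q: "?q > 0" by (rule sym_pdD(3)[OF pd v])
      have "v \<bullet> (Z (s + \<delta>) *\<^sub>v v) = ?q - \<delta> * R2 v" using v by (simp add: Zf algebra_simps)
      moreover have "\<delta> * R2 v \<le> \<delta> * (C * ?q)" using bound[OF v(1)] d by (intro mult_left_mono) auto
      moreover have "\<delta> * (C * ?q) < ?q" using dC q by (simp add: mult.assoc[symmetric])
      ultimately show "0 < v \<bullet> (Z (s + \<delta>) *\<^sub>v v)" by simp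
    qed (use Zc Zs in auto)
    hence "s + \<delta> \<in> T" using s0 d by (simp add: T_def)
    from cSup_upper[OF this Tb] show False using d by (simp add: s_def)
  qed
  thus ?thesis using pd by (simp add: Z_def)
qed

section \<open>The function gamma\<close>

text \<open>Each eigenvalue \<open>d\<close> of \<open>H\<^sup>T H P\<close> contributes \<open>phi (d / l) / 2\<close> to \<open>gamma l\<close>.\<close>

definition phi :: "real \<Rightarrow> real" where
  "phi x = 1 / (1 - x) - 1 + ln (1 - x)"

lemma phi_zero [simp]: "phi 0 = 0"
  by (simp add: phi_def)

text \<open>The derivative of \<open>phi\<close> is \<open>x / (1 - x)^2\<close>, so the sign of
  \<open>x\<close> matters. Here \<open>ln t < t - 1\<close> for \<open>t > 1\<close> replaces the
  derivative, and \<open>0 <= x\<close> enters as \<open>u <= 1\<close>.\<close>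

lemma phi_strict_mono:
  assumes "0 \<le> x" "x < y" "y < 1"
  shows "phi x < phi y"
proof -
  define u v t where "u = 1 - x" and "v = 1 - y" and "t = u / v"
  have uv: "0 < v" "v < u" "u \<le> 1" using assms by (auto simp: u_def v_def)
  have t: "t > 1" using uv by (simp add: t_def)
  have "ln t < t - 1" using ln_le_minus_one[of t] ln_eq_minus_one[of t] t by fastforce
  also have "\<dots> \<le> (t - 1) / u" using t uv by (simp add: le_divide_eq mult_left_le)
  also have "\<dots> = 1 / v - 1 / u" using uv by (simp add: t_def field_simps)
  finally have "ln u - ln v < 1 / v - 1 / u" using uv by (simp add: t_def ln_div)
  thus ?thesis by (simp add: phi_def u_def v_def)
qed

lemma phi_mono: "0 \<le> x \<Longrightarrow> x \<le> y \<Longrightarrow> y < 1 \<Longrightarrow> phi x \<le> phi y"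
  using phi_strict_mono[of x y] by (cases "x = y") auto

text \<open>At argument 1 the pole of \<open>1 / (1 - x)\<close> outweighs the logarithm, which
  tends to minus infinity.\<close>

lemma phi_at_top:
  assumes "0 < r"
  shows "filterlim (\<lambda>l. phi (r / l)) at_top (at_right r)"
  using assms unfolding phi_def by real_asymp

lemma phi_tendsto_zero: "((\<lambda>l. phi (d / l)) \<longlongrightarrow> 0) at_top"
proof -
  have "((\<lambda>l. d / l) \<longlongrightarrow> 0) at_top" by real_asymp
  hence "((\<lambda>l. phi (d / l)) \<longlongrightarrow> 1 / (1 - 0) - 1 + ln (1 - 0)) at_top"
    unfolding phi_def by (intro tendsto_intros) auto
  thus ?thesis by simp
qed

text \<open>All summands are nonnegative and do not increase with \<open>l\<close>. The one
  belonging to the largest value \<open>d j = r\<close> is strictly decreasing and already blows up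
  at \<open>r\<close>. The intermediate value theorem then gives the solution, monotonicity its
  uniqueness.\<close>

lemma spectral_sum_properties:
  fixes g :: "real \<Rightarrow> real" and d :: "nat \<Rightarrow> real"
  assumes r: "0 < r" and d: "\<And>i. i < N \<Longrightarrow> 0 \<le> d i \<and> d i \<le> r"
    and j: "j < N" "d j = r"
    and g: "\<And>l. r < l \<Longrightarrow> g l = (1/2) * (\<Sum>i<N. phi (d i / l))"
  shows "\<And>a b. r < a \<Longrightarrow> a < b \<Longrightarrow> g b < g a"
    and "filterlim g at_top (at_right r)"
    and "(g \<longlongrightarrow> 0) at_top"
    and "0 < c \<Longrightarrow> \<exists>!l. r < l \<and> g l = c"
proof -
  show mono: "g b < g a" if ab: "r < a" "a < b" for a b
  proof -
    have "(\<Sum>i<N. phi (d i / b)) < (\<Sum>i<N. phi (d i / a))"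
    proof (rule sum_strict_mono_ex1)
      show "\<forall>i\<in>{..<N}. phi (d i / b) \<le> phi (d i / a)"
      proof
        fix i assume "i \<in> {..<N}"
        hence di: "0 \<le> d i" "d i \<le> r" using d by auto
        show "phi (d i / b) \<le> phi (d i / a)"
        proof (rule phi_mono)
          show "0 \<le> d i / b" "d i / a < 1" using di ab r by (simp_all add: field_simps)
          show "d i / b \<le> d i / a" using di ab r by (intro divide_left_mono) auto
        qed
      qed
      \<comment> \<open>Strictness comes from this index alone: \<open>d j = r\<close> is positive,
        whereas a zero value contributes the constant \<open>phi 0\<close>.\<close>
      have "phi (d j / b) < phi (d j / a)"
        unfolding j(2) by (rule phi_strict_mono) (use ab r in \<open>auto intro!: divide_strict_left_mono simp: field_simps\<close>)
      thus "\<exists>i\<in>{..<N}. phi (d i / b) < phi (d i / a)" using j by auto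
    qed simp
    thus ?thesis using ab by (simp add: g)
  qed
  have ev: "eventually (\<lambda>l. r < l) (at_right r)" by (simp add: eventually_at_filter)
  show top: "filterlim g at_top (at_right r)"
  proof (rule filterlim_at_top_mono)
    show "filterlim (\<lambda>l. (1/2) * phi (r / l)) at_top (at_right r)"
      by (rule filterlim_tendsto_pos_mult_at_top[OF tendsto_const _ phi_at_top[OF r]]) simp
    show "\<forall>\<^sub>F l in at_right r. (1/2) * phi (r / l) \<le> g l"
      using ev
    proof eventually_elim
      case (elim l)
      have "phi (d j / l) \<le> (\<Sum>i<N. phi (d i / l))"
      proof (rule member_le_sum)
        fix i assume "i \<in> {..<N} - {j}"
        hence di: "0 \<le> d i" "d i \<le> r" using d by auto
        show "0 \<le> phi (d i / l)"
          using phi_mono[of 0 "d i / l"] di elim r by (simp add: field_simps)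
      qed (use j in auto)
      thus ?case using g[OF elim] j by simp
    qed
  qed
  show zero: "(g \<longlongrightarrow> 0) at_top"
  proof (rule Lim_transform_eventually)
    have "((\<lambda>l. (1/2) * (\<Sum>i<N. phi (d i / l))) \<longlongrightarrow> (1/2) * (\<Sum>i<N. 0)) at_top"
      by (intro tendsto_intros phi_tendsto_zero)
    thus "((\<lambda>l. (1/2) * (\<Sum>i<N. phi (d i / l))) \<longlongrightarrow> 0) at_top" by simp
    show "\<forall>\<^sub>F l in at_top. (1/2) * (\<Sum>i<N. phi (d i / l)) = g l"
      using eventually_gt_at_top[of r] by eventually_elim (simp add: g)
  qed
  show "\<exists>!l. r < l \<and> g l = c" if c: "0 < c"
  proof -
    have "\<exists>a>r. c \<le> g a"
    proof -
      have "eventually (\<lambda>l. c \<le> g l \<and> r < l) (at_right r)"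
        using top[unfolded filterlim_at_top, rule_format, of c] ev by eventually_elim auto
      from eventually_happens[OF this] show ?thesis by auto
    qed
    then obtain a where a: "r < a" "c \<le> g a" by auto
    have "\<exists>b>a. g b < c"
    proof -
      have "eventually (\<lambda>l. g l < c \<and> a < l) at_top"
        using order_tendstoD(2)[OF zero c] eventually_gt_at_top[of a] by eventually_elim auto
      from eventually_happens[OF this] show ?thesis by auto
    qed
    then obtain b where b: "a < b" "g b < c" by auto
    have cont: "continuous_on {a..b} g"
    proof -
      have nz: "x \<noteq> 0 \<and> 0 < 1 - d i / x" if i: "i \<in> {..<N}" and x: "x \<in> {a..b}" for i x
      proof -
        have "0 \<le> d i" "d i \<le> r" using d i by auto
        thus ?thesis using x a r by (simp add: field_simps)
      qed
      have "continuous_on {a..b} (\<lambda>l. (1/2) * (\<Sum>i<N. phi (d i / l)))"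
        unfolding phi_def
        by (intro continuous_intros ballI) (use nz in fastforce)+
      thus ?thesis using a g by (subst continuous_on_cong[OF refl, of _ g]) auto
    qed
    obtain l where l: "a \<le> l" "l \<le> b" "g l = c"
      using IVT2'[of g b c a] a b cont by auto
    show ?thesis
    proof (rule ex1I[of _ l])
      show "r < l \<and> g l = c" using l a by simp
      fix l' assume l': "r < l' \<and> g l' = c"
      show "l' = l" using mono[of l l'] mono[of l' l] l' l a by (cases l l' rule: linorder_cases) auto
    qed
  qed
qed

lemma sym_pd_diag_pos:
  assumes K: "sym_pd d K" and i: "i < d"
  shows "0 < K $$ (i, i)"
proof -
  have "unit_vec d i \<bullet> (K *\<^sub>v unit_vec d i) = K $$ (i, i)"
    using i sym_pdD(1)[OF K] by (simp add: mult_mat_vec_def row_def)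
  moreover have "unit_vec d i \<noteq> (0\<^sub>v d :: real vec)" using i by (metis index_unit_vec(1) index_zero_vec(1) zero_neq_one)
  ultimately show ?thesis using sym_pdD(3)[OF K, of "unit_vec d i"] by simp
qed

section \<open>The spectrum of \<open>H^T H P\<close> and the posterior precision\<close>

context
  fixes n N :: nat and H P :: "real mat"
  assumes n: "0 < n" and H: "H \<in> carrier_mat n N" and HH: "H * transpose_mat H = 1\<^sub>m n" and P: "sym_pd N P"
begin

lemma coisometry_transpose_inj:
  assumes v: "v \<in> carrier_vec n" and z: "transpose_mat H *\<^sub>v v = 0\<^sub>v N" shows "v = 0\<^sub>v n"
proof -
  have "v = H *\<^sub>v (transpose_mat H *\<^sub>v v)"
    using v H by (simp add: assoc_mult_mat_vec[symmetric, of H n N "transpose_mat H" n] HH del: assoc_mult_mat_vec)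
  also have "\<dots> = 0\<^sub>v n" unfolding z using H by auto
  finally show ?thesis .
qed

lemma sym_pd_compression: "sym_pd n (H * P * transpose_mat H)"
  by (rule sym_pd_congruence[OF H P coisometry_transpose_inj])

text \<open>Two products \<open>X Y\<close> and \<open>Y X\<close> share their nonzero eigenvalues;
  here \<open>X = H^T\<close> and \<open>Y = H P\<close>. The maps \<open>w\<close> to
  \<open>H^T w\<close> and \<open>v\<close> to \<open>H P v\<close> carry eigenvectors across, and
  the compression is definite, so 0 is not among its eigenvalues.\<close>

lemma eigenvalue_compression_iff:
  "eigenvalue (H * P * transpose_mat H) k \<longleftrightarrow> eigenvalue (transpose_mat H * H * P) k \<and> k \<noteq> 0"
proof -
  note P' = sym_pdD(1)[OF P]
  let ?A = "H * P * transpose_mat H" and ?M = "transpose_mat H * H * P"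
  have A: "?A \<in> carrier_mat n n" and M: "?M \<in> carrier_mat N N" using H P' by auto
  have mA: "?A *\<^sub>v w = H *\<^sub>v (P *\<^sub>v (transpose_mat H *\<^sub>v w))" if "w \<in> carrier_vec n" for w
    using that H P' by (simp add: assoc_mult_mat_vec[of _ n N _ n] assoc_mult_mat_vec[of _ n N _ N])
  have mM: "?M *\<^sub>v w = transpose_mat H *\<^sub>v (H *\<^sub>v (P *\<^sub>v w))" if "w \<in> carrier_vec N" for w
    using that H P' by (simp add: assoc_mult_mat_vec[of _ N N _ N] assoc_mult_mat_vec[of _ N n _ N])
  show ?thesis
  proof (intro iffI conjI)
    assume "eigenvalue ?A k"
    then obtain w where w: "w \<in> carrier_vec n" "w \<noteq> 0\<^sub>v n" "?A *\<^sub>v w = k \<cdot>\<^sub>v w"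
      using carrier_matD(1)[OF A] unfolding eigenvalue_def eigenvector_def by auto
    have nz: "transpose_mat H *\<^sub>v w \<noteq> 0\<^sub>v N" using coisometry_transpose_inj[OF w(1)] w(2) by auto
    have "?M *\<^sub>v (transpose_mat H *\<^sub>v w) = transpose_mat H *\<^sub>v (?A *\<^sub>v w)"
      using mM[of "transpose_mat H *\<^sub>v w"] mA[OF w(1)] H w(1) by simp
    also have "\<dots> = k \<cdot>\<^sub>v (transpose_mat H *\<^sub>v w)"
      unfolding w(3) using H w(1) by (intro mult_mat_vec) auto
    finally show "eigenvalue ?M k"
      using nz H w(1) carrier_matD(1)[OF M] unfolding eigenvalue_def eigenvector_def
      by (intro exI[of _ "transpose_mat H *\<^sub>v w"]) auto
    have "0 < w \<bullet> (?A *\<^sub>v w)" by (rule sym_pdD(3)[OF sym_pd_compression w(1,2)])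
    thus "k \<noteq> 0" unfolding w(3) using w(1) by auto
  next
    assume "eigenvalue ?M k \<and> k \<noteq> 0"
    then obtain v where v: "v \<in> carrier_vec N" "v \<noteq> 0\<^sub>v N" "?M *\<^sub>v v = k \<cdot>\<^sub>v v" and k: "k \<noteq> 0"
      using carrier_matD(1)[OF M] unfolding eigenvalue_def eigenvector_def by auto
    define w where "w = H *\<^sub>v (P *\<^sub>v v)"
    have w: "w \<in> carrier_vec n" using H P' v(1) by (auto simp: w_def)
    have Hw: "transpose_mat H *\<^sub>v w = k \<cdot>\<^sub>v v" using mM[OF v(1)] v(3) by (simp add: w_def)
    have "w \<noteq> 0\<^sub>v n"
    proof
      assume "w = 0\<^sub>v n"
      moreover have "transpose_mat H *\<^sub>v 0\<^sub>v n = 0\<^sub>v N" using H by auto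
      ultimately have "k \<cdot>\<^sub>v v = 0\<^sub>v N" using Hw by simp
      hence "v = 0\<^sub>v N" using k v(1) by (auto simp: vec_eq_iff)
      thus False using v by simp
    qed
    moreover have "?A *\<^sub>v w = k \<cdot>\<^sub>v w"
      unfolding mA[OF w] Hw unfolding w_def using H P' v(1)
      by (simp add: mult_mat_vec[of _ N N] mult_mat_vec[of _ n N])
    ultimately show "eigenvalue ?A k"
      using w carrier_matD(1)[OF A] unfolding eigenvalue_def eigenvector_def by auto
  qed
qed

text \<open>Pairing the eigenvector equation with \<open>u = P v\<close> gives
  \<open>k * (v . P v)\<close> on one side and the squared norm of \<open>H u\<close> on the
  other.\<close>

lemma gram_times_eigenvalue_nonneg:
  assumes "eigenvalue (transpose_mat H * H * P) k" shows "0 \<le> k"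
proof -
  note P' = sym_pdD[OF P]
  let ?M = "transpose_mat H * H * P"
  have M: "?M \<in> carrier_mat N N" using H P' by auto
  obtain v where v: "v \<in> carrier_vec N" "v \<noteq> 0\<^sub>v N" "?M *\<^sub>v v = k \<cdot>\<^sub>v v"
    using assms carrier_matD(1)[OF M] unfolding eigenvalue_def eigenvector_def by auto
  define u where "u = P *\<^sub>v v"
  have u: "u \<in> carrier_vec N" using P'(1) v(1) by (auto simp: u_def)
  have "k * (v \<bullet> u) = (k \<cdot>\<^sub>v v) \<bullet> u" using v(1) u by simp
  also have "\<dots> = u \<bullet> (k \<cdot>\<^sub>v v)" using v(1) u by (intro comm_scalar_prod[of _ N]) auto
  also have "k \<cdot>\<^sub>v v = (transpose_mat H * H) *\<^sub>v u"
    unfolding v(3)[symmetric] u_def using H P' v(1) by (intro assoc_mult_mat_vec) auto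
  also have "u \<bullet> \<dots> = (\<Sum>k<n. (row H k \<bullet> u)\<^sup>2)" by (rule gram_form_sum[OF H u])
  also have "\<dots> \<ge> 0" by (intro sum_nonneg) auto
  finally have "0 \<le> k * (v \<bullet> u)" .
  thus ?thesis using P'(3)[OF v(1,2)] by (simp add: u_def zero_le_mult_iff)
qed

text \<open>The \<open>d i\<close> are the diagonal of a triangularisation of
  \<open>H^T H P\<close>, hence its eigenvalues. This reduces \<open>gammaf\<close> to the scalar
  sums of \<open>spectral_sum_properties\<close> and also yields the determinant sign needed for
  \<open>V1\<close>.\<close>

lemma spectral_representation:
  obtains d j where
    "0 < lmax (H * P * transpose_mat H)"
    "\<And>i. i < N \<Longrightarrow> 0 \<le> d i \<and> d i \<le> lmax (H * P * transpose_mat H)"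
    "j < N" "d j = lmax (H * P * transpose_mat H)"
    "\<And>l. lmax (H * P * transpose_mat H) < l \<Longrightarrow> gammaf N H P l = (1/2) * (\<Sum>i<N. phi (d i / l))"
    "\<And>l. lmax (H * P * transpose_mat H) < l \<Longrightarrow> 0 < det (1\<^sub>m N - (1 / l) \<cdot>\<^sub>m (transpose_mat H * H * P))"
proof -
  note P' = sym_pdD[OF P]
  let ?M = "transpose_mat H * H * P" and ?A = "H * P * transpose_mat H"
  let ?r = "lmax ?A"
  have M: "?M \<in> carrier_mat N N" using H P' by auto
  \<comment> \<open>\<open>P * ?M\<close> is the congruence of the symmetric \<open>H^T H\<close> by
    \<open>P\<close>, which makes \<open>?M\<close> symmetrizable.\<close>
  have PM: "transpose_mat (P * ?M) = P * ?M"
  proof -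
    have "P * ?M = P * (transpose_mat H * H) * transpose_mat P"
      using H P'(1,2) by (simp add: assoc_mult_mat[of P N N _ N _ N])
    moreover have "transpose_mat (transpose_mat H * H) = transpose_mat H * H"
      using H by (simp add: transpose_mult[of _ N n _ N])
    ultimately show ?thesis using congruence_sym[OF P'(1), of "transpose_mat H * H"] H by simp
  qed
  obtain B X Y where B: "similar_mat_wit ?M B X Y" "upper_triangular B"
    "\<And>k. eigenvalue ?M k \<longleftrightarrow> (\<exists>i<N. k = B $$ (i, i))"
    using real_splitting_triangular[OF M symmetrizable_complex_eigenvalue_real[OF P M PM]] by blast
  have Bc: "B \<in> carrier_mat N N" using B(1) M by (auto simp: similar_mat_wit_def Let_def)
  define d where "d i = B $$ (i, i)" for i
  have d0: "0 \<le> d i" if "i < N" for i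
    using gram_times_eigenvalue_nonneg B(3) that by (auto simp: d_def)
  have set: "{k. eigenvalue ?A k} = d ` {..<N} - {0}"
    unfolding eigenvalue_compression_iff B(3) by (auto simp: d_def)
  \<comment> \<open>The trace of the definite compression is positive because \<open>n > 0\<close>,
    so some \<open>d i\<close> is nonzero. The set whose \<open>Max\<close> defines
    \<open>lmax\<close> is therefore nonempty.\<close>
  have "mtrace ?M = mtrace (?A)"
  proof -
    have "?M = transpose_mat H * (H * P)" using H P' by simp
    thus ?thesis using mtrace_mult_commute[of "transpose_mat H" N n "H * P"] H P' by simp
  qed
  moreover have "mtrace ?M = (\<Sum>i<N. d i)"
    using mtrace_similar[OF B(1) M] Bc by (simp add: mtrace_def d_def)
  moreover have "0 < mtrace ?A"
    unfolding mtrace_def using sym_pd_diag_pos[OF sym_pd_compression] H n by (intro sum_pos) auto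
  ultimately have "(\<Sum>i<N. d i) \<noteq> 0" by simp
  then obtain i0 where i0: "i0 < N" "d i0 \<noteq> 0" by (metis lessThan_iff sum.neutral)
  have fin: "finite (d ` {..<N} - {0})" by simp
  have ne: "d ` {..<N} - {0} \<noteq> {}" using i0 by auto
  have req: "?r = Max (d ` {..<N} - {0})" by (simp add: lmax_def set)
  have "?r \<in> d ` {..<N} - {0}" unfolding req by (rule Max_in[OF fin ne])
  then obtain j where j: "j < N" "d j = ?r" "?r \<noteq> 0" by auto
  have r: "0 < ?r" using d0[OF j(1)] j by simp
  have le: "d i \<le> ?r" if "i < N" for i
  proof (cases "d i = 0")
    case True thus ?thesis using r by simp
  next
    case False thus ?thesis unfolding req using that fin by (intro Max_ge) auto
  qed
  have pos: "0 < 1 - d i / l" if "i < N" "?r < l" for i l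
    using d0[OF that(1)] le[OF that(1)] that r by (simp add: field_simps)
  have dt: "det (1\<^sub>m N - (1 / l) \<cdot>\<^sub>m ?M) = (\<Prod>i<N. 1 - d i / l)"
    and tr: "mtrace (minv (1\<^sub>m N - (1 / l) \<cdot>\<^sub>m ?M) - 1\<^sub>m N) = (\<Sum>i<N. 1 / (1 - d i / l) - 1)" if "?r < l" for l
    using det_trace_resolvent[OF M B(1,2), of "1 / l"] pos[OF _ that] by (force simp: d_def)+
  show thesis
  proof (rule that[of d j])
    show "0 < ?r" "j < N" "d j = ?r" by fact+
    show "0 \<le> d i \<and> d i \<le> ?r" if "i < N" for i using d0 le that by simp
    fix l assume l: "?r < l"
    show "0 < det (1\<^sub>m N - (1 / l) \<cdot>\<^sub>m ?M)" unfolding dt[OF l] using pos[OF _ l] by (intro prod_pos) auto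
    have "ln (\<Prod>i<N. 1 - d i / l) = (\<Sum>i<N. ln (1 - d i / l))"
    proof (rule ln_prod)
      fix i assume "i \<in> {..<N}"
      hence "0 < 1 - d i / l" using pos[OF _ l] by simp
      thus "1 - d i / l \<noteq> 0" by (rule less_imp_neq[symmetric])
    qed simp
    thus "gammaf N H P l = (1/2) * (\<Sum>i<N. phi (d i / l))"
      unfolding gammaf_def Let_def tr[OF l] dt[OF l] by (simp add: phi_def sum.distrib)
  qed
qed

text \<open>Links the precision matrix, whose definiteness is at stake, with the matrix inside
  \<open>gammaf\<close>, whose determinant is known.\<close>

lemma resolvent_factor:
  "(minv P - s \<cdot>\<^sub>m (transpose_mat H * H)) * P = 1\<^sub>m N - s \<cdot>\<^sub>m (transpose_mat H * H * P)"
proof -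
  note P' = sym_pdD(1)[OF P] sym_pd_minv_inverse[OF P]
  have R: "transpose_mat H * H \<in> carrier_mat N N" using H by simp
  have "(minv P - s \<cdot>\<^sub>m (transpose_mat H * H)) * P = minv P * P - (s \<cdot>\<^sub>m (transpose_mat H * H)) * P"
    using P' R by (intro minus_mult_distrib_mat) auto
  also have "(s \<cdot>\<^sub>m (transpose_mat H * H)) * P = s \<cdot>\<^sub>m (transpose_mat H * H * P)"
    using P' R by (intro mult_smult_assoc_mat) auto
  finally show ?thesis using P' by simp
qed

lemma sym_pd_posterior_precision:
  assumes l: "lmax (H * P * transpose_mat H) < l"
  shows "sym_pd N (minv P - (1 / l) \<cdot>\<^sub>m (transpose_mat H * H))"
proof -
  obtain d j where r: "0 < lmax (H * P * transpose_mat H)"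
    and pos: "\<And>l. lmax (H * P * transpose_mat H) < l \<Longrightarrow> 0 < det (1\<^sub>m N - (1 / l) \<cdot>\<^sub>m (transpose_mat H * H * P))"
    by (rule spectral_representation) blast
  note P' = sym_pdD(1)[OF P] sym_pd_minv_inverse[OF P]
  show ?thesis
  proof (rule sym_pd_minus_gram[OF sym_pd_minv[OF P] H])
    show "0 \<le> 1 / l" using r l by simp
    fix s assume s: "0 \<le> s" "s \<le> 1 / l"
    let ?Z = "minv P - s \<cdot>\<^sub>m (transpose_mat H * H)"
    have Z: "?Z \<in> carrier_mat N N" using H by (intro minus_carrier_mat) auto
    have "det ?Z * det P = det (1\<^sub>m N - s \<cdot>\<^sub>m (transpose_mat H * H * P))"
      using det_mult[OF Z P'(1)] by (simp only: resolvent_factor)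
    also have "\<dots> \<noteq> 0"
    \<comment> \<open>For positive \<open>s\<close>, the number \<open>1 / s\<close> is at least
      \<open>l\<close> and so above the spectrum. At \<open>s = 0\<close> the quotient
      \<open>1 / s\<close> is 0 in HOL, but the matrix is the identity.\<close>
    proof (cases "s = 0")
      case True
      have "1\<^sub>m N - 0 \<cdot>\<^sub>m (transpose_mat H * H * P) = 1\<^sub>m N" using H P' by (intro eq_matI) auto
      thus ?thesis using True by simp
    next
      case False
      have "l \<le> 1 / s" using s False r l by (simp add: field_simps)
      thus ?thesis using pos[of "1 / s"] l by simp
    qed
    finally show "det ?Z \<noteq> 0" by auto
  qed
qed

text \<open>With \<open>Z = V1^-1\<close> the matrix in \<open>gammaf\<close> is
  \<open>Q = Z P\<close>. Hence \<open>Q^-1 - 1 = (P^-1 - Z) V1 = H^T H V1 / l\<close> and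
  \<open>det Q = det P / det V1\<close>. The right-hand side is the form in which the divergence of
  the worst-case density will appear.\<close>

lemma gammaf_posterior:
  assumes l: "lmax (H * P * transpose_mat H) < l"
    and V1: "V1 = minv (minv P - (1 / l) \<cdot>\<^sub>m (transpose_mat H * H))"
  shows "gammaf N H P l = (1/2) * ((1 / l) * mtrace (transpose_mat H * H * V1) + ln (det P / det V1))"
proof -
  let ?R = "transpose_mat H * H"
  let ?Z = "minv P - (1 / l) \<cdot>\<^sub>m ?R" and ?Q = "1\<^sub>m N - (1 / l) \<cdot>\<^sub>m (?R * P)"
  note P' = sym_pdD(1)[OF P] sym_pd_minv_inverse[OF P]
  note Zp = sym_pd_posterior_precision[OF l]
  note Z = sym_pdD(1)[OF Zp] sym_pd_minv_inverse[OF Zp, folded V1]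
  have R: "?R \<in> carrier_mat N N" using H by simp
  have Q: "?Q \<in> carrier_mat N N" using R P' by (intro minus_carrier_mat) auto
  have "?Q * (minv P * V1) = (?Z * P) * (minv P * V1)" by (simp only: resolvent_factor)
  also have "\<dots> = ?Z * ((P * minv P) * V1)"
    using assoc_mult_mat[OF Z(1) P'(1), of "minv P * V1" N] assoc_mult_mat[OF P'(1,2) Z(2)] P'(2) Z(2)
    by simp
  also have "\<dots> = 1\<^sub>m N" unfolding P'(3) using Z by simp
  finally have mQ: "minv ?Q = minv P * V1" using minv_eqI[OF Q, of "minv P * V1"] P' Z by simp
  have "(1 / l) \<cdot>\<^sub>m ?R = minv P - ?Z" using P' R by (intro eq_matI) auto
  hence "(1 / l) \<cdot>\<^sub>m ?R * V1 = minv P * V1 - ?Z * V1"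
    using minus_mult_distrib_mat[of "minv P" N N ?Z V1 N] P' Z by simp
  hence mQ1: "minv ?Q - 1\<^sub>m N = (1 / l) \<cdot>\<^sub>m (?R * V1)"
    using mQ Z(3) mult_smult_assoc_mat[OF R Z(2), of "1 / l"] by simp
  have tr: "mtrace (minv ?Q - 1\<^sub>m N) = (1 / l) * mtrace (?R * V1)"
  proof -
    have "?R * V1 \<in> carrier_mat N N" using R Z(2) by (rule mult_carrier_mat)
    moreover have "mtrace (s \<cdot>\<^sub>m K) = s * mtrace K" if "K \<in> carrier_mat N N" for s K
      using that by (simp add: mtrace_def sum_distrib_left)
    ultimately show ?thesis unfolding mQ1 by blast
  qed
  have "det ?Q = det ?Z * det P"
    using det_mult[OF Z(1) P'(1)] by (simp only: resolvent_factor)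
  moreover have "det ?Z * det V1 = 1" using det_mult[OF Z(1,2)] Z(3) by simp
  ultimately have "det ?Q = det P / det V1" using eq_divide_imp[of "det V1" "det ?Z" 1]
    by (metis divide_inverse inverse_unique mult.commute mult_zero_right zero_neq_one)
  thus ?thesis unfolding gammaf_def Let_def tr by simp
qed

end

section \<open>Gaussian losses and the Gibbs inequality\<close>

lemma gauss_has_integral:
  assumes K: "sym_pd d K" and mu: "mu \<in> carrier_vec d"
  shows "integrable (Rsp d) (gauss d mu K)" "integral\<^sup>L (Rsp d) (gauss d mu K) = 1"
proof -
  have "(\<integral>\<^sup>+ x. ennreal (gauss d mu K x) \<partial>Rsp d) = ennreal 1"
    using gauss_moments_const[OF gauss_moments[OF K] sym_pdD(1)[OF K] mu, of 1] by simp
  hence "has_bochner_integral (Rsp d) (gauss d mu K) 1"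
    using gauss_nonneg[OF K] by (intro has_bochner_integral_nn_integral gauss_measurable[OF K mu]) auto
  thus "integrable (Rsp d) (gauss d mu K)" "integral\<^sup>L (Rsp d) (gauss d mu K) = 1"
    by (auto simp: has_bochner_integral_iff)
qed

lemma gauss_is_density:
  assumes K: "sym_pd d K" and mu: "mu \<in> carrier_vec d"
  shows "is_density d (gauss d mu K)"
  unfolding is_density_def
  using gauss_has_integral[OF K mu] gauss_measurable[OF K mu] gauss_nonneg[OF K] by auto

lemma ln_gauss_ratio:
  assumes K1: "sym_pd d K1" and K2: "sym_pd d K2"
  shows "ln (gauss d mu K1 z / gauss d mu K2 z)
    = (1/2) * ((vec d z - mu) \<bullet> (minv K2 *\<^sub>v (vec d z - mu)) - (vec d z - mu) \<bullet> (minv K1 *\<^sub>v (vec d z - mu)))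
      + (1/2) * ln (det K2 / det K1)"
proof -
  note p = sym_pd_det_pos[OF K1] sym_pd_det_pos[OF K2]
  have c: "(2 * pi) ^ d > 0" by simp
  show ?thesis
    unfolding gauss_def using p c
    by (simp add: ln_div ln_mult ln_sqrt field_simps)
qed

lemma marg_gauss_udu:
  assumes G: "G \<in> carrier_mat N m" and W: "sym_pd N W" and S: "sym_pd m S"
    and mx: "mx \<in> carrier_vec N" and my: "my \<in> carrier_vec m"
  shows "marg N m (gauss (N + m) (mx @\<^sub>v my) (udu N m G W S)) y = gauss m my S y"
proof -
  have "mx + G *\<^sub>v (vec m y - my) \<in> carrier_vec N" using G mx my by auto
  from gauss_has_integral(2)[OF W this] show ?thesis
    unfolding marg_def gauss_udu[OF G W S mx my] by simp
qed

text \<open>Conditional laws are expressed through densities: the joint density is a Gaussian in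
  \<open>x\<close>, with mean depending on \<open>y\<close>, times the marginal.\<close>

lemma gauss_udu_conditional:
  assumes G: "G \<in> carrier_mat N m" and W: "sym_pd N W" and S: "sym_pd m S"
    and mx: "mx \<in> carrier_vec N" and my: "my \<in> carrier_vec m" and z: "z \<in> space (Rsp (N + m))"
  shows "gauss (N + m) (mx @\<^sub>v my) (udu N m G W S) z
     = gauss N (mx + G *\<^sub>v (vec m (ypart N m z) - my)) W (xpart N z)
       * marg N m (gauss (N + m) (mx @\<^sub>v my) (udu N m G W S)) (ypart N m z)"
  using gauss_udu[OF G W S mx my, of "xpart N z" "ypart N m z"]
  by (simp add: join_parts[OF z] marg_gauss_udu[OF G W S mx my])

text \<open>Squared bias plus variance, row by row: each row of \<open>H\<close> is one instance of
  \<open>gauss_moments\<close> with the bias as offset \<open>a\<close>.\<close>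

lemma gauss_quadratic_loss:
  assumes W: "sym_pd N W" and mu: "mu \<in> carrier_vec N" and b: "b \<in> carrier_vec N"
    and H: "H \<in> carrier_mat n N"
  shows "(\<integral>\<^sup>+ x. ennreal (sqnorm (H *\<^sub>v (vec N x - b)) * gauss N mu W x) \<partial>Rsp N)
     = ennreal (\<Sum>k<n. (row H k \<bullet> (mu - b))\<^sup>2 + row H k \<bullet> (W *\<^sub>v row H k))"
proof -
  have rk: "row H k \<in> carrier_vec N" if "k < n" for k using H that by auto
  have [measurable]: "gauss N mu W \<in> borel_measurable (Rsp N)" "\<And>v. (\<lambda>x. v \<bullet> (vec N x - mu)) \<in> borel_measurable (Rsp N)"
    using gauss_measurable[OF W mu] linear_form_measurable[OF mu] by auto
  have "sqnorm (H *\<^sub>v (vec N x - b)) * gauss N mu W x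
      = (\<Sum>k<n. gauss N mu W x * (row H k \<bullet> (mu - b) + row H k \<bullet> (vec N x - mu))\<^sup>2)" for x
  proof -
    have "row H k \<bullet> (vec N x - b) = row H k \<bullet> (mu - b) + row H k \<bullet> (vec N x - mu)" if "k < n" for k
    proof -
      have "vec N x - b = (mu - b) + (vec N x - mu)" using mu b by (intro eq_vecI) auto
      thus ?thesis using rk[OF that] mu b by (simp add: scalar_prod_add_distrib[of _ N])
    qed
    thus ?thesis using H b by (simp add: sqnorm_def sum_distrib_right sum_distrib_left mult.commute)
  qed
  hence "(\<integral>\<^sup>+ x. ennreal (sqnorm (H *\<^sub>v (vec N x - b)) * gauss N mu W x) \<partial>Rsp N)
     = (\<integral>\<^sup>+ x. (\<Sum>k<n. ennreal (gauss N mu W x * (row H k \<bullet> (mu - b) + row H k \<bullet> (vec N x - mu))\<^sup>2)) \<partial>Rsp N)"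
    using gauss_nonneg[OF W] by (simp add: sum_ennreal)
  also have "\<dots> = (\<Sum>k<n. \<integral>\<^sup>+ x. ennreal (gauss N mu W x * (row H k \<bullet> (mu - b) + row H k \<bullet> (vec N x - mu))\<^sup>2) \<partial>Rsp N)"
    by (rule nn_integral_sum) measurable
  also have "\<dots> = (\<Sum>k<n. ennreal ((row H k \<bullet> (mu - b))\<^sup>2 + row H k \<bullet> (W *\<^sub>v row H k)))"
    using gauss_moments[OF W] mu rk by (intro sum.cong) (auto simp: gauss_moments_def)
  also have "\<dots> = ennreal (\<Sum>k<n. (row H k \<bullet> (mu - b))\<^sup>2 + row H k \<bullet> (W *\<^sub>v row H k))"
    using sym_pdD(4)[OF W] rk by (intro sum_ennreal) auto
  finally show ?thesis .
qed

lemma mtrace_gram_mult: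
  assumes H: "H \<in> carrier_mat n N" and W: "W \<in> carrier_mat N N"
  shows "mtrace (transpose_mat H * H * W) = (\<Sum>k<n. row H k \<bullet> (W *\<^sub>v row H k))"
proof -
  have "transpose_mat H * H * W = transpose_mat H * (H * W)" using H W by simp
  hence "mtrace (transpose_mat H * H * W) = mtrace (H * W * transpose_mat H)"
    using mtrace_mult_commute[of "transpose_mat H" N n "H * W"] H W by simp
  also have "\<dots> = (\<Sum>k<n. row (H * (W * transpose_mat H)) k $ k)"
    using H W by (simp add: mtrace_def)
  also have "\<dots> = (\<Sum>k<n. row H k \<bullet> (W *\<^sub>v row H k))"
  proof (rule sum.cong)
    fix k assume "k \<in> {..<n}"
    hence k: "k < n" by simp
    have "col (W * transpose_mat H) k = W *\<^sub>v row H k"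
      using H W k by (subst col_mult2[of _ N N _ n]) auto
    thus "row (H * (W * transpose_mat H)) k $ k = row H k \<bullet> (W *\<^sub>v row H k)" using H W k by simp
  qed simp
  finally show ?thesis .
qed

text \<open>The Gibbs variational inequality: pointwise, \<open>f ln (h / fb) \<le> f ln (f / fb) - f + h\<close>,
  which also yields integrability of the left-hand side.\<close>

lemma entropy_bound:
  assumes f: "is_density d f" and h: "is_density d h"
    and int: "integrable (Rsp d) (\<lambda>z. f z * ln (f z / fb z))"
    and pos: "\<And>z. z \<in> space (Rsp d) \<Longrightarrow> 0 < fb z" "\<And>z. z \<in> space (Rsp d) \<Longrightarrow> 0 < h z"
    and s: "0 < s" and q: "\<And>z. z \<in> space (Rsp d) \<Longrightarrow> 0 \<le> q z"
    and eq: "\<And>z. z \<in> space (Rsp d) \<Longrightarrow> ln (h z / fb z) = s * q z + k"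
  shows "(\<integral>\<^sup>+ z. ennreal (q z * f z) \<partial>Rsp d) \<le> ennreal ((KL d f fb - k) / s)"
proof -
  \<comment> \<open>An integrable majorant of \<open>q * f\<close>. Its terms \<open>- f\<close> and
    \<open>h\<close> integrate to -1 and 1 and cancel, which leaves the stated bound.\<close>
  define R where "R z = (f z * ln (f z / fb z) - f z + h z - k * f z) / s" for z
  have fi: "integrable (Rsp d) f" "integral\<^sup>L (Rsp d) f = 1" and hi: "integrable (Rsp d) h" "integral\<^sup>L (Rsp d) h = 1"
    and f0: "\<And>z. z \<in> space (Rsp d) \<Longrightarrow> 0 \<le> f z"
    using f h by (auto simp: is_density_def)
  have Ri: "integrable (Rsp d) R" unfolding R_def using fi hi int by auto
  have RI: "integral\<^sup>L (Rsp d) R = (KL d f fb - k) / s"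
    unfolding R_def using fi hi int by (simp add: KL_def)
  have le: "q z * f z \<le> R z" if z: "z \<in> space (Rsp d)" for z
  proof -
    have "f z * ln (h z / fb z) \<le> f z * ln (f z / fb z) - f z + h z"
    proof (cases "f z = 0")
      case True thus ?thesis using pos(2)[OF z] by simp
    next
      case False
      hence fp: "0 < f z" using f0[OF z] by simp
      \<comment> \<open>Concavity of the logarithm, \<open>ln x <= x - 1\<close>, at the ratio of
        \<open>h\<close> to \<open>f\<close>.\<close>
      have "ln (h z / f z) \<le> h z / f z - 1" using fp pos(2)[OF z] by (intro ln_le_minus_one) auto
      hence "f z * ln (h z / f z) \<le> h z - f z" using fp by (simp add: field_simps)
      moreover have "ln (h z / f z) = ln (h z / fb z) - ln (f z / fb z)"
        using fp pos[OF z] by (simp add: ln_div)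
      ultimately show ?thesis by (simp add: algebra_simps)
    qed
    hence "s * (q z * f z) \<le> f z * ln (f z / fb z) - f z + h z - k * f z"
      unfolding eq[OF z] by (simp add: algebra_simps)
    thus ?thesis using s by (simp add: R_def field_simps)
  qed
  have R0: "0 \<le> R z" if z: "z \<in> space (Rsp d)" for z
    using le[OF z] q[OF z] f0[OF z] by (meson mult_nonneg_nonneg order_trans)
  have "(\<integral>\<^sup>+ z. ennreal (q z * f z) \<partial>Rsp d) \<le> (\<integral>\<^sup>+ z. ennreal (R z) \<partial>Rsp d)"
    by (intro nn_integral_mono ennreal_leI le)
  also have "\<dots> = ennreal ((KL d f fb - k) / s)"
    using Ri R0 RI by (subst nn_integral_eq_integral) auto
  finally show ?thesis .
qed

section \<open>Estimation loss under a factored Gaussian\<close>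

lemma measurable_ypart: "ypart N m \<in> Rsp (N + m) \<rightarrow>\<^sub>M Rsp m"
  unfolding Rsp_def[of m]
proof (rule measurable_PiM_single')
  fix i assume "i \<in> {..<m}"
  thus "(\<lambda>z. ypart N m z i) \<in> Rsp (N + m) \<rightarrow>\<^sub>M lborel" by (auto simp: ypart_def)
qed (simp add: PiE_iff extensional_def ypart_def)

lemma loss_measurable:
  assumes g: "g \<in> Rsp m \<rightarrow>\<^sub>M Rsp N" and H: "H \<in> carrier_mat n N"
  shows "(\<lambda>z. sqnorm (H *\<^sub>v vec N (\<lambda>i. z i - g (ypart N m z) i))) \<in> borel_measurable (Rsp (N + m))"
proof -
  have [measurable]: "(\<lambda>z. g (ypart N m z) i) \<in> borel_measurable (Rsp (N + m))" if "i < N" for i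
    using measurable_compose[OF measurable_compose[OF measurable_ypart g] measurable_Rsp_component[OF that]] .
  have eq: "sqnorm (H *\<^sub>v vec N (\<lambda>i. z i - g (ypart N m z) i))
      = (\<Sum>k<n. (\<Sum>i<N. H $$ (k, i) * (z i - g (ypart N m z) i))\<^sup>2)" for z
    using H by (auto simp: sqnorm_def scalar_prod_def atLeast0LessThan intro!: sum.cong)
  show ?thesis unfolding eq by measurable
qed

text \<open>Conditioning on \<open>y\<close> makes the estimate a constant vector, so the inner
  integral is \<open>gauss_quadratic_loss\<close>. What remains is the squared bias of
  \<open>g\<close> at \<open>y\<close> plus a variance independent of \<open>g\<close>.\<close>

lemma cost_gauss_udu:
  assumes G: "G \<in> carrier_mat N m" and W: "sym_pd N W" and S: "sym_pd m S"
    and mx: "mx \<in> carrier_vec N" and my: "my \<in> carrier_vec m"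
    and g: "g \<in> Rsp m \<rightarrow>\<^sub>M Rsp N" and H: "H \<in> carrier_mat n N"
  shows "(\<integral>\<^sup>+ z. ennreal (sqnorm (H *\<^sub>v vec N (\<lambda>i. z i - g (ypart N m z) i))
            * gauss (N + m) (mx @\<^sub>v my) (udu N m G W S) z) \<partial>Rsp (N + m))
    = (\<integral>\<^sup>+ y. ennreal (gauss m my S y * (\<Sum>k<n. (row H k \<bullet> (mx + G *\<^sub>v (vec m y - my) - vec N (g y)))\<^sup>2
            + row H k \<bullet> (W *\<^sub>v row H k))) \<partial>Rsp m)"
proof -
  let ?K = "udu N m G W S"
  have K: "sym_pd (N + m) ?K" by (rule sym_pd_udu[OF G W S])
  have mz: "mx @\<^sub>v my \<in> carrier_vec (N + m)" using mx my by simp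
  have [measurable]: "gauss (N + m) (mx @\<^sub>v my) ?K \<in> borel_measurable (Rsp (N + m))"
    by (rule gauss_measurable[OF K mz])
  note [measurable] = loss_measurable[OF g H]
  have "(\<integral>\<^sup>+ z. ennreal (sqnorm (H *\<^sub>v vec N (\<lambda>i. z i - g (ypart N m z) i))
            * gauss (N + m) (mx @\<^sub>v my) ?K z) \<partial>Rsp (N + m))
    = (\<integral>\<^sup>+ y. \<integral>\<^sup>+ x. ennreal (sqnorm (H *\<^sub>v vec N (\<lambda>i. join N m x y i - g (ypart N m (join N m x y)) i))
            * gauss (N + m) (mx @\<^sub>v my) ?K (join N m x y)) \<partial>Rsp N \<partial>Rsp m)"
    by (rule nn_integral_Rsp_join) measurable
  also have "\<dots> = (\<integral>\<^sup>+ y. ennreal (gauss m my S y * (\<Sum>k<n. (row H k \<bullet> (mx + G *\<^sub>v (vec m y - my) - vec N (g y)))\<^sup>2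
            + row H k \<bullet> (W *\<^sub>v row H k))) \<partial>Rsp m)"
  proof (rule nn_integral_cong)
    fix y assume y: "y \<in> space (Rsp m)"
    let ?mu = "mx + G *\<^sub>v (vec m y - my)"
    have mu: "?mu \<in> carrier_vec N" using G mx my by auto
    have b: "vec N (g y) \<in> carrier_vec N" by simp
    have mm: "(\<lambda>x. sqnorm (H *\<^sub>v (vec N x - vec N (g y)))) \<in> borel_measurable (Rsp N)"
    proof -
      have eq: "sqnorm (H *\<^sub>v (vec N x - vec N (g y))) = (\<Sum>k<n. (\<Sum>i<N. H $$ (k, i) * (x i - g y i))\<^sup>2)" for x
        using H by (auto simp: sqnorm_def scalar_prod_def atLeast0LessThan intro!: sum.cong)
      show ?thesis unfolding eq by measurable
    qed
    note [measurable] = mm gauss_measurable[OF W mu]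
    have "vec N (\<lambda>i. join N m x y i - g (ypart N m (join N m x y)) i) = vec N x - vec N (g y)" for x
      unfolding ypart_join[OF y] by (intro eq_vecI) (auto simp: join_def)
    hence "(\<integral>\<^sup>+ x. ennreal (sqnorm (H *\<^sub>v vec N (\<lambda>i. join N m x y i - g (ypart N m (join N m x y)) i))
            * gauss (N + m) (mx @\<^sub>v my) ?K (join N m x y)) \<partial>Rsp N)
      = (\<integral>\<^sup>+ x. ennreal (gauss m my S y) * ennreal (sqnorm (H *\<^sub>v (vec N x - vec N (g y))) * gauss N ?mu W x) \<partial>Rsp N)"
      unfolding gauss_udu[OF G W S mx my] using gauss_nonneg[OF S]
      by (simp add: ennreal_mult'[symmetric] mult_ac)
    also have "\<dots> = ennreal (gauss m my S y) * ennreal (\<Sum>k<n. (row H k \<bullet> (?mu - vec N (g y)))\<^sup>2 + row H k \<bullet> (W *\<^sub>v row H k))"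
      by (subst nn_integral_cmult, measurable) (simp only: gauss_quadratic_loss[OF W mu b H])
    finally show "(\<integral>\<^sup>+ x. ennreal (sqnorm (H *\<^sub>v vec N (\<lambda>i. join N m x y i - g (ypart N m (join N m x y)) i))
            * gauss (N + m) (mx @\<^sub>v my) ?K (join N m x y)) \<partial>Rsp N)
       = ennreal (gauss m my S y * (\<Sum>k<n. (row H k \<bullet> (?mu - vec N (g y)))\<^sup>2 + row H k \<bullet> (W *\<^sub>v row H k)))"
      using gauss_nonneg[OF S] by (simp add: ennreal_mult')
  qed
  finally show ?thesis .
qed

section \<open>The saddle point\<close>

lemma sym_pd_smult:
  assumes K: "sym_pd d K" and a: "0 < a"
  shows "sym_pd d (a \<cdot>\<^sub>m K)" "minv (a \<cdot>\<^sub>m K) = (1 / a) \<cdot>\<^sub>m minv K"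
proof -
  note K' = sym_pdD[OF K] and I = sym_pd_minv_inverse[OF K]
  show "sym_pd d (a \<cdot>\<^sub>m K)"
    unfolding sym_pd_def
  proof (intro conjI ballI impI)
    show "transpose_mat (a \<cdot>\<^sub>m K) = a \<cdot>\<^sub>m K"
    proof -
      have "transpose_mat (a \<cdot>\<^sub>m K) = a \<cdot>\<^sub>m transpose_mat K" by (intro eq_matI) auto
      thus ?thesis using K' by simp
    qed
    fix v :: "real vec" assume v: "v \<in> carrier_vec d" "v \<noteq> 0\<^sub>v d"
    have "(a \<cdot>\<^sub>m K) *\<^sub>v v = a \<cdot>\<^sub>v (K *\<^sub>v v)" using K'(1) v(1) by (intro eq_vecI) auto
    thus "0 < v \<bullet> (a \<cdot>\<^sub>m K *\<^sub>v v)" using K'(1) K'(3)[OF v] v(1) a by simp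
  qed (use K' in auto)
  show "minv (a \<cdot>\<^sub>m K) = (1 / a) \<cdot>\<^sub>m minv K"
  proof (rule minv_eqI[of _ d])
    have "a \<cdot>\<^sub>m K * ((1 / a) \<cdot>\<^sub>m minv K) = (1 / a) \<cdot>\<^sub>m (a \<cdot>\<^sub>m (K * minv K))"
      using K'(1) I(1) by (simp add: mult_smult_assoc_mat[of _ d d _ d] mult_smult_distrib[of _ d d _ d])
    thus "a \<cdot>\<^sub>m K * ((1 / a) \<cdot>\<^sub>m minv K) = 1\<^sub>m d"
      unfolding I(2) using a by (auto intro!: eq_matI)
  qed (use K' I in auto)
qed

lemma quadratic_form_measurable:
  fixes M :: "real mat"
  assumes "M \<in> carrier_mat d d" "mu \<in> carrier_vec d"
  shows "(\<lambda>z. (vec d z - mu) \<bullet> (M *\<^sub>v (vec d z - mu))) \<in> borel_measurable (Rsp d)"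
  unfolding quadratic_form_sum[OF assms] by measurable

lemma sqnorm_mult_form:
  assumes "H \<in> carrier_mat n N" "v \<in> carrier_vec N"
  shows "sqnorm (H *\<^sub>v v) = v \<bullet> ((transpose_mat H * H) *\<^sub>v v)"
  unfolding gram_form_sum[OF assms] using assms by (simp add: sqnorm_def)

lemma sqnorm_nonneg: "0 \<le> sqnorm v"
  by (auto simp: sqnorm_def intro: sum_nonneg)

context
  fixes N m n :: nat and G P V1 S H :: "real mat" and mx my :: "real vec" and lt c :: real
    and g0 :: "(nat \<Rightarrow> real) \<Rightarrow> (nat \<Rightarrow> real)"
  assumes G: "G \<in> carrier_mat N m" and P: "sym_pd N P" and V1: "sym_pd N V1" and S: "sym_pd m S"
    and H: "H \<in> carrier_mat n N" and mx: "mx \<in> carrier_vec N" and my: "my \<in> carrier_vec m"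
    and lt: "0 < lt" and VP: "minv V1 = minv P - (1 / lt) \<cdot>\<^sub>m (transpose_mat H * H)"
    and c: "c = (1/2) * ((1 / lt) * mtrace (transpose_mat H * H * V1) + ln (det P / det V1))"
    and g0m: "g0 \<in> Rsp m \<rightarrow>\<^sub>M Rsp N" and g0: "\<And>y. vec N (g0 y) = mx + G *\<^sub>v (vec m y - my)"
begin

abbreviation (input) "nominal_density \<equiv> gauss (N + m) (mx @\<^sub>v my) (udu N m G P S)"
abbreviation (input) "worst_density \<equiv> gauss (N + m) (mx @\<^sub>v my) (udu N m G V1 S)"
abbreviation (input) "sq_loss z \<equiv> sqnorm (H *\<^sub>v vec N (\<lambda>i. z i - g0 (ypart N m z) i))"
abbreviation (input) "worst_loss \<equiv> mtrace (transpose_mat H * H * V1)"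

lemma ln_worst_ratio:
  assumes z: "z \<in> space (Rsp (N + m))"
  shows "ln (worst_density z / nominal_density z) = (1 / (2 * lt)) * sq_loss z + (1/2) * ln (det P / det V1)"
proof -
  define x y where "x = xpart N z" and "y = ypart N m z"
  have zj: "z = join N m x y" using join_parts[OF z] by (simp add: x_def y_def)
  let ?mu = "mx + G *\<^sub>v (vec m y - my)"
  define e where "e = vec N x - ?mu"
  have mu: "?mu \<in> carrier_vec N" using G mx my by auto
  have e: "e \<in> carrier_vec N" using mu by (simp add: e_def)
  note P' = sym_pd_minv_inverse(1)[OF P]
  have R: "transpose_mat H * H \<in> carrier_mat N N" using H by simp
  have "vec N (\<lambda>i. z i - g0 (ypart N m z) i) = vec N x - vec N (g0 y)"
    by (intro eq_vecI) (auto simp: x_def y_def xpart_def)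
  hence l: "sq_loss z = e \<bullet> ((transpose_mat H * H) *\<^sub>v e)"
    using sqnorm_mult_form[OF H e] by (simp add: g0 e_def)
  have "worst_density z / nominal_density z = gauss N ?mu V1 x / gauss N ?mu P x"
    unfolding zj gauss_udu[OF G V1 S mx my] gauss_udu[OF G P S mx my]
    using gauss_pos[OF S, of my y] by simp
  hence "ln (worst_density z / nominal_density z) = (1/2) * (e \<bullet> (minv P *\<^sub>v e) - e \<bullet> (minv V1 *\<^sub>v e)) + (1/2) * ln (det P / det V1)"
    by (simp only: ln_gauss_ratio[OF V1 P] e_def)
  moreover have "e \<bullet> (minv V1 *\<^sub>v e) = e \<bullet> (minv P *\<^sub>v e) - (1 / lt) * (e \<bullet> ((transpose_mat H * H) *\<^sub>v e))"
  proof -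
    have "minv V1 *\<^sub>v e = minv P *\<^sub>v e - ((1 / lt) \<cdot>\<^sub>m (transpose_mat H * H)) *\<^sub>v e"
      unfolding VP using P' R e by (intro minus_mult_distrib_mat_vec) auto
    also have "((1 / lt) \<cdot>\<^sub>m (transpose_mat H * H)) *\<^sub>v e = (1 / lt) \<cdot>\<^sub>v ((transpose_mat H * H) *\<^sub>v e)"
      using R e by (intro eq_vecI) auto
    finally show ?thesis
      using P' R e by (simp add: scalar_prod_minus_distrib[of _ N] del: assoc_mult_mat_vec)
  qed
  ultimately show ?thesis unfolding l using lt by (simp add: field_simps)
qed

text \<open>\<open>g0\<close> is the conditional mean, so the bias term of
  \<open>cost_gauss_udu\<close> vanishes and the integrand in \<open>y\<close> is a constant times
  the marginal density.\<close>

lemma loss_worst_integral: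
  "(\<integral>\<^sup>+ z. ennreal (sq_loss z * worst_density z) \<partial>Rsp (N + m)) = ennreal worst_loss"
proof -
  have T: "worst_loss = (\<Sum>k<n. row H k \<bullet> (V1 *\<^sub>v row H k))"
    by (rule mtrace_gram_mult[OF H sym_pdD(1)[OF V1]])
  have T0: "0 \<le> worst_loss" unfolding T using H by (intro sum_nonneg sym_pdD(4)[OF V1]) auto
  have "mx + G *\<^sub>v (vec m y - my) - vec N (g0 y) = 0\<^sub>v N" for y
    unfolding g0 using G mx my by auto
  moreover have "row H k \<bullet> 0\<^sub>v N = 0" if "k < n" for k using H that by auto
  ultimately have "(\<integral>\<^sup>+ z. ennreal (sq_loss z * worst_density z) \<partial>Rsp (N + m)) = (\<integral>\<^sup>+ y. ennreal (gauss m my S y * worst_loss) \<partial>Rsp m)"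
    unfolding cost_gauss_udu[OF G V1 S mx my g0m H] T by simp
  also have "\<dots> = ennreal worst_loss"
    by (rule gauss_moments_const[OF gauss_moments[OF S] sym_pdD(1)[OF S] my T0])
  finally show ?thesis .
qed

lemma loss_worst_has_integral:
  "has_bochner_integral (Rsp (N + m)) (\<lambda>z. sq_loss z * worst_density z) worst_loss"
proof (rule has_bochner_integral_nn_integral)
  have K: "sym_pd (N + m) (udu N m G V1 S)" by (rule sym_pd_udu[OF G V1 S])
  have mz: "mx @\<^sub>v my \<in> carrier_vec (N + m)" using mx my by simp
  note [measurable] = gauss_measurable[OF K mz] loss_measurable[OF g0m H]
  show "(\<lambda>z. sq_loss z * worst_density z) \<in> borel_measurable (Rsp (N + m))" by measurable
  show "AE z in Rsp (N + m). 0 \<le> sq_loss z * worst_density z"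
    using gauss_nonneg[OF K] sqnorm_nonneg by auto
  show "0 \<le> worst_loss"
    unfolding mtrace_gram_mult[OF H sym_pdD(1)[OF V1]] using H by (intro sum_nonneg sym_pdD(4)[OF V1]) auto
qed (rule loss_worst_integral)

text \<open>Integrating the affine relation \<open>ln_worst_ratio\<close> against the worst-case
  density turns the loss into \<open>worst_loss\<close>; the outcome is the expression for
  \<open>c\<close>.\<close>

lemma worst_in_ambiguity_set: "worst_density \<in> amb (N + m) nominal_density c" "KL (N + m) worst_density nominal_density = c"
proof -
  have K: "sym_pd (N + m) (udu N m G V1 S)" by (rule sym_pd_udu[OF G V1 S])
  have mz: "mx @\<^sub>v my \<in> carrier_vec (N + m)" using mx my by simp
  let ?k = "(1/2) * ln (det P / det V1)"
  have "has_bochner_integral (Rsp (N + m)) worst_density 1"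
    using gauss_has_integral[OF K mz] by (simp add: has_bochner_integral_iff)
  hence "has_bochner_integral (Rsp (N + m)) (\<lambda>z. (1 / (2 * lt)) * (sq_loss z * worst_density z) + ?k * worst_density z)
     ((1 / (2 * lt)) * worst_loss + ?k * 1)"
    by (intro has_bochner_integral_add has_bochner_integral_mult_right loss_worst_has_integral)
  also have "(1 / (2 * lt)) * worst_loss + ?k * 1 = c" unfolding c by (simp add: field_simps)
  finally have "has_bochner_integral (Rsp (N + m)) (\<lambda>z. worst_density z * ln (worst_density z / nominal_density z)) c"
    by (rule has_bochner_integral_cong[THEN iffD1, rotated -1]) (simp_all add: ln_worst_ratio algebra_simps)
  thus "worst_density \<in> amb (N + m) nominal_density c" "KL (N + m) worst_density nominal_density = c"
    using gauss_is_density[OF K mz] by (auto simp: amb_def KL_def has_bochner_integral_iff)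
qed

text \<open>Second moments must be finite under every density of the ambiguity set. As
  \<open>g0\<close> is affine in \<open>y\<close>, it is enough to control the form \<open>q\<close>
  of \<open>S^-1\<close> in \<open>y\<close>, and finite divergence does so through
  \<open>entropy_bound\<close>.\<close>

lemma estimator_admissible: "g0 \<in> estims N m (amb (N + m) nominal_density c)"
  unfolding estims_def
proof (intro CollectI conjI ballI g0m)
  fix f assume f: "f \<in> amb (N + m) nominal_density c"
  have f1: "is_density (N + m) f" and f2: "integrable (Rsp (N + m)) (\<lambda>z. f z * ln (f z / nominal_density z))"
    using f by (auto simp: amb_def)
  have fm [measurable]: "f \<in> borel_measurable (Rsp (N + m))" and fnn: "\<And>z. z \<in> space (Rsp (N + m)) \<Longrightarrow> 0 \<le> f z"
    and fi: "integrable (Rsp (N + m)) f" using f1 by (auto simp: is_density_def)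
  have mz: "mx @\<^sub>v my \<in> carrier_vec (N + m)" using mx my by simp
  \<comment> \<open>Only the innovation covariance is inflated, so the log-ratio to the nominal
    density depends on \<open>y\<close> alone. Doubling halves the precision and gives
    \<open>q\<close> the positive coefficient \<open>(1/2) * (1 - 1/2) = 1/4\<close>.\<close>
  let ?S2 = "2 \<cdot>\<^sub>m S"
  have S2: "sym_pd m ?S2" and mS2: "minv ?S2 = (1/2) \<cdot>\<^sub>m minv S" using sym_pd_smult[OF S, of 2] by auto
  have KP: "sym_pd (N + m) (udu N m G P S)" by (rule sym_pd_udu[OF G P S])
  have Kh: "sym_pd (N + m) (udu N m G P ?S2)" by (rule sym_pd_udu[OF G P S2])
  let ?h = "gauss (N + m) (mx @\<^sub>v my) (udu N m G P ?S2)"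
  define q where "q z = (vec m (ypart N m z) - my) \<bullet> (minv S *\<^sub>v (vec m (ypart N m z) - my))" for z
  note S' = sym_pd_minv_inverse(1)[OF S]
  have bc: "vec m (ypart N m z) - my \<in> carrier_vec m" for z using my by simp
  have q0: "0 \<le> q z" for z unfolding q_def by (rule sym_pdD(4)[OF sym_pd_minv[OF S] bc])
  have [measurable]: "q \<in> borel_measurable (Rsp (N + m))"
    unfolding q_def using measurable_compose[OF measurable_ypart quadratic_form_measurable[OF S' my]] .
  have ratio: "ln (?h z / nominal_density z) = (1/4) * q z + (1/2) * ln (det S / det ?S2)" if z: "z \<in> space (Rsp (N + m))" for z
  proof -
    define x y where "x = xpart N z" and "y = ypart N m z"
    have zj: "z = join N m x y" using join_parts[OF z] by (simp add: x_def y_def)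
    have "?h z / nominal_density z = gauss m my ?S2 y / gauss m my S y"
      unfolding zj gauss_udu[OF G P S2 mx my] gauss_udu[OF G P S mx my]
      using gauss_pos[OF P] by (simp add: less_imp_neq[symmetric])
    hence "ln (?h z / nominal_density z) = (1/2) * ((vec m y - my) \<bullet> (minv S *\<^sub>v (vec m y - my)) - (vec m y - my) \<bullet> (minv ?S2 *\<^sub>v (vec m y - my)))
        + (1/2) * ln (det S / det ?S2)"
      by (simp only: ln_gauss_ratio[OF S2 S])
    moreover have "minv ?S2 *\<^sub>v (vec m y - my) = (1/2) \<cdot>\<^sub>v (minv S *\<^sub>v (vec m y - my))"
      unfolding mS2 using S' my by (intro eq_vecI) auto
    moreover have "(vec m y - my) \<bullet> ((1/2) \<cdot>\<^sub>v (minv S *\<^sub>v (vec m y - my))) = (1/2) * q z"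
      using S' my by (simp add: q_def y_def)
    ultimately show ?thesis by (simp add: q_def y_def)
  qed
  have qfin: "(\<integral>\<^sup>+ z. ennreal (q z * f z) \<partial>Rsp (N + m)) < \<infinity>"
    using entropy_bound[OF f1 gauss_is_density[OF Kh mz] f2 gauss_pos[OF KP] gauss_pos[OF Kh] _ q0 ratio]
    by (simp add: order.strict_trans1)
  \<comment> \<open>The factors 2 come from \<open>(a + b)^2 <= 2 a^2 + 2 b^2\<close>; the
    coefficients in \<open>C\<close> come from \<open>sym_pd_dual_bound\<close> on the rows of
    \<open>G\<close>.\<close>
  define A C where "A = (\<Sum>i<N. 2 * (mx $ i)\<^sup>2)" and "C = (\<Sum>i<N. 2 * (row G i \<bullet> (S *\<^sub>v row G i)))"
  have A0: "0 \<le> A" by (auto simp: A_def intro: sum_nonneg)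
  have C0: "0 \<le> C" unfolding C_def using G by (intro sum_nonneg mult_nonneg_nonneg sym_pdD(4)[OF S]) auto
  have bound: "sqnorm (vec N (g0 (ypart N m z))) \<le> A + C * q z" for z
  proof -
    let ?b = "vec m (ypart N m z) - my"
    have "sqnorm (vec N (g0 (ypart N m z))) = (\<Sum>i<N. (mx $ i + row G i \<bullet> ?b)\<^sup>2)"
      unfolding g0 sqnorm_def using G mx my by simp
    also have "\<dots> \<le> (\<Sum>i<N. 2 * (mx $ i)\<^sup>2 + 2 * (row G i \<bullet> (S *\<^sub>v row G i)) * q z)"
    proof (rule sum_mono)
      fix i assume i: "i \<in> {..<N}"
      have "(row G i \<bullet> ?b)\<^sup>2 \<le> (row G i \<bullet> (S *\<^sub>v row G i)) * q z"
        unfolding q_def by (rule sym_pd_dual_bound[OF S _ bc]) (use G i in auto)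
      moreover have "(mx $ i + row G i \<bullet> ?b)\<^sup>2 \<le> 2 * (mx $ i)\<^sup>2 + 2 * (row G i \<bullet> ?b)\<^sup>2"
        using sum_squares_bound[of "mx $ i" "row G i \<bullet> ?b"] by (simp add: power2_sum)
      ultimately show "(mx $ i + row G i \<bullet> ?b)\<^sup>2 \<le> 2 * (mx $ i)\<^sup>2 + 2 * (row G i \<bullet> (S *\<^sub>v row G i)) * q z" by linarith
    qed
    also have "\<dots> = A + C * q z" by (simp add: A_def C_def sum.distrib sum_distrib_right)
    finally show ?thesis .
  qed
  have "(\<integral>\<^sup>+ z. ennreal (f z * sqnorm (vec N (g0 (ypart N m z)))) \<partial>Rsp (N + m))
     \<le> (\<integral>\<^sup>+ z. ennreal A * ennreal (f z) + ennreal C * ennreal (q z * f z) \<partial>Rsp (N + m))"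
  proof (rule nn_integral_mono)
    fix z assume z: "z \<in> space (Rsp (N + m))"
    have "f z * sqnorm (vec N (g0 (ypart N m z))) \<le> f z * (A + C * q z)"
      by (rule mult_left_mono[OF bound fnn[OF z]])
    also have "\<dots> = A * f z + C * (q z * f z)" by (simp add: algebra_simps)
    finally have "ennreal (f z * sqnorm (vec N (g0 (ypart N m z)))) \<le> ennreal (A * f z + C * (q z * f z))"
      by (rule ennreal_leI)
    thus "ennreal (f z * sqnorm (vec N (g0 (ypart N m z)))) \<le> ennreal A * ennreal (f z) + ennreal C * ennreal (q z * f z)"
      using A0 C0 fnn[OF z] q0[of z] by (simp add: ennreal_plus ennreal_mult)
  qed
  also have "\<dots> = ennreal A * (\<integral>\<^sup>+ z. ennreal (f z) \<partial>Rsp (N + m)) + ennreal C * (\<integral>\<^sup>+ z. ennreal (q z * f z) \<partial>Rsp (N + m))"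
    by (subst nn_integral_add) (simp_all add: nn_integral_cmult)
  also have "\<dots> < \<infinity>"
  proof -
    have "(\<integral>\<^sup>+ z. ennreal (f z) \<partial>Rsp (N + m)) = ennreal 1"
      using f1 by (subst nn_integral_eq_integral) (auto simp: is_density_def)
    thus ?thesis using qfin by (simp add: ennreal_mult_less_top)
  qed
  finally show "(\<integral>\<^sup>+ z. ennreal (f z * sqnorm (vec N (g0 (ypart N m z)))) \<partial>Rsp (N + m)) < \<infinity>" .
qed

lemma cost_worst: "cost N m H worst_density g0 = ennreal (1/2) * ennreal worst_loss"
  unfolding cost_def loss_worst_integral ..

text \<open>\<open>entropy_bound\<close> with the worst-case density as comparison and slope
  \<open>1 / (2 lt)\<close>. The bound increases with the divergence, and at divergence
  \<open>c\<close> it is exactly \<open>worst_loss\<close>.\<close>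

lemma saddle_density:
  assumes f: "f \<in> amb (N + m) nominal_density c"
  shows "cost N m H f g0 \<le> cost N m H worst_density g0"
proof -
  have f1: "is_density (N + m) f" and f2: "integrable (Rsp (N + m)) (\<lambda>z. f z * ln (f z / nominal_density z))"
    and f3: "KL (N + m) f nominal_density \<le> c"
    using f by (auto simp: amb_def)
  have mz: "mx @\<^sub>v my \<in> carrier_vec (N + m)" using mx my by simp
  have KP: "sym_pd (N + m) (udu N m G P S)" by (rule sym_pd_udu[OF G P S])
  have K: "sym_pd (N + m) (udu N m G V1 S)" by (rule sym_pd_udu[OF G V1 S])
  let ?k = "(1/2) * ln (det P / det V1)"
  have "(\<integral>\<^sup>+ z. ennreal (sq_loss z * f z) \<partial>Rsp (N + m)) \<le> ennreal ((KL (N + m) f nominal_density - ?k) / (1 / (2 * lt)))"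
    by (rule entropy_bound[OF f1 gauss_is_density[OF K mz] f2 gauss_pos[OF KP] gauss_pos[OF K] _ sqnorm_nonneg ln_worst_ratio])
      (use lt in auto)
  also have "\<dots> \<le> ennreal worst_loss"
  proof (rule ennreal_leI)
    have "(KL (N + m) f nominal_density - ?k) / (1 / (2 * lt)) \<le> (c - ?k) / (1 / (2 * lt))"
      using f3 lt by (intro divide_right_mono) auto
    also have "\<dots> = worst_loss" using lt unfolding c by (simp add: field_simps)
    finally show "(KL (N + m) f nominal_density - ?k) / (1 / (2 * lt)) \<le> worst_loss" .
  qed
  finally show ?thesis unfolding cost_worst unfolding cost_def by (intro mult_left_mono) auto
qed

text \<open>In \<open>cost_gauss_udu\<close> only the squared bias depends on the estimator;
  dropping it leaves the cost of \<open>g0\<close>.\<close>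

lemma saddle_estimator:
  assumes g: "g \<in> Rsp m \<rightarrow>\<^sub>M Rsp N"
  shows "cost N m H worst_density g0 \<le> cost N m H worst_density g"
proof -
  have T: "worst_loss = (\<Sum>k<n. row H k \<bullet> (V1 *\<^sub>v row H k))"
    by (rule mtrace_gram_mult[OF H sym_pdD(1)[OF V1]])
  have T0: "0 \<le> worst_loss" unfolding T using H by (intro sum_nonneg sym_pdD(4)[OF V1]) auto
  have "ennreal worst_loss = (\<integral>\<^sup>+ y. ennreal (gauss m my S y * worst_loss) \<partial>Rsp m)"
    by (rule gauss_moments_const[OF gauss_moments[OF S] sym_pdD(1)[OF S] my T0, symmetric])
  also have "\<dots> \<le> (\<integral>\<^sup>+ z. ennreal (sqnorm (H *\<^sub>v vec N (\<lambda>i. z i - g (ypart N m z) i)) * worst_density z) \<partial>Rsp (N + m))"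
    unfolding cost_gauss_udu[OF G V1 S mx my g H] T
    by (intro nn_integral_mono ennreal_leI mult_left_mono sum_mono gauss_nonneg[OF S]) simp
  finally show ?thesis unfolding cost_worst unfolding cost_def by (intro mult_left_mono) auto
qed

end

section \<open>The lifted state space model\<close>

lemma stack_carrier:
  "X \<in> carrier_mat a k \<Longrightarrow> Y \<in> carrier_mat b k \<Longrightarrow> stack X Y \<in> carrier_mat (a + b) k"
  by (auto simp: stack_def)

lemma row_stack:
  assumes "X \<in> carrier_mat a k" "Y \<in> carrier_mat b k" "i < a + b"
  shows "row (stack X Y) i = (if i < a then row X i else row Y (i - a))"
  using assms by (intro eq_vecI) (auto simp: stack_def)

lemma stack_mult:
  assumes X: "X \<in> carrier_mat a k" and Y: "Y \<in> carrier_mat b k" and Z: "Z \<in> carrier_mat k l"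
  shows "stack X Y * Z = stack (X * Z) (Y * Z)"
proof (rule eq_matI)
  fix i j assume "i < dim_row (stack (X * Z) (Y * Z))" "j < dim_col (stack (X * Z) (Y * Z))"
  hence i: "i < a + b" and j: "j < l" using X Y Z by (auto simp: stack_def)
  show "(stack X Y * Z) $$ (i, j) = stack (X * Z) (Y * Z) $$ (i, j)"
    using X Y Z i j row_stack[OF X Y i] stack_carrier[OF X Y] by (auto simp: stack_def)
qed (use X Y Z in \<open>auto simp: stack_def\<close>)

lemma stack_mult_transpose:
  assumes X: "X \<in> carrier_mat a k" and Y: "Y \<in> carrier_mat b k"
    and X': "X' \<in> carrier_mat a' k" and Y': "Y' \<in> carrier_mat b' k"
  shows "stack X Y * transpose_mat (stack X' Y')
    = four_block_mat (X * transpose_mat X') (X * transpose_mat Y') (Y * transpose_mat X') (Y * transpose_mat Y')"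
proof (rule eq_matI)
  let ?R = "four_block_mat (X * transpose_mat X') (X * transpose_mat Y') (Y * transpose_mat X') (Y * transpose_mat Y')"
  note C = stack_carrier[OF X Y] stack_carrier[OF X' Y']
  fix i j assume "i < dim_row ?R" "j < dim_col ?R"
  hence i: "i < a + b" and j: "j < a' + b'" using X Y X' Y' by auto
  show "(stack X Y * transpose_mat (stack X' Y')) $$ (i, j) = ?R $$ (i, j)"
    using X Y X' Y' i j row_stack[OF X Y i] row_stack[OF X' Y' j] C by auto
qed (use X Y X' Y' stack_carrier[OF X Y] stack_carrier[OF X' Y'] in auto)

lemma stack_mult_vec:
  assumes X: "X \<in> carrier_mat a k" and Y: "Y \<in> carrier_mat b k" and v: "v \<in> carrier_vec k"
  shows "stack X Y *\<^sub>v v = (X *\<^sub>v v) @\<^sub>v (Y *\<^sub>v v)"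
proof (rule eq_vecI)
  fix i assume "i < dim_vec ((X *\<^sub>v v) @\<^sub>v (Y *\<^sub>v v))"
  hence i: "i < a + b" using X Y by auto
  show "(stack X Y *\<^sub>v v) $ i = ((X *\<^sub>v v) @\<^sub>v (Y *\<^sub>v v)) $ i"
    using X Y v i row_stack[OF X Y i] stack_carrier[OF X Y] by auto
qed (use X Y stack_carrier[OF X Y] in auto)

lemma lifted_carriers:
  "tA n L A \<in> carrier_mat (dimxi n L) (dimxi n L)"
  "B \<in> carrier_mat n k \<Longrightarrow> tB n L B \<in> carrier_mat (dimxi n L) k"
  "C \<in> carrier_mat m n \<Longrightarrow> tC n L C \<in> carrier_mat m (dimxi n L)"
  "tH n L \<in> carrier_mat n (dimxi n L)"
  by (auto simp: tA_def tB_def tC_def tH_def)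

lemma tH_coisometry: "tH n L * transpose_mat (tH n L) = 1\<^sub>m n"
proof (rule eq_matI)
  fix i j assume ij: "i < dim_row (1\<^sub>m n :: real mat)" "j < dim_col (1\<^sub>m n :: real mat)"
  have "(tH n L * transpose_mat (tH n L)) $$ (i, j)
      = (\<Sum>k<dimxi n L. (if k = L * n + i then 1 else 0) * (if k = L * n + j then 1 else 0))"
    using ij by (auto simp: tH_def scalar_prod_def atLeast0LessThan)
  also have "\<dots> = (\<Sum>k<dimxi n L. if k = L * n + i then (if i = j then 1 else 0) else 0)"
    by (intro sum.cong) auto
  also have "\<dots> = (if i = j then 1 else 0)" using ij by (simp add: dimxi_def)
  finally show "(tH n L * transpose_mat (tH n L)) $$ (i, j) = 1\<^sub>m n $$ (i, j)" using ij by simp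
qed (auto simp: tH_def)

text \<open>Lifting keeps state noise and output noise uncorrelated, which removes the noise from
  the off-diagonal blocks of the nominal covariance.\<close>

lemma tB_mult_transpose_zero:
  assumes B: "B \<in> carrier_mat n k" and D: "D \<in> carrier_mat m k" and BD: "B * transpose_mat D = 0\<^sub>m n m"
  shows "tB n L B * transpose_mat D = 0\<^sub>m (dimxi n L) m"
proof (rule eq_matI)
  fix i j assume "i < dim_row (0\<^sub>m (dimxi n L) m :: real mat)" "j < dim_col (0\<^sub>m (dimxi n L) m :: real mat)"
  hence ij: "i < dimxi n L" "j < m" by auto
  have "(tB n L B * transpose_mat D) $$ (i, j) = (\<Sum>l<k. tB n L B $$ (i, l) * D $$ (j, l))"
    using ij B D by (auto simp: tB_def scalar_prod_def atLeast0LessThan)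
  also have "\<dots> = 0"
  proof (cases "i < n")
    case True
    have "(\<Sum>l<k. tB n L B $$ (i, l) * D $$ (j, l)) = (\<Sum>l<k. B $$ (i, l) * D $$ (j, l))"
      using True ij B by (intro sum.cong) (auto simp: tB_def)
    also have "\<dots> = (B * transpose_mat D) $$ (i, j)"
      using True ij B D by (auto simp: scalar_prod_def atLeast0LessThan)
    finally show ?thesis using True ij by (simp add: BD)
  next
    case False
    thus ?thesis using ij B by (intro sum.neutral) (auto simp: tB_def)
  qed
  finally show "(tB n L B * transpose_mat D) $$ (i, j) = 0\<^sub>m (dimxi n L) m $$ (i, j)" using ij by simp
qed (use B D in \<open>auto simp: tB_def\<close>)

text \<open>The noise only drives the first block; the remaining blocks are reached through the shift
  part of \<open>tA\<close>, one block per step.\<close>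

lemma lifted_controllable:
  assumes B: "B \<in> carrier_mat n k" and rB: "vec_space.rank n B = n"
    and v: "v \<in> carrier_vec (dimxi n L)"
    and zB: "transpose_mat (tB n L B) *\<^sub>v v = 0\<^sub>v k"
    and zA: "transpose_mat (tA n L A) *\<^sub>v v = 0\<^sub>v (dimxi n L)"
  shows "v = 0\<^sub>v (dimxi n L)"
proof -
  let ?N = "dimxi n L"
  have nN: "n \<le> ?N" by (simp add: dimxi_def)
  define w where "w = vec n (\<lambda>i. v $ i)"
  have "transpose_mat B *\<^sub>v w = 0\<^sub>v k"
  proof (rule eq_vecI)
    fix j assume "j < dim_vec (0\<^sub>v k :: real vec)"
    hence j: "j < k" by simp
    have "(transpose_mat B *\<^sub>v w) $ j = (\<Sum>i<n. B $$ (i, j) * v $ i)"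
      using j B by (auto simp: w_def scalar_prod_def atLeast0LessThan intro!: sum.cong)
    also have "\<dots> = (\<Sum>i<?N. tB n L B $$ (i, j) * v $ i)"
      using nN j B by (intro sum.mono_neutral_cong_left) (auto simp: tB_def)
    also have "\<dots> = (transpose_mat (tB n L B) *\<^sub>v v) $ j"
      using j B v by (auto simp: tB_def scalar_prod_def atLeast0LessThan intro!: sum.cong)
    finally show "(transpose_mat B *\<^sub>v w) $ j = 0\<^sub>v k $ j" using zB by simp
  qed (use B in auto)
  from full_row_rank_transpose_inj[OF B rB _ this] have w0: "w = 0\<^sub>v n" by (simp add: w_def)
  have v1: "v $ i = 0" if "i < n" for i
    using that w0 unfolding w_def by (metis index_vec index_zero_vec(1))
  \<comment> \<open>Below the first block row, column \<open>j\<close> of \<open>tA\<close> has a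
    single 1, in row \<open>j + n\<close>. The rows of the first block meet the entries of
    \<open>v\<close> already known to vanish.\<close>
  have v2: "v $ (j + n) = 0" if j: "j + n < ?N" for j
  proof -
    have "0 = (transpose_mat (tA n L A) *\<^sub>v v) $ j" using zA j by simp
    also have "\<dots> = (\<Sum>i<?N. tA n L A $$ (i, j) * v $ i)"
      using j v by (auto simp: tA_def scalar_prod_def atLeast0LessThan intro!: sum.cong)
    also have "\<dots> = (\<Sum>i<?N. if i = j + n then v $ (j + n) else 0)"
      using j v1 by (intro sum.cong) (auto simp: tA_def)
    also have "\<dots> = v $ (j + n)" using j by simp
    finally show ?thesis by simp
  qed
  show ?thesis
  proof (rule eq_vecI)
    fix i assume "i < dim_vec (0\<^sub>v ?N :: real vec)"
    thus "v $ i = 0\<^sub>v ?N $ i" using v1[of i] v2[of "i - n"] by (cases "i < n") auto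
  qed (use v in auto)
qed

section \<open>The Riccati update and the nominal joint covariance\<close>

context
  fixes N m k :: nat and At Bt Ct D V :: "real mat"
  assumes At: "At \<in> carrier_mat N N" and Bt: "Bt \<in> carrier_mat N k" and Ct: "Ct \<in> carrier_mat m N"
    and D: "D \<in> carrier_mat m k" and V: "sym_pd N V"
    and rD: "vec_space.rank m D = m"
begin

lemma sym_pd_innov: "sym_pd m (innov Ct D V)"
  unfolding innov_def
proof (rule sym_pd_add_psd)
  note V' = sym_pdD[OF V]
  show "sym_pd m (D * transpose_mat D)"
    by (rule sym_pd_gram[OF D full_row_rank_transpose_inj[OF D rD]])
  show "Ct * V * transpose_mat Ct \<in> carrier_mat m m" using Ct V' by simp
  show "transpose_mat (Ct * V * transpose_mat Ct) = Ct * V * transpose_mat Ct"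
    by (rule congruence_sym[OF Ct V'(1,2)])
  fix v :: "real vec" assume v: "v \<in> carrier_vec m"
  show "0 \<le> v \<bullet> (Ct * V * transpose_mat Ct *\<^sub>v v)"
    unfolding congruence_form[OF Ct V'(1) v] using Ct v by (intro V'(4)) auto
qed

lemma gainG_carrier: "gainG At Ct D V \<in> carrier_mat N m"
  unfolding gainG_def using At Ct sym_pdD(1)[OF V] sym_pd_minv_inverse(1)[OF sym_pd_innov]
  by (intro mult_carrier_mat[of _ N m] mult_carrier_mat[of _ N N]) auto

lemma gainG_mult_innov: "gainG At Ct D V * innov Ct D V = At * V * transpose_mat Ct"
proof -
  note S = sym_pdD(1)[OF sym_pd_innov] sym_pd_minv_inverse[OF sym_pd_innov]
  have X: "At * V * transpose_mat Ct \<in> carrier_mat N m" using At Ct sym_pdD(1)[OF V] by simp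
  show ?thesis unfolding gainG_def
    unfolding assoc_mult_mat[OF X S(2,1)] S(4) by (rule right_mult_one_mat[OF X])
qed

lemma innov_mult_gainG_transpose: "innov Ct D V * transpose_mat (gainG At Ct D V) = Ct * V * transpose_mat At"
proof -
  note S = sym_pdD(1,2)[OF sym_pd_innov] and V' = sym_pdD(1,2)[OF V]
  have "innov Ct D V * transpose_mat (gainG At Ct D V) = transpose_mat (At * V * transpose_mat Ct)"
    using transpose_mult[OF gainG_carrier S(1)] S(2) gainG_mult_innov by simp
  also have "\<dots> = Ct * transpose_mat (At * V)"
    using transpose_mult[of "At * V" N N "transpose_mat Ct" m] At Ct V' by simp
  also have "transpose_mat (At * V) = V * transpose_mat At" using transpose_mult[OF At V'(1)] V'(2) by simp
  finally show ?thesis using At Ct V' by simp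
qed

lemma predP_carrier: "predP At Bt Ct D V \<in> carrier_mat N N"
  unfolding predP_def using At Bt gainG_carrier sym_pdD(1)[OF V] sym_pdD(1)[OF sym_pd_innov]
  by (intro add_carrier_mat minus_carrier_mat mult_carrier_mat[of _ N m] mult_carrier_mat[of _ N N] mult_carrier_mat[of _ N k]) auto

lemma predP_sym: "transpose_mat (predP At Bt Ct D V) = predP At Bt Ct D V"
proof -
  note V' = sym_pdD(1,2)[OF V] and S = sym_pdD(1,2)[OF sym_pd_innov] and G = gainG_carrier
  let ?a = "At * V * transpose_mat At" and ?b = "gainG At Ct D V * innov Ct D V * transpose_mat (gainG At Ct D V)"
    and ?c = "Bt * transpose_mat Bt"
  have ca: "?a \<in> carrier_mat N N" "?b \<in> carrier_mat N N" "?c \<in> carrier_mat N N"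
    using At V' G S Bt by (auto intro!: mult_carrier_mat[of _ N m] mult_carrier_mat[of _ N N])
  have "transpose_mat (?a - ?b + ?c) = transpose_mat (?a - ?b) + transpose_mat ?c"
    by (rule transpose_add[OF minus_carrier_mat[OF ca(2)] ca(3)])
  also have "transpose_mat (?a - ?b) = transpose_mat ?a - transpose_mat ?b"
    by (rule transpose_minus[OF ca(1,2)])
  also have "transpose_mat ?a = ?a" by (rule congruence_sym[OF At V'])
  also have "transpose_mat ?b = ?b" by (rule congruence_sym[OF G S])
  also have "transpose_mat ?c = ?c" using Bt by (simp add: transpose_mult[of _ N k _ N])
  finally show ?thesis by (simp only: predP_def)
qed

text \<open>The Joseph form of the Riccati update, as an identity of quadratic forms.\<close>

lemma predP_form:
  assumes v: "v \<in> carrier_vec N"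
  defines "g \<equiv> transpose_mat (gainG At Ct D V) *\<^sub>v v"
  defines "u \<equiv> transpose_mat At *\<^sub>v v - transpose_mat Ct *\<^sub>v g"
  shows "v \<bullet> (predP At Bt Ct D V *\<^sub>v v)
    = u \<bullet> (V *\<^sub>v u) + (transpose_mat D *\<^sub>v g) \<bullet> (transpose_mat D *\<^sub>v g)
      + (transpose_mat Bt *\<^sub>v v) \<bullet> (transpose_mat Bt *\<^sub>v v)"
proof -
  note V' = sym_pdD(1,2)[OF V] and S = sym_pdD(1,2)[OF sym_pd_innov] and G = gainG_carrier
  let ?S = "innov Ct D V" and ?G = "gainG At Ct D V"
  let ?a = "At * V * transpose_mat At" and ?b = "?G * ?S * transpose_mat ?G" and ?c = "Bt * transpose_mat Bt"
  define w where "w = transpose_mat At *\<^sub>v v"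
  have w: "w \<in> carrier_vec N" using At v by (auto simp: w_def)
  have g: "g \<in> carrier_vec m" using G v by (auto simp: g_def)
  define t where "t = transpose_mat Ct *\<^sub>v g"
  have t: "t \<in> carrier_vec N" using Ct g by (auto simp: t_def)
  have ca: "?a \<in> carrier_mat N N" "?b \<in> carrier_mat N N" "?c \<in> carrier_mat N N"
    using At V' G S Bt by (auto intro!: mult_carrier_mat[of _ N m] mult_carrier_mat[of _ N N])
  have "(?a - ?b + ?c) *\<^sub>v v = ?a *\<^sub>v v - ?b *\<^sub>v v + ?c *\<^sub>v v"
    unfolding add_mult_distrib_mat_vec[OF minus_carrier_mat[OF ca(2)] ca(3) v] minus_mult_distrib_mat_vec[OF ca(1,2) v] ..
  hence "v \<bullet> (predP At Bt Ct D V *\<^sub>v v) = v \<bullet> (?a *\<^sub>v v) - v \<bullet> (?b *\<^sub>v v) + v \<bullet> (?c *\<^sub>v v)"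
    unfolding predP_def using v ca
    by (simp add: scalar_prod_add_distrib[of _ N] scalar_prod_minus_distrib[of _ N] del: assoc_mult_mat_vec assoc_mult_mat)
  also have "v \<bullet> (?a *\<^sub>v v) = w \<bullet> (V *\<^sub>v w)" unfolding w_def by (rule congruence_form[OF At V'(1) v])
  also have "v \<bullet> (?b *\<^sub>v v) = g \<bullet> (?S *\<^sub>v g)" unfolding g_def by (rule congruence_form[OF G S(1) v])
  also have "v \<bullet> (?c *\<^sub>v v) = (transpose_mat Bt *\<^sub>v v) \<bullet> (transpose_mat Bt *\<^sub>v v)" by (rule gram_form[OF Bt v])
  finally have 1: "v \<bullet> (predP At Bt Ct D V *\<^sub>v v)
    = w \<bullet> (V *\<^sub>v w) - g \<bullet> (?S *\<^sub>v g) + (transpose_mat Bt *\<^sub>v v) \<bullet> (transpose_mat Bt *\<^sub>v v)" .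
  have Sg: "?S *\<^sub>v g = Ct *\<^sub>v (V *\<^sub>v w)"
  proof -
    have "?S *\<^sub>v g = (?S * transpose_mat ?G) *\<^sub>v v"
      unfolding g_def using S(1) G v by (intro assoc_mult_mat_vec[symmetric]) auto
    also have "\<dots> = Ct *\<^sub>v (V *\<^sub>v w)"
      unfolding innov_mult_gainG_transpose w_def using At Ct V'(1) v
      by (simp add: assoc_mult_mat_vec[of _ m N _ N] assoc_mult_mat_vec[of _ N N _ N])
    finally show ?thesis .
  qed
  \<comment> \<open>The form \<open>g . S g\<close> is evaluated in two ways, through the gain
    equation here and through the definition of \<open>innov\<close> next. Twice the first minus the
    second converts the subtracted Riccati term into a sum of squares.\<close>
  have 2: "g \<bullet> (?S *\<^sub>v g) = t \<bullet> (V *\<^sub>v w)"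
    unfolding Sg t_def using transpose_vec_mult_scalar[OF Ct _ g, of "V *\<^sub>v w"] V'(1) w by simp
  have 3: "g \<bullet> (?S *\<^sub>v g) = t \<bullet> (V *\<^sub>v t) + (transpose_mat D *\<^sub>v g) \<bullet> (transpose_mat D *\<^sub>v g)"
  proof -
    have cc: "Ct * V * transpose_mat Ct \<in> carrier_mat m m" "D * transpose_mat D \<in> carrier_mat m m"
      using Ct V' D by auto
    have "g \<bullet> (?S *\<^sub>v g) = g \<bullet> ((Ct * V * transpose_mat Ct) *\<^sub>v g) + g \<bullet> ((D * transpose_mat D) *\<^sub>v g)"
      unfolding innov_def add_mult_distrib_mat_vec[OF cc g]
      using cc g by (intro scalar_prod_add_distrib[of _ m]) auto
    thus ?thesis unfolding congruence_form[OF Ct V'(1) g] gram_form[OF D g] t_def .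
  qed
  have 4: "u \<bullet> (V *\<^sub>v u) = w \<bullet> (V *\<^sub>v w) - 2 * (t \<bullet> (V *\<^sub>v w)) + t \<bullet> (V *\<^sub>v t)"
  proof -
    have u: "u = w - t" by (simp add: u_def w_def t_def)
    have "V *\<^sub>v u = V *\<^sub>v w - V *\<^sub>v t" unfolding u using V'(1) w t by (intro mult_minus_distrib_mat_vec) auto
    thus ?thesis unfolding u
      using V'(1) w t sym_bilinear_commute[OF V' w t]
      by (simp add: minus_scalar_prod_distrib[of _ N] scalar_prod_minus_distrib[of _ N])
  qed
  show ?thesis using 1 2 3 4 by simp
qed

text \<open>If the form vanishes, so does each of the three squares in \<open>predP_form\<close>.
  Full row rank of \<open>D\<close> forces \<open>g = 0\<close>, then \<open>u = 0\<close> reads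
  \<open>At^T v = 0\<close>, and together with \<open>Bt^T v = 0\<close> this contradicts
  \<open>ctrl\<close>.\<close>

lemma sym_pd_predP:
  assumes ctrl: "\<And>v. v \<in> carrier_vec N \<Longrightarrow> transpose_mat Bt *\<^sub>v v = 0\<^sub>v k \<Longrightarrow> transpose_mat At *\<^sub>v v = 0\<^sub>v N \<Longrightarrow> v = 0\<^sub>v N"
  shows "sym_pd N (predP At Bt Ct D V)"
  unfolding sym_pd_def
proof (intro conjI ballI impI predP_carrier predP_sym)
  note V' = sym_pdD[OF V] and G = gainG_carrier
  fix v :: "real vec" assume v: "v \<in> carrier_vec N" "v \<noteq> 0\<^sub>v N"
  define g where "g = transpose_mat (gainG At Ct D V) *\<^sub>v v"
  define u where "u = transpose_mat At *\<^sub>v v - transpose_mat Ct *\<^sub>v g"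
  have g: "g \<in> carrier_vec m" using G v by (auto simp: g_def)
  have u: "u \<in> carrier_vec N" using At Ct v g by (auto simp: u_def)
  have Dg: "transpose_mat D *\<^sub>v g \<in> carrier_vec k" and Bv: "transpose_mat Bt *\<^sub>v v \<in> carrier_vec k"
    using D Bt g v by auto
  have form: "v \<bullet> (predP At Bt Ct D V *\<^sub>v v) = u \<bullet> (V *\<^sub>v u) + (transpose_mat D *\<^sub>v g) \<bullet> (transpose_mat D *\<^sub>v g)
      + (transpose_mat Bt *\<^sub>v v) \<bullet> (transpose_mat Bt *\<^sub>v v)"
    using predP_form[OF v(1)] by (simp only: g_def u_def)
  note nonneg = V'(4)[OF u] scalar_prod_self_nonneg[of "transpose_mat D *\<^sub>v g"] scalar_prod_self_nonneg[of "transpose_mat Bt *\<^sub>v v"]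
  show "0 < v \<bullet> (predP At Bt Ct D V *\<^sub>v v)"
  proof (rule ccontr)
    assume "\<not> ?thesis"
    hence z: "u \<bullet> (V *\<^sub>v u) = 0" "(transpose_mat D *\<^sub>v g) \<bullet> (transpose_mat D *\<^sub>v g) = 0"
      "(transpose_mat Bt *\<^sub>v v) \<bullet> (transpose_mat Bt *\<^sub>v v) = 0"
      using form nonneg by linarith+
    have "u = 0\<^sub>v N" using V'(3)[OF u] z(1) by force
    moreover have "g = 0\<^sub>v m"
      using full_row_rank_transpose_inj[OF D rD g scalar_prod_self_zero[OF Dg z(2)]] .
    moreover have "transpose_mat Ct *\<^sub>v 0\<^sub>v m = 0\<^sub>v N" using Ct by auto
    ultimately have "transpose_mat At *\<^sub>v v = 0\<^sub>v N"
      using At v(1) by (auto simp: u_def)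
    from ctrl[OF v(1) scalar_prod_self_zero[OF Bv z(3)] this] v(2) show False by simp
  qed
qed

text \<open>The off-diagonal block is \<open>At V Ct^T = G S\<close>, and \<open>predP\<close>
  subtracts exactly \<open>G S G^T\<close> from the upper left block, so it is the Schur
  complement.\<close>

lemma nominal_covariance_udu:
  assumes BD: "Bt * transpose_mat D = 0\<^sub>m N m"
  shows "stack At Ct * V * transpose_mat (stack At Ct) + stack Bt D * transpose_mat (stack Bt D)
    = udu N m (gainG At Ct D V) (predP At Bt Ct D V) (innov Ct D V)"
proof -
  note V' = sym_pdD(1,2)[OF V] and S = sym_pdD(1,2)[OF sym_pd_innov] and G = gainG_carrier
  let ?b = "gainG At Ct D V * innov Ct D V * transpose_mat (gainG At Ct D V)"
  have b: "?b \<in> carrier_mat N N" using G S by (auto intro!: mult_carrier_mat[of _ N m])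
  have DB: "D * transpose_mat Bt = 0\<^sub>m m N"
    using transpose_mult[of Bt N k "transpose_mat D" m] BD Bt D by simp
  have AV: "At * V \<in> carrier_mat N N" and CV: "Ct * V \<in> carrier_mat m N" using At Ct V' by auto
  have "stack At Ct * V * transpose_mat (stack At Ct)
     = four_block_mat (At * V * transpose_mat At) (At * V * transpose_mat Ct) (Ct * V * transpose_mat At) (Ct * V * transpose_mat Ct)"
    unfolding stack_mult[OF At Ct V'(1)] by (rule stack_mult_transpose[OF AV CV At Ct])
  moreover have "stack Bt D * transpose_mat (stack Bt D)
     = four_block_mat (Bt * transpose_mat Bt) (0\<^sub>m N m) (0\<^sub>m m N) (D * transpose_mat D)"
    unfolding stack_mult_transpose[OF Bt D Bt D] BD DB ..
  ultimately have "stack At Ct * V * transpose_mat (stack At Ct) + stack Bt D * transpose_mat (stack Bt D)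
     = four_block_mat (At * V * transpose_mat At + Bt * transpose_mat Bt) (At * V * transpose_mat Ct + 0\<^sub>m N m)
         (Ct * V * transpose_mat At + 0\<^sub>m m N) (innov Ct D V)"
    unfolding innov_def using At Bt Ct D V'
    by (simp only:, intro add_four_block_mat) auto
  moreover have "At * V * transpose_mat At + Bt * transpose_mat Bt = predP At Bt Ct D V + ?b"
    unfolding predP_def using At Bt V' b by (intro eq_matI) auto
  ultimately show ?thesis
    unfolding udu_four_block[OF G predP_carrier S(1)] gainG_mult_innov innov_mult_gainG_transpose
    using AV CV At Ct by simp
qed

end

lemma measurable_g0f:
  assumes "At \<in> carrier_mat N N" "Ct \<in> carrier_mat m N" "G \<in> carrier_mat N m" "xi \<in> carrier_vec N"
  shows "g0f N m At Ct G xi \<in> Rsp m \<rightarrow>\<^sub>M Rsp N"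
  unfolding Rsp_def[of N]
proof (rule measurable_PiM_single')
  fix i assume i: "i \<in> {..<N}"
  have my: "Ct *\<^sub>v xi \<in> carrier_vec m" using assms by auto
  have eq: "g0f N m At Ct G xi y i = (At *\<^sub>v xi) $ i + row G i \<bullet> (vec m y - Ct *\<^sub>v xi)" for y
    using assms i by (auto simp: g0f_def g0v_def)
  show "(\<lambda>y. g0f N m At Ct G xi y i) \<in> Rsp m \<rightarrow>\<^sub>M lborel"
    unfolding eq using linear_form_measurable[OF my] by auto
qed (simp add: PiE_iff extensional_def g0f_def)

lemma vec_g0f:
  assumes "At \<in> carrier_mat N N" "G \<in> carrier_mat N m"
  shows "vec N (g0f N m At Ct G xi y) = At *\<^sub>v xi + G *\<^sub>v (vec m y - Ct *\<^sub>v xi)"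
  using assms by (intro eq_vecI) (auto simp: g0f_def g0v_def)

theorem theorem1:
  fixes n m L :: nat and A B C D :: "real mat" and xi :: "real vec" and V :: "real mat" and c :: real
  assumes "0 < n" and "1 \<le> L"
    and "A \<in> carrier_mat n n" and "B \<in> carrier_mat n (n + m)"
    and "C \<in> carrier_mat m n" and "D \<in> carrier_mat m (n + m)"
    and "B * transpose_mat D = 0\<^sub>m n m"
    and "vec_space.rank n B = n" and "vec_space.rank m D = m"
    and "xi \<in> carrier_vec (dimxi n L)"
    and "sym_pd (dimxi n L) V"
    and "0 < c"
  shows
   "let N = dimxi n L; At = tA n L A; Bt = tB n L B; Ct = tC n L C; Dt = D; H = tH n L;
        S = innov Ct Dt V; G = gainG At Ct Dt V; P = predP At Bt Ct Dt V;
        r = lmax (H * P * transpose_mat H);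
        \<gamma> = gammaf N H P;
        lt = (THE l. r < l \<and> \<gamma> l = c);
        V1 = minv (minv P - (1 / lt) \<cdot>\<^sub>m (transpose_mat H * H));
        mz = stack At Ct *\<^sub>v xi;
        Kbar = stack At Ct * V * transpose_mat (stack At Ct)
               + stack Bt Dt * transpose_mat (stack Bt Dt);
        fbar = gauss (N + m) mz Kbar;
        K0 = four_block_mat (1\<^sub>m N) G (0\<^sub>m m N) (1\<^sub>m m)
             * four_block_mat V1 (0\<^sub>m N m) (0\<^sub>m m N) S
             * four_block_mat (1\<^sub>m N) (0\<^sub>m N m) (transpose_mat G) (1\<^sub>m m);
        f0 = gauss (N + m) mz K0;
        g0 = g0f N m At Ct G xi;
        Bs = amb (N + m) fbar c;
        Gs = estims N m Bs
    in
      \<comment> \<open>(i)\<close>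
      (\<forall>a b. r < a \<longrightarrow> a < b \<longrightarrow> \<gamma> b < \<gamma> a)
    \<and> filterlim \<gamma> at_top (at_right r)
    \<and> (\<gamma> \<longlongrightarrow> 0) at_top
    \<and> (\<exists>!l. r < l \<and> \<gamma> l = c)
      \<comment> \<open>(ii)\<close>
    \<and> sym_pd N V1
    \<and> sym_pd (N + m) K0
    \<and> f0 \<in> Bs \<and> KL (N + m) f0 fbar = c
    \<and> g0 \<in> Gs
    \<and> (\<forall>f \<in> Bs. cost N m H f g0 \<le> cost N m H f0 g0)
    \<and> (\<forall>g \<in> Gs. cost N m H f0 g0 \<le> cost N m H f0 g)
      \<comment> \<open>(iii)\<close>
    \<and> (\<forall>z \<in> space (Rsp (N + m)).
          f0 z = gauss N (g0v m At Ct G xi (ypart N m z)) V1 (xpart N z)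
                   * marg N m f0 (ypart N m z))
    \<and> (\<forall>z \<in> space (Rsp (N + m)).
          fbar z = gauss N (g0v m At Ct G xi (ypart N m z)) P (xpart N z)
                   * marg N m fbar (ypart N m z))"
proof -
  define N where "N = dimxi n L"
  define At Bt Ct H where "At = tA n L A" and "Bt = tB n L B" and "Ct = tC n L C" and "H = tH n L"
  define S G P where "S = innov Ct D V" and "G = gainG At Ct D V" and "P = predP At Bt Ct D V"
  define r where "r = lmax (H * P * transpose_mat H)"
  define lt where "lt = (THE l. r < l \<and> gammaf N H P l = c)"
  define V1 where "V1 = minv (minv P - (1 / lt) \<cdot>\<^sub>m (transpose_mat H * H))"
  define mx my where "mx = At *\<^sub>v xi" and "my = Ct *\<^sub>v xi"
  have At: "At \<in> carrier_mat N N" and Bt: "Bt \<in> carrier_mat N (n + m)" and Ct: "Ct \<in> carrier_mat m N"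
    and H: "H \<in> carrier_mat n N"
    unfolding At_def Bt_def Ct_def H_def N_def using assms(4,5) by (auto intro: lifted_carriers)
  have V: "sym_pd N V" and xi: "xi \<in> carrier_vec N" using assms(10,11) by (auto simp: N_def)
  have mx: "mx \<in> carrier_vec N" and my: "my \<in> carrier_vec m" using At Ct xi by (auto simp: mx_def my_def)
  have HH: "H * transpose_mat H = 1\<^sub>m n" unfolding H_def by (rule tH_coisometry)
  have BD: "Bt * transpose_mat D = 0\<^sub>m N m"
    unfolding Bt_def N_def by (rule tB_mult_transpose_zero[OF assms(4,6,7)])
  have S: "sym_pd m S" unfolding S_def by (rule sym_pd_innov[OF At Bt Ct assms(6) V assms(9)])
  have G: "G \<in> carrier_mat N m" unfolding G_def by (rule gainG_carrier[OF At Bt Ct assms(6) V assms(9)])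
  have P: "sym_pd N P"
    unfolding P_def
  proof (rule sym_pd_predP[OF At Bt Ct assms(6) V assms(9)])
    fix v :: "real vec"
    assume "v \<in> carrier_vec N" "transpose_mat Bt *\<^sub>v v = 0\<^sub>v (n + m)" "transpose_mat At *\<^sub>v v = 0\<^sub>v N"
    thus "v = 0\<^sub>v N" unfolding N_def At_def Bt_def by (rule lifted_controllable[OF assms(4,8)])
  qed
  have Kbar: "stack At Ct * V * transpose_mat (stack At Ct) + stack Bt D * transpose_mat (stack Bt D) = udu N m G P S"
    unfolding G_def P_def S_def by (rule nominal_covariance_udu[OF At Bt Ct assms(6) V assms(9) BD])
  have mz: "stack At Ct *\<^sub>v xi = mx @\<^sub>v my"
    unfolding mx_def my_def by (rule stack_mult_vec[OF At Ct xi])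
  obtain d j where sp: "0 < r" "\<And>i. i < N \<Longrightarrow> 0 \<le> d i \<and> d i \<le> r" "j < N" "d j = r"
    "\<And>l. r < l \<Longrightarrow> gammaf N H P l = (1/2) * (\<Sum>i<N. phi (d i / l))"
    using spectral_representation[OF assms(1) H HH P] unfolding r_def by metis
  note gam = spectral_sum_properties[OF sp]
  have dec: "\<forall>a b. r < a \<longrightarrow> a < b \<longrightarrow> gammaf N H P b < gammaf N H P a"
    by (intro allI impI, rule gam(1)) auto
  have top: "filterlim (gammaf N H P) at_top (at_right r)" and zero: "(gammaf N H P \<longlongrightarrow> 0) at_top"
    by (rule gam(2), simp_all) (rule gam(3), simp_all)
  have ex1: "\<exists>!l. r < l \<and> gammaf N H P l = c" by (rule gam(4)) (use assms(12) in auto)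
  have ltr: "r < lt" and ltc: "gammaf N H P lt = c" using theI'[OF ex1] by (auto simp: lt_def)
  have lt0: "0 < lt" using sp(1) ltr by simp
  have Z: "sym_pd N (minv P - (1 / lt) \<cdot>\<^sub>m (transpose_mat H * H))"
    by (rule sym_pd_posterior_precision[OF assms(1) H HH P ltr[unfolded r_def]])
  have V1: "sym_pd N V1" unfolding V1_def by (rule sym_pd_minv[OF Z])
  have VP: "minv V1 = minv P - (1 / lt) \<cdot>\<^sub>m (transpose_mat H * H)" unfolding V1_def by (rule minv_minv[OF Z])
  have c: "c = (1/2) * ((1 / lt) * mtrace (transpose_mat H * H * V1) + ln (det P / det V1))"
    using gammaf_posterior[OF assms(1) H HH P ltr[unfolded r_def] V1_def] ltc by simp
  let ?g0 = "g0f N m At Ct G xi"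
  have g0m: "?g0 \<in> Rsp m \<rightarrow>\<^sub>M Rsp N" by (rule measurable_g0f[OF At Ct G xi])
  have g0: "vec N (?g0 y) = mx + G *\<^sub>v (vec m y - my)" for y
    unfolding mx_def my_def by (rule vec_g0f[OF At G])
  \<comment> \<open>These instantiate the assumptions of the saddle point context; the budget
    \<open>c\<close> enters through \<open>gammaf_posterior\<close> at the root
    \<open>lt\<close>.\<close>
  note facts = G P V1 S H mx my lt0 VP c g0m g0
  let ?fbar = "gauss (N + m) (mx @\<^sub>v my) (udu N m G P S)" and ?f0 = "gauss (N + m) (mx @\<^sub>v my) (udu N m G V1 S)"
  have right: "\<forall>g\<in>estims N m (amb (N + m) ?fbar c). cost N m H ?f0 ?g0 \<le> cost N m H ?f0 g"
    using saddle_estimator[OF facts] by (auto simp: estims_def)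
  have left: "\<forall>f\<in>amb (N + m) ?fbar c. cost N m H f ?g0 \<le> cost N m H ?f0 ?g0"
    using saddle_density[OF facts] by blast
  have cond: "\<forall>z\<in>space (Rsp (N + m)). gauss (N + m) (mx @\<^sub>v my) (udu N m G W S) z
      = gauss N (g0v m At Ct G xi (ypart N m z)) W (xpart N z)
        * marg N m (gauss (N + m) (mx @\<^sub>v my) (udu N m G W S)) (ypart N m z)" if W: "sym_pd N W" for W
    unfolding g0v_def using gauss_udu_conditional[OF G W S mx my] by (simp add: mx_def my_def)
  show ?thesis
    \<comment> \<open>The abbreviations are folded from the inside out, since each right-hand side
      is stated in terms of the earlier ones.\<close>
    unfolding Let_def N_def[symmetric] At_def[symmetric] Bt_def[symmetric] Ct_def[symmetric] H_def[symmetric]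
    unfolding S_def[symmetric] G_def[symmetric] P_def[symmetric]
    unfolding r_def[symmetric]
    unfolding lt_def[symmetric]
    unfolding V1_def[symmetric] Kbar mz
    unfolding udu_def[of N m G V1 S, symmetric]
    by (intro conjI dec top zero ex1 V1 sym_pd_udu[OF G V1 S] worst_in_ambiguity_set[OF facts]
        estimator_admissible[OF facts] left right cond[OF V1] cond[OF P])
qed

end
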